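(* The set $\mathcal{R}_2$ is homeomorphic to a topological disk, i.e. to the closed unit disk $\{z\in\mathbb{C}:|z|\le1\}$.
   Context: Let $\alpha$ be one of the two non-real roots of $x^3-2x^2+x-1$ (so $|\alpha|<1$). $\mathcal{R}_2\subset\mathbb{C}$ is the set of all $\sum_{i=2}^\infty\varepsilon_i\alpha^i$ with $\varepsilon_i\in\{0,1\}$ and $\varepsilon_i\varepsilon_{i-1}\varepsilon_{i-2}\varepsilon_{i-3}<_{lex}1101$ for all $i\ge2$, where $\varepsilon_1=\varepsilon_0=\varepsilon_{-1}=0$ and $<_{lex}$ is the lexicographic order on words. *)

theory Defs
  imports "HOL-Analysis.Analysis"
begin

(* Digits are indexed by integers so that the indices 1, 0, -1 occur literally;
   the values at indices below -1 play no role. *)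
definition admissible :: "(int \<Rightarrow> nat) \<Rightarrow> bool" where
  "admissible \<epsilon> \<longleftrightarrow>
     \<epsilon> 1 = 0 \<and> \<epsilon> 0 = 0 \<and> \<epsilon> (-1) = 0 \<and>
     (\<forall>i\<ge>2. \<epsilon> i \<in> {0, 1}) \<and>
     (\<forall>i\<ge>2. ([\<epsilon> i, \<epsilon> (i - 1), \<epsilon> (i - 2), \<epsilon> (i - 3)], [1, 1, 0, 1]) \<in> lexord less_than)"

(* The summation index is shifted: n stands for i - 2. *)
definition rauzy_fractal_R2 :: "complex \<Rightarrow> complex set" where
  "rauzy_fractal_R2 \<alpha> =
     {z. \<exists>\<epsilon>. admissible \<epsilon> \<and> (\<lambda>n. of_nat (\<epsilon> (int n + 2)) * \<alpha> ^ (n + 2)) sums z}"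

end

theory Submission
  imports Defs
begin

text \<open>Write \<open>R\<close> for the set in question. Read in the order of increasing index, the digits must avoid the
blocks 111 and 1011. The sums that can follow a given digit prefix depend only on its last three
digits, and comparing them gives \<open>R = \<alpha> (f\<^sub>1 C \<union> f\<^sub>3 C)\<close> (lemma \<open>rauzy_eq\<close>), where \<open>C\<close> is the compact set
with \<open>C = f\<^sub>1 C \<union> f\<^sub>2 C \<union> f\<^sub>3 C\<close> for the contractions \<open>f\<^sub>1 z = \<alpha> z\<close>, \<open>f\<^sub>2 z = 1 + \<alpha>\<^sup>2 z\<close> and
\<open>f\<^sub>3 z = \<alpha> + \<alpha>\<^sup>2 + \<alpha>\<^sup>4 z\<close>. The three pieces of \<open>C\<close> form a chain: \<open>f\<^sub>2 C\<close> and \<open>f\<^sub>3 C\<close> are disjoint, and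
each of them touches \<open>f\<^sub>1 C\<close> along an arc.

The proof does not study these fractal arcs; it transports the combinatorics of the chain to a
polygon. The boundary of \<open>C\<close> falls into seven arcs, here called \<open>a, m, Y, n, e, p, q\<close> in cyclic
order, each of which is a union of images of such arcs under the \<open>f\<^sub>i\<close>. A convex heptagon \<open>Q\<close> is cut
by two straight chords into three convex cells, and there are piecewise linear contractions \<open>g\<^sub>i\<close>
from \<open>Q\<close> onto the cells that subdivide its sides in the same way. Two sequences of indices name the
same point of \<open>Q\<close> if and only if they name the same point of \<open>C\<close>. To use this without
sequences, let \<open>Graph\<close> be a compact attractor of the product maps \<open>g\<^sub>i \<times> f\<^sub>i\<close>. It projects onto \<open>Q\<close>
and onto \<open>C\<close>. Both projections are injective (\<open>fibre_unique\<close>, \<open>point_unique\<close>), so \<open>f\<^sub>1 C \<union> f\<^sub>3 C\<close> is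
homeomorphic to the union of two adjacent cells, which is a convex polygon (\<open>two_pieces_disc\<close>).

For \<open>fibre_unique\<close>, two descriptions of a point of \<open>Q\<close> can only diverge on a chord. That the values
then agree follows from two folding identities: the side \<open>n\<close> and the reversed side \<open>Y\<close> carry the same
arc up to a similarity, and so do \<open>Y\<close> and the reversed union of \<open>a\<close> and \<open>m\<close> (\<open>foldX\<close>, \<open>foldY\<close>). Each
identity splits into three contracted copies of the two, so its error is at most a constant times
\<open>|\<alpha>|\<^sup>n\<close> for every \<open>n\<close>.

For \<open>point_unique\<close>, one has to find all coincidences \<open>f\<^sub>i u = f\<^sub>j v\<close> with \<open>u, v \<in> C\<close>. Dividing by a
power of \<open>\<alpha>\<close> and subdividing again leads to relations \<open>u = \<alpha>\<^sup>k v + d\<close> with \<open>d \<in> \<int>[\<alpha>]\<close>. As \<open>C\<close> lies in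
an explicit disc, only finitely many of the differences \<open>d\<close> that arise in this way are small enough, and the
finite graph of the remaining relations reduces everything to the two folding relations and a single
vertex.\<close>

section \<open>Fan maps of the plane\<close>

definition cross :: "complex \<Rightarrow> complex \<Rightarrow> real" where
  "cross a b = Re a * Im b - Im a * Re b"

lemma cross_simps [simp]:
  "cross (a + b) c = cross a c + cross b c" "cross a (b + c) = cross a b + cross a c"
  "cross (a - b) c = cross a c - cross b c" "cross a (b - c) = cross a b - cross a c"
  "cross (r *\<^sub>R a) b = r * cross a b" "cross a (r *\<^sub>R b) = r * cross a b"
  "cross a a = 0" "cross 0 a = 0" "cross a 0 = 0"
  by (simp_all add: cross_def algebra_simps)

lemma cross_swap: "cross a b = - cross b a"
  by (simp add: cross_def)

text \<open>For \<open>x\<close> in one of the two cones at the ray \<open>v k\<close>, this is the coordinate of \<open>x\<close> along \<open>v k\<close>; it is \<open>0\<close> on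
the other cones. Families of
rays are \<open>7\<close>-periodic, and the index \<open>k + 6\<close> stands for \<open>k - 1\<close>.\<close>
definition tent :: "(nat \<Rightarrow> complex) \<Rightarrow> nat \<Rightarrow> complex \<Rightarrow> real" where
  "tent v k x = max 0 (min (cross (v (k + 6)) x / cross (v (k + 6)) (v k)) (cross x (v (k + 1)) / cross (v k) (v (k + 1))))"

text \<open>For a family \<open>v\<close> that is \<open>fanlike\<close> (see below), the map which is linear on each cone between consecutive rays \<open>v j\<close>, \<open>v (j + 1)\<close> and sends \<open>v j\<close> to \<open>w j\<close>.\<close>
definition fan :: "(nat \<Rightarrow> complex) \<Rightarrow> (nat \<Rightarrow> complex) \<Rightarrow> complex \<Rightarrow> complex" where
  "fan v w x = (\<Sum>k<7. tent v k x *\<^sub>R w k)"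

text \<open>The rays run once round the origin in counterclockwise order. The third clause expresses, by finitely
many signs, that a cone which does not contain the ray \<open>v k\<close> lies beyond one of the two lines spanned by
the adjacent rays \<open>v (k - 1)\<close> and \<open>v (k + 1)\<close>; it replaces an argument with angles.\<close>
definition fanlike :: "(nat \<Rightarrow> complex) \<Rightarrow> bool" where
  "fanlike v \<longleftrightarrow> (\<forall>k. v (k + 7) = v k)
     \<and> (\<forall>k<7. 0 < cross (v k) (v (k + 1)) \<and> 0 \<le> cross (v (k + 6)) (v (k + 1)))
     \<and> (\<forall>j<7. \<forall>k<7. k \<noteq> j \<longrightarrow> k \<noteq> (j + 1) mod 7 \<longrightarrow>
          cross (v (k + 6)) (v j) \<le> 0 \<and> cross (v (k + 6)) (v (j + 1)) \<le> 0 \<or>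
          cross (v j) (v (k + 1)) \<le> 0 \<and> cross (v (j + 1)) (v (k + 1)) \<le> 0)
     \<and> (\<forall>x. \<exists>j<7. 0 \<le> cross (v j) x \<and> 0 \<le> cross x (v (j + 1)))"

lemma fanlike_per: "fanlike v \<Longrightarrow> v (k + 7) = v k"
  unfolding fanlike_def by blast

lemma fanlike_mod: "fanlike v \<Longrightarrow> v (k mod 7) = v k"
proof (induction k rule: less_induct)
  case (less k)
  show ?case
  proof (cases "k < 7")
    case False
    then have "v (k - 7) = v k" using less.prems unfolding fanlike_def by (metis le_add_diff_inverse2 not_less)
    moreover have "(k - 7) mod 7 = k mod 7" using False by (metis le_mod_geq not_less)
    ultimately show ?thesis using less.IH[of "k - 7"] False less.prems by auto
  qed simp
qed

lemma fanlike_D_pos: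
  assumes "fanlike v" shows "0 < cross (v k) (v (k + 1))"
proof -
  have "0 < cross (v (k mod 7)) (v (k mod 7 + 1))"
    using assms unfolding fanlike_def by (simp del: cross_simps)
  moreover have "(k mod 7 + 1) mod 7 = (k + 1) mod 7" by presburger
  then have "v (k mod 7 + 1) = v (k + 1)"
    using fanlike_mod[OF assms, of "k + 1"] fanlike_mod[OF assms, of "k mod 7 + 1"] by metis
  ultimately show ?thesis using fanlike_mod[OF assms, of k] by simp
qed

lemma sector_coords:
  assumes "0 < cross v w" "0 \<le> cross v x" "0 \<le> cross x w"
  obtains a b where "0 \<le> a" "0 \<le> b" "x = a *\<^sub>R v + b *\<^sub>R w"
proof
  have "cross v w *\<^sub>R x = cross x w *\<^sub>R v + cross v x *\<^sub>R w"
    by (simp add: cross_def complex_eq_iff algebra_simps)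
  then have "(1 / cross v w) *\<^sub>R (cross v w *\<^sub>R x) = (1 / cross v w) *\<^sub>R (cross x w *\<^sub>R v + cross v x *\<^sub>R w)" by simp
  then show "x = (cross x w / cross v w) *\<^sub>R v + (cross v x / cross v w) *\<^sub>R w"
    using assms(1) by (simp add: scaleR_add_right)
qed (use assms in auto)

lemma fanlike_cover:
  assumes "fanlike v" obtains j a b where "j < 7" "0 \<le> a" "0 \<le> b" "x = a *\<^sub>R v j + b *\<^sub>R v (j + 1)"
proof -
  obtain j where "j < 7" "0 \<le> cross (v j) x" "0 \<le> cross x (v (j + 1))"
    using assms unfolding fanlike_def by blast
  then show thesis using that sector_coords[OF fanlike_D_pos[OF assms]] by metis
qed

text \<open>Away from the two cones at \<open>v k\<close>, the third clause of \<open>fanlike\<close> makes one of the two linear functions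
in the minimum nonpositive on the whole cone.\<close>
lemma tent_sector:
  assumes v: "fanlike v" and "j < 7" "k < 7" "0 \<le> a" "0 \<le> b"
  shows "tent v k (a *\<^sub>R v j + b *\<^sub>R v (j + 1)) = (if k = j then a else if k = (j + 1) mod 7 then b else 0)"
proof -
  have D1: "cross (v k) (v (k + 1)) > 0" using fanlike_D_pos[OF v] .
  have D0: "cross (v (k + 6)) (v k) > 0"
    using fanlike_D_pos[OF v, of "k + 6"] fanlike_per[OF v, of k] by (simp add: add.commute)
  have two: "0 \<le> cross (v (k + 6)) (v (k + 1))" using v assms(3) unfolding fanlike_def by blast
  consider "k = j" | "k = (j + 1) mod 7" "k \<noteq> j" | "k \<noteq> j" "k \<noteq> (j + 1) mod 7" by blast
  then show ?thesis
  proof cases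
    case 1
    have "a \<le> (a * cross (v (k + 6)) (v k) + b * cross (v (k + 6)) (v (k + 1))) / cross (v (k + 6)) (v k)"
      using D0 two assms by (simp add: pos_le_divide_eq)
    then show ?thesis using 1 D1 assms unfolding tent_def by simp
  next
    case 2
    have e: "v k = v (j + 1)" using 2 fanlike_mod[OF v, of "j + 1"] by simp
    have e': "v (k + 6) = v j"
    proof -
      have "(k + 6) mod 7 = j" using 2 assms(2) by presburger
      then show ?thesis using fanlike_mod[OF v, of "k + 6"] by simp
    qed
    have "b \<le> (a * cross (v j) (v (k + 1)) + b * cross (v (j + 1)) (v (k + 1))) / cross (v k) (v (k + 1))"
      using D1 two assms e e' by (simp add: pos_le_divide_eq)
    then show ?thesis using 2 D0 assms e e' unfolding tent_def by simp
  next
    case 3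
    then have "cross (v (k + 6)) (v j) \<le> 0 \<and> cross (v (k + 6)) (v (j + 1)) \<le> 0 \<or>
          cross (v j) (v (k + 1)) \<le> 0 \<and> cross (v (j + 1)) (v (k + 1)) \<le> 0"
      using v assms unfolding fanlike_def by blast
    then have "min (cross (v (k + 6)) (a *\<^sub>R v j + b *\<^sub>R v (j + 1)) / cross (v (k + 6)) (v k))
       (cross (a *\<^sub>R v j + b *\<^sub>R v (j + 1)) (v (k + 1)) / cross (v k) (v (k + 1))) \<le> 0"
    proof
      assume "cross (v (k + 6)) (v j) \<le> 0 \<and> cross (v (k + 6)) (v (j + 1)) \<le> 0"
      then have "cross (v (k + 6)) (a *\<^sub>R v j + b *\<^sub>R v (j + 1)) \<le> 0"
        using assms by (simp add: mult_nonneg_nonpos add_nonpos_nonpos)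
      then show ?thesis using D0 by (metis divide_nonpos_pos min.coboundedI1)
    next
      assume "cross (v j) (v (k + 1)) \<le> 0 \<and> cross (v (j + 1)) (v (k + 1)) \<le> 0"
      then have "cross (a *\<^sub>R v j + b *\<^sub>R v (j + 1)) (v (k + 1)) \<le> 0"
        using assms by (simp add: mult_nonneg_nonpos add_nonpos_nonpos)
      then show ?thesis using D1 by (metis divide_nonpos_pos min.coboundedI2)
    qed
    then show ?thesis using 3 unfolding tent_def by simp
  qed
qed

lemma fan_sector:
  assumes v: "fanlike v" and w: "\<And>k. w (k mod 7) = w k" and "j < 7" "0 \<le> a" "0 \<le> b"
  shows "fan v w (a *\<^sub>R v j + b *\<^sub>R v (j + 1)) = a *\<^sub>R w j + b *\<^sub>R w (j + 1)"
proof -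
  let ?i = "(j + 1) mod 7"
  have ne: "?i \<noteq> j" "?i < 7" using assms(3) by presburger+
  have "fan v w (a *\<^sub>R v j + b *\<^sub>R v (j + 1)) = (\<Sum>k<7. (if k = j then a *\<^sub>R w j else 0) + (if k = ?i then b *\<^sub>R w ?i else 0))"
    unfolding fan_def using tent_sector[OF v assms(3) _ assms(4,5)] ne by (intro sum.cong) auto
  also have "\<dots> = a *\<^sub>R w j + b *\<^sub>R w ?i"
    using ne assms(3) by (simp only: sum.distrib sum.delta) (simp add: sum.delta)
  finally show ?thesis using w[of "j + 1"] by simp
qed

lemma fan_inverse:
  assumes "fanlike v" "fanlike w" shows "fan w v (fan v w x) = x"
proof -
  obtain j a b where j: "j < 7" "0 \<le> a" "0 \<le> b" and x: "x = a *\<^sub>R v j + b *\<^sub>R v (j + 1)"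
    using fanlike_cover[OF assms(1)] by blast
  have "fan v w x = a *\<^sub>R w j + b *\<^sub>R w (j + 1)"
    unfolding x by (rule fan_sector[of v w, OF assms(1) fanlike_mod[OF assms(2)] j])
  then show ?thesis unfolding x using fan_sector[of w v, OF assms(2) fanlike_mod[OF assms(1)] j] by simp
qed

lemma quadratic_form_nonneg:
  fixes p q r a b :: real
  assumes "0 < p" "q\<^sup>2 \<le> p * r" shows "0 \<le> p * a\<^sup>2 + 2 * q * a * b + r * b\<^sup>2"
proof -
  have "p * (p * a\<^sup>2 + 2 * q * a * b + r * b\<^sup>2) = (p * a + q * b)\<^sup>2 + (p * r - q\<^sup>2) * b\<^sup>2"
    by (simp add: power2_eq_square algebra_simps)
  also have "\<dots> \<ge> 0" using assms by simp
  finally show ?thesis using assms(1) by (simp add: zero_le_mult_iff)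
qed

text \<open>The quadratic form \<open>K\<^sup>2 |a v + b v'|\<^sup>2 - |a w + b w'|\<^sup>2\<close> in \<open>a, b\<close> has positive leading coefficient and
nonnegative determinant. This is a finite check that the linear map with \<open>v \<mapsto> w\<close>, \<open>v' \<mapsto> w'\<close> has
operator norm at most \<open>K\<close>.\<close>
definition dominated :: "real \<Rightarrow> complex \<Rightarrow> complex \<Rightarrow> complex \<Rightarrow> complex \<Rightarrow> bool" where
  "dominated K v v' w w' \<longleftrightarrow> (let p = K\<^sup>2 * (v \<bullet> v) - w \<bullet> w; q = K\<^sup>2 * (v \<bullet> v') - w \<bullet> w';
      r = K\<^sup>2 * (v' \<bullet> v') - w' \<bullet> w' in 0 < p \<and> q\<^sup>2 \<le> p * r)"

lemma dominated_norm:
  assumes "dominated K v v' w w'" "0 \<le> K"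
  shows "norm (a *\<^sub>R w + b *\<^sub>R w') \<le> K * norm (a *\<^sub>R v + b *\<^sub>R v')"
proof -
  have e: "(norm (a *\<^sub>R x + b *\<^sub>R y))\<^sup>2 = a\<^sup>2 * (norm x)\<^sup>2 + 2 * a * b * (x \<bullet> y) + b\<^sup>2 * (norm y)\<^sup>2" for x y :: complex
    unfolding cmod_power2 by (simp add: inner_complex_def power2_eq_square algebra_simps)
  have "0 \<le> (K\<^sup>2 * (norm v)\<^sup>2 - (norm w)\<^sup>2) * a\<^sup>2 + 2 * (K\<^sup>2 * (v \<bullet> v') - w \<bullet> w') * a * b + (K\<^sup>2 * (norm v')\<^sup>2 - (norm w')\<^sup>2) * b\<^sup>2"
    using assms(1) unfolding dominated_def Let_def power2_norm_eq_inner by (intro quadratic_form_nonneg) auto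
  then have "(norm (a *\<^sub>R w + b *\<^sub>R w'))\<^sup>2 \<le> (K * norm (a *\<^sub>R v + b *\<^sub>R v'))\<^sup>2"
    by (simp add: e power_mult_distrib algebra_simps)
  then show ?thesis using assms(2) by (meson mult_nonneg_nonneg norm_ge_zero power2_le_imp_le)
qed

text \<open>A segment is covered by its closed intersections with the seven cones, and on each cone the map is
linear of norm at most \<open>K\<close>; the constant is therefore the same across the cones.\<close>
lemma fan_lipschitz:
  assumes v: "fanlike v" and w: "\<And>k. w (k mod 7) = w k" and "0 \<le> K"
    and dom: "\<And>j. j < 7 \<Longrightarrow> dominated K (v j) (v (j + 1)) (w j) (w (j + 1))"
  shows "K-lipschitz_on UNIV (fan v w)"
proof -
  define S where "S j = {x. 0 \<le> cross (v j) x \<and> 0 \<le> cross x (v (j + 1))}" for j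
  have lip: "K-lipschitz_on (S j) (fan v w)" if "j < 7" for j
  proof (rule lipschitz_onI[OF _ assms(3)])
    fix x y assume "x \<in> S j" "y \<in> S j"
    then have S: "0 \<le> cross (v j) x" "0 \<le> cross x (v (j + 1))" "0 \<le> cross (v j) y" "0 \<le> cross y (v (j + 1))"
      unfolding S_def by auto
    obtain a b where "a \<ge> 0" "b \<ge> 0" "x = a *\<^sub>R v j + b *\<^sub>R v (j + 1)"
      by (rule sector_coords[OF fanlike_D_pos[OF v] S(1,2)])
    moreover obtain a' b' where "a' \<ge> 0" "b' \<ge> 0" "y = a' *\<^sub>R v j + b' *\<^sub>R v (j + 1)"
      by (rule sector_coords[OF fanlike_D_pos[OF v] S(3,4)])
    ultimately have ab: "a \<ge> 0" "b \<ge> 0" "x = a *\<^sub>R v j + b *\<^sub>R v (j + 1)"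
      "a' \<ge> 0" "b' \<ge> 0" "y = a' *\<^sub>R v j + b' *\<^sub>R v (j + 1)" by auto
    have "fan v w x - fan v w y = (a - a') *\<^sub>R w j + (b - b') *\<^sub>R w (j + 1)"
      using fan_sector[of v w, OF v w that ab(1,2)] fan_sector[of v w, OF v w that ab(4,5)] ab(3,6) by (simp add: algebra_simps)
    moreover have "x - y = (a - a') *\<^sub>R v j + (b - b') *\<^sub>R v (j + 1)" using ab(3,6) by (simp add: algebra_simps)
    ultimately show "dist (fan v w x) (fan v w y) \<le> K * dist x y"
      using dominated_norm[OF dom[OF that] assms(3), of "a - a'" "b - b'"] by (simp add: dist_norm)
  qed
  have cl: "closed (S j)" for j
  proof -
    have "S j = {x. 0 \<le> Re (v j) * Im x - Im (v j) * Re x} \<inter> {x. 0 \<le> Re x * Im (v (j+1)) - Im x * Re (v (j+1))}"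
      unfolding S_def cross_def by auto
    also have "closed \<dots>" by (intro closed_Int closed_Collect_le continuous_intros)
    finally show ?thesis .
  qed
  show ?thesis
  proof (rule lipschitz_onI[OF _ assms(3)])
    fix x y :: complex
    let ?l = "\<lambda>t::real. x + t *\<^sub>R (y - x)"
    have "(K * norm (y - x))-lipschitz_on {0..1} (\<lambda>t. fan v w (?l t))"
    proof (rule lipschitz_on_closed_Union[where I = "{..<7::nat}" and U = "\<lambda>j. ?l -` S j"])
      fix j :: nat assume "j \<in> {..<7}"
      show "closed (?l -` S j)" by (intro closed_vimage cl continuous_intros)
      show "(K * norm (y - x))-lipschitz_on (?l -` S j) (\<lambda>t. fan v w (?l t))"
      proof (rule lipschitz_onI)
        fix s t assume "s \<in> ?l -` S j" "t \<in> ?l -` S j"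
        then have "dist (fan v w (?l s)) (fan v w (?l t)) \<le> K * dist (?l s) (?l t)"
          using lipschitz_onD[OF lip, of j "?l s" "?l t"] \<open>j \<in> _\<close> by blast
        also have "dist (?l s) (?l t) = norm (y - x) * dist s t"
          by (simp add: dist_norm flip: scaleR_diff_left)
        finally show "dist (fan v w (?l s)) (fan v w (?l t)) \<le> K * norm (y - x) * dist s t" by simp
      qed (use assms(3) in simp)
    next
      have "\<exists>j<7. z \<in> S j" for z using v unfolding fanlike_def S_def by blast
      then show "{0..1} \<subseteq> (\<Union>j<7. ?l -` S j)" by blast
    qed (use assms(3) in auto)
    from lipschitz_onD[OF this, of 0 1] show "dist (fan v w x) (fan v w y) \<le> K * dist x y"
      by (simp add: dist_norm norm_minus_commute)
  qed
qed

text \<open>That the cones cover the plane follows from three of the rays which wind once round the origin. If \<open>x\<close>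
were in no cone, all products \<open>cross (v j) x\<close> would have the same strict sign, but a positive
combination of three of them vanishes.\<close>
lemma fanlikeI:
  assumes per: "\<And>k. v (k + 7) = v k"
    and pos: "\<forall>k<7. 0 < cross (v k) (v (k + 1)) \<and> 0 \<le> cross (v (k + 6)) (v (k + 1))"
    and far: "\<forall>j<7. \<forall>k<7. k \<noteq> j \<longrightarrow> k \<noteq> (j + 1) mod 7 \<longrightarrow>
          cross (v (k + 6)) (v j) \<le> 0 \<and> cross (v (k + 6)) (v (j + 1)) \<le> 0 \<or>
          cross (v j) (v (k + 1)) \<le> 0 \<and> cross (v (j + 1)) (v (k + 1)) \<le> 0"
    and turn: "k < 7" "l < 7" "0 < cross (v 0) (v k)" "0 < cross (v k) (v l)" "0 < cross (v l) (v 0)"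
  shows "fanlike v"
proof -
  have "\<exists>j<7. 0 \<le> cross (v j) x \<and> 0 \<le> cross x (v (j + 1))" for x
  proof (rule ccontr)
    assume "\<not> ?thesis"
    then have step: "cross (v j) x < 0 \<or> 0 < cross (v (j + 1)) x" if "j < 7" for j
      using that by (metis cross_swap neg_0_less_iff_less not_less)
    have v7: "v 7 = v 0" using per[of 0] by simp
    have "(\<forall>j<7. 0 < cross (v j) x) \<or> (\<forall>j<7. cross (v j) x < 0)"
    proof (cases "cross (v 0) x < 0")
      case True
      have "cross (v (7 - i)) x < 0" if "i \<le> 7" for i
        using that
      proof (induction i)
        case (Suc i)
        have "Suc (7 - Suc i) = 7 - i" using Suc.prems by simp
        then show ?case using step[of "7 - Suc i"] Suc by auto
      qed (use True v7 in simp)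
      from this[of "7 - j" for j] show ?thesis by (metis diff_diff_cancel diff_le_self less_imp_le_nat)
    next
      case False
      have "0 < cross (v (Suc j)) x" if "j < 7" for j
        using that
      proof (induction j)
        case (Suc j) then show ?case using step[of "Suc j"] by simp
      qed (use False step[of 0] in simp)
      note suc = this
      have "0 < cross (v 7) x" using suc[of 6] by simp
      then have "0 < cross (v j) x" if "j < 7" for j
        using that suc v7 by (cases j) auto
      then show ?thesis by blast
    qed
    \<comment> \<open>The positive combination; it vanishes by the identity between the cross products of four vectors.\<close>
    moreover have "cross (v k) (v l) * cross (v 0) x + cross (v l) (v 0) * cross (v k) x + cross (v 0) (v k) * cross (v l) x = 0"
      by (simp add: cross_def algebra_simps)
    ultimately show False using turn
      by (smt (verit) mult_pos_pos mult_pos_neg zero_less_numeral)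
  qed
  then show ?thesis using per pos far unfolding fanlike_def by blast
qed

section \<open>The heptagon and its three cells\<close>

datatype piece = P1 | P2 | P3

definition cyclic :: "complex list \<Rightarrow> nat \<Rightarrow> complex" where
  "cyclic xs k = xs ! (k mod 7)"

lemma cyclic_vals [simp]:
  "cyclic [a,b,c,d,e,f,h] 0 = a" "cyclic [a,b,c,d,e,f,h] (Suc 0) = b" "cyclic [a,b,c,d,e,f,h] (Suc (Suc 0)) = c"
  "cyclic [a,b,c,d,e,f,h] (Suc (Suc (Suc 0))) = d"
  "cyclic [a,b,c,d,e,f,h] 2 = c" "cyclic [a,b,c,d,e,f,h] 3 = d" "cyclic [a,b,c,d,e,f,h] 4 = e"
  "cyclic [a,b,c,d,e,f,h] 5 = f" "cyclic [a,b,c,d,e,f,h] 6 = h" "cyclic [a,b,c,d,e,f,h] 7 = a"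
  "cyclic [a,b,c,d,e,f,h] 8 = b" "cyclic [a,b,c,d,e,f,h] 9 = c" "cyclic [a,b,c,d,e,f,h] 10 = d"
  "cyclic [a,b,c,d,e,f,h] 11 = e" "cyclic [a,b,c,d,e,f,h] 12 = f" "cyclic [a,b,c,d,e,f,h] 13 = h"
  by (simp_all add: cyclic_def)

lemma cyclic_per: "cyclic xs (k mod 7) = cyclic xs k" "cyclic xs (k + 7) = cyclic xs k"
  by (simp_all add: cyclic_def)

lemma cross_minus [simp]: "cross (- a) b = - cross a b" "cross a (- b) = - cross a b"
  by (simp_all add: cross_def)

lemma cross_Complex [simp]: "cross (Complex a b) (Complex c d) = a * d - b * c"
  by (simp add: cross_def)

lemma all_less_7: "(\<forall>k<7::nat. P k) \<longleftrightarrow> P 0 \<and> P 1 \<and> P 2 \<and> P 3 \<and> P 4 \<and> P 5 \<and> P 6"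
proof -
  have "(7::nat) = Suc (Suc (Suc (Suc (Suc (Suc (Suc 0))))))" by simp
  then show ?thesis by (simp only: All_less_Suc) (simp add: numeral_eq_Suc conj_ac)
qed

text \<open>The sides of the heptagon starting at these vertices are \<open>a, m, Y, n, e, p, q\<close>, so that side \<open>2\<close> is \<open>Y\<close>
and side \<open>3\<close> is \<open>n\<close>. The coordinates were found numerically: they make all three maps \<open>g i\<close>
contractions.\<close>
definition V :: "nat \<Rightarrow> complex" where
  "V = cyclic [Complex (-48) 112, Complex (-96) (-48), Complex (-32) (-112), Complex 64 (-96),
            Complex 80 0, Complex 64 64, Complex 32 96]"

fun centre :: "piece \<Rightarrow> complex" where
  "centre P1 = Complex 0 (-32)" | "centre P2 = Complex 0 32" | "centre P3 = Complex 48 (-92)"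

text \<open>The image of vertex \<open>k\<close> under \<open>g i\<close>. Each point that is not a vertex divides a side or a chord of the
heptagon in a dyadic ratio, and the sides \<open>e, p, q\<close> divide both chords in the same ratios. The chords run from
\<open>V 4\<close> to the midpoint of side \<open>0\<close>, and from the midpoint of side \<open>2\<close> to the point of side \<open>3\<close> at one
quarter.\<close>
fun W :: "piece \<Rightarrow> nat \<Rightarrow> complex" where
  "W P1 k = cyclic [Complex 80 0, Complex (-72) 32, Complex (-96) (-48), Complex (-32) (-112),
               Complex 16 (-104), Complex 68 (-72), Complex 72 (-48)] k"
| "W P2 k = cyclic [Complex 80 0, Complex 64 64, Complex 32 96, Complex (-48) 112,
               Complex (-72) 32, Complex (-34) 24, Complex 4 16] k"
| "W P3 k = cyclic [Complex 16 (-104), Complex 28 (-102), Complex 40 (-100), Complex 64 (-96),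
               Complex 68 (-72), Complex 55 (-80), Complex 42 (-88)] k"

definition spoke :: "piece \<Rightarrow> nat \<Rightarrow> complex" where
  "spoke i k = W i k - centre i"

lemma W_per: "W i (k mod 7) = W i k" "W i (k + 7) = W i k"
  by (cases i; simp add: cyclic_per)+

lemma V_per: "V (k mod 7) = V k" "V (k + 7) = V k"
  by (simp_all add: V_def cyclic_per)

lemma spoke_per: "spoke i (k mod 7) = spoke i k" "spoke i (k + 7) = spoke i k"
  by (simp_all add: spoke_def W_per)

lemma fanlike_V: "fanlike V"
  by (rule fanlikeI[where v = V and k = 2 and l = 4]) (rule V_per, simp_all add: all_less_7 V_def)

lemma fanlike_spoke: "fanlike (spoke i)"
proof (cases i)
  case P1 show ?thesis unfolding P1
    by (rule fanlikeI[where k = 2 and l = 4]) (rule spoke_per, simp_all add: all_less_7 spoke_def complex_diff)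
next
  case P2 show ?thesis unfolding P2
    by (rule fanlikeI[where k = 3 and l = 5]) (rule spoke_per, simp_all add: all_less_7 spoke_def complex_diff)
next
  case P3 show ?thesis unfolding P3
    by (rule fanlikeI[where k = 3 and l = 5]) (rule spoke_per, simp_all add: all_less_7 spoke_def complex_diff)
qed

definition \<kappa> :: real where "\<kappa> = 49/50"

text \<open>Affine on the triangles with apex \<open>0\<close> over the sides of \<open>Q\<close>, with \<open>centre i\<close> as the image of the apex.\<close>
definition g :: "piece \<Rightarrow> complex \<Rightarrow> complex" where
  "g i x = centre i + fan V (spoke i) x"

lemma g_lipschitz: "norm (g i x - g i y) \<le> \<kappa> * norm (x - y)"
proof -
  have "\<kappa>-lipschitz_on UNIV (fan V (spoke i))"
  proof (rule fan_lipschitz[OF fanlike_V])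
    have "\<forall>j<7. dominated \<kappa> (V j) (V (j + 1)) (spoke i j) (spoke i (j + 1))"
      unfolding all_less_7
      by (cases i; simp add: dominated_def Let_def inner_complex_def V_def spoke_def complex_diff \<kappa>_def power2_eq_square)
    then show "dominated \<kappa> (V j) (V (j + 1)) (spoke i j) (spoke i (j + 1))" if "j < 7" for j using that by blast
  qed (simp_all add: \<kappa>_def spoke_per)
  from lipschitz_onD[OF this, of x y] show ?thesis by (simp add: g_def dist_norm)
qed

lemma g_inj: "g i x = g i y \<Longrightarrow> x = y"
  using fan_inverse[OF fanlike_V fanlike_spoke] unfolding g_def by (metis add_left_cancel)

lemma g_sector:
  assumes "j < 7" "0 \<le> a" "0 \<le> b"
  shows "g i (a *\<^sub>R V j + b *\<^sub>R V (j + 1)) = centre i + a *\<^sub>R spoke i j + b *\<^sub>R spoke i (j + 1)"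
  using fan_sector[of V "spoke i", OF fanlike_V spoke_per(1) assms] by (simp add: g_def)

definition edge :: "(nat \<Rightarrow> complex) \<Rightarrow> nat \<Rightarrow> complex \<Rightarrow> real" where
  "edge w j x = cross (w (j + 1) - w j) (x - w j)"

definition Q :: "complex set" where "Q = {x. \<forall>j<7. 0 \<le> edge V j x}"

definition cell :: "piece \<Rightarrow> complex set" where "cell i = {x. \<forall>j<7. 0 \<le> edge (W i) j x}"

definition side :: "nat \<Rightarrow> real \<Rightarrow> complex" where "side j s = (1 - s) *\<^sub>R V j + s *\<^sub>R V (j + 1)"

lemma Q_sector:
  assumes "j < 7" "0 \<le> a" "0 \<le> b"
  shows "a *\<^sub>R V j + b *\<^sub>R V (j + 1) \<in> Q \<longleftrightarrow> a + b \<le> 1"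
proof
  assume "a *\<^sub>R V j + b *\<^sub>R V (j + 1) \<in> Q"
  then have "0 \<le> edge V j (a *\<^sub>R V j + b *\<^sub>R V (j + 1))" using assms unfolding Q_def by blast
  also have "\<dots> = (1 - a - b) * cross (V j) (V (j + 1))"
    by (simp add: edge_def cross_def algebra_simps)
  finally show "a + b \<le> 1"
    using fanlike_D_pos[OF fanlike_V, of j] by (simp add: zero_le_mult_iff)
next
  assume ab: "a + b \<le> 1"
  have conv: "\<forall>k<7. \<forall>l<7. 0 \<le> edge V k 0 \<and> 0 \<le> edge V k (V l) \<and> 0 \<le> edge V k (V (l + 1))"
    by (simp add: all_less_7 edge_def V_def)
  have "0 \<le> edge V k (a *\<^sub>R V j + b *\<^sub>R V (j + 1))" if "k < 7" for k
  proof -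
    have "edge V k (a *\<^sub>R V j + b *\<^sub>R V (j + 1)) =
       (1 - a - b) * edge V k 0 + a * edge V k (V j) + b * edge V k (V (j + 1))"
      by (simp add: edge_def cross_def algebra_simps)
    also have "\<dots> \<ge> 0" using conv that assms ab by (intro add_nonneg_nonneg mult_nonneg_nonneg) auto
    finally show ?thesis .
  qed
  then show "a *\<^sub>R V j + b *\<^sub>R V (j + 1) \<in> Q" unfolding Q_def by blast
qed

lemma cell_sector:
  assumes "j < 7" "0 \<le> a" "0 \<le> b"
  shows "centre i + a *\<^sub>R spoke i j + b *\<^sub>R spoke i (j + 1) \<in> cell i \<longleftrightarrow> a + b \<le> 1"
proof
  assume "centre i + a *\<^sub>R spoke i j + b *\<^sub>R spoke i (j + 1) \<in> cell i"
  then have "0 \<le> edge (W i) j (centre i + a *\<^sub>R spoke i j + b *\<^sub>R spoke i (j + 1))" using assms unfolding cell_def by blast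
  also have "\<dots> = (1 - a - b) * cross (spoke i j) (spoke i (j + 1))"
    by (simp add: edge_def cross_def spoke_def algebra_simps)
  finally show "a + b \<le> 1"
    using fanlike_D_pos[OF fanlike_spoke[of i], of j] by (simp add: zero_le_mult_iff)
next
  assume ab: "a + b \<le> 1"
  have conv: "\<forall>k<7. \<forall>l<7. 0 \<le> edge (W i) k (centre i) \<and> 0 \<le> edge (W i) k (W i l) \<and> 0 \<le> edge (W i) k (W i (l + 1))"
    by (cases i; simp add: all_less_7 edge_def)
  have "0 \<le> edge (W i) k (centre i + a *\<^sub>R spoke i j + b *\<^sub>R spoke i (j + 1))" if "k < 7" for k
  proof -
    have "edge (W i) k (centre i + a *\<^sub>R spoke i j + b *\<^sub>R spoke i (j + 1)) =
       (1 - a - b) * edge (W i) k (centre i) + a * edge (W i) k (W i j) + b * edge (W i) k (W i (j + 1))"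
      by (simp add: edge_def cross_def spoke_def algebra_simps)
    also have "\<dots> \<ge> 0" using conv that assms ab by (intro add_nonneg_nonneg mult_nonneg_nonneg) auto
    finally show ?thesis .
  qed
  then show "centre i + a *\<^sub>R spoke i j + b *\<^sub>R spoke i (j + 1) \<in> cell i" unfolding cell_def by blast
qed

lemma g_image: "g i ` Q = cell i"
proof
  show "g i ` Q \<subseteq> cell i"
  proof
    fix y assume "y \<in> g i ` Q"
    then obtain x where x: "x \<in> Q" "y = g i x" by blast
    obtain j a b where j: "j < 7" "0 \<le> a" "0 \<le> b" "x = a *\<^sub>R V j + b *\<^sub>R V (j + 1)"
      using fanlike_cover[OF fanlike_V] by blast
    then have "a + b \<le> 1" using Q_sector x by simp
    then show "y \<in> cell i" using cell_sector[OF j(1-3)] g_sector[OF j(1-3)] x j by simp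
  qed
  show "cell i \<subseteq> g i ` Q"
  proof
    fix y assume y: "y \<in> cell i"
    obtain j a b where j: "j < 7" "0 \<le> a" "0 \<le> b" "y - centre i = a *\<^sub>R spoke i j + b *\<^sub>R spoke i (j + 1)"
      using fanlike_cover[OF fanlike_spoke] by blast
    then have yy: "y = centre i + a *\<^sub>R spoke i j + b *\<^sub>R spoke i (j + 1)" by (simp add: algebra_simps)
    then have "a + b \<le> 1" using cell_sector[OF j(1-3)] y by simp
    then show "y \<in> g i ` Q" using g_sector[OF j(1-3)] Q_sector[OF j(1-3)] yy by (metis image_eqI)
  qed
qed

lemma g_side:
  assumes "j < 7" "0 \<le> s" "s \<le> 1"
  shows "g i (side j s) = (1 - s) *\<^sub>R W i j + s *\<^sub>R W i (j + 1)"
  using g_sector[of j "1 - s" s i] assms by (simp add: side_def spoke_def algebra_simps)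

lemma side_Q: "j < 7 \<Longrightarrow> 0 \<le> s \<Longrightarrow> s \<le> 1 \<Longrightarrow> side j s \<in> Q"
  using Q_sector[of j "1 - s" s] by (simp add: side_def)

instance piece :: finite
proof
  have "x \<in> {P1, P2, P3}" for x by (cases x) simp_all
  then have "UNIV \<subseteq> {P1, P2, P3}" by blast
  then show "finite (UNIV :: piece set)" by (rule finite_subset) (rule finite.intros | simp)+
qed

text \<open>The lines of the two chords: \<open>cut1\<close> vanishes on the chord between the cells of \<open>P1\<close> and \<open>P2\<close>, \<open>cut2\<close> on
the chord between those of \<open>P1\<close> and \<open>P3\<close>. Both are positive inside the cell of \<open>P1\<close>.\<close>
definition cut1 :: "complex \<Rightarrow> real" where "cut1 x = cross (Complex (-152) 32) (x - Complex 80 0)"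
definition cut2 :: "complex \<Rightarrow> real" where "cut2 x = cross (Complex 52 32) (x - Complex 16 (-104))"

lemma cut_sector:
  assumes "j < 7" "0 \<le> a" "0 \<le> b"
  shows "cut1 (g i (a *\<^sub>R V j + b *\<^sub>R V (j + 1))) = (1 - a - b) * cut1 (centre i) + a * cut1 (W i j) + b * cut1 (W i (j + 1))"
    and "cut2 (g i (a *\<^sub>R V j + b *\<^sub>R V (j + 1))) = (1 - a - b) * cut2 (centre i) + a * cut2 (W i j) + b * cut2 (W i (j + 1))"
  unfolding g_sector[OF assms] by (simp_all add: cut1_def cut2_def spoke_def algebra_simps)

lemma Q_obtain:
  assumes "x \<in> Q" obtains j a b where "j < 7" "0 \<le> a" "0 \<le> b" "a + b \<le> 1" "x = a *\<^sub>R V j + b *\<^sub>R V (j + 1)"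
proof -
  obtain j a b where j: "j < 7" "0 \<le> a" "0 \<le> b" "x = a *\<^sub>R V j + b *\<^sub>R V (j + 1)"
    by (rule fanlike_cover[OF fanlike_V])
  with assms Q_sector have "a + b \<le> 1" by simp
  then show thesis using that j by blast
qed

lemma cut_signs:
  assumes "y \<in> Q"
  shows "0 \<le> cut1 (g P1 y)" "cut1 (g P2 y) \<le> 0" "0 < cut1 (g P3 y)"
    "0 \<le> cut2 (g P1 y)" "0 < cut2 (g P2 y)" "cut2 (g P3 y) \<le> 0"
proof -
  obtain j a b where j: "j < 7" "0 \<le> a" "0 \<le> b" "a + b \<le> 1" and y: "y = a *\<^sub>R V j + b *\<^sub>R V (j + 1)"
    using assms by (rule Q_obtain)
  have 1: "\<forall>j<7. 0 < cut1 (centre P1) \<and> 0 \<le> cut1 (W P1 j) \<and> 0 \<le> cut1 (W P1 (j + 1))"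
    "\<forall>j<7. 0 < - cut1 (centre P2) \<and> 0 \<le> - cut1 (W P2 j) \<and> 0 \<le> - cut1 (W P2 (j + 1))"
    "\<forall>j<7. 0 < cut1 (centre P3) \<and> 0 < cut1 (W P3 j) \<and> 0 < cut1 (W P3 (j + 1))"
    "\<forall>j<7. 0 < cut2 (centre P1) \<and> 0 \<le> cut2 (W P1 j) \<and> 0 \<le> cut2 (W P1 (j + 1))"
    "\<forall>j<7. 0 < cut2 (centre P2) \<and> 0 < cut2 (W P2 j) \<and> 0 < cut2 (W P2 (j + 1))"
    "\<forall>j<7. 0 < - cut2 (centre P3) \<and> 0 \<le> - cut2 (W P3 j) \<and> 0 \<le> - cut2 (W P3 (j + 1))"
    by (simp_all add: all_less_7 cut1_def cut2_def)
  have nn: "0 \<le> (1 - a - b) * c + a * p + b * q" if "0 \<le> c" "0 \<le> p" "0 \<le> q" for c p q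
    using that j by (intro add_nonneg_nonneg mult_nonneg_nonneg) auto
  have pp: "0 < (1 - a - b) * c + a * p + b * q" if "0 < c" "0 < p" "0 < q" for c p q
  proof -
    have "0 < min c (min p q)" using that by simp
    also have "min c (min p q) = (1 - a - b) * min c (min p q) + a * min c (min p q) + b * min c (min p q)"
      by (simp add: algebra_simps)
    also have "\<dots> \<le> (1 - a - b) * c + a * p + b * q"
      using j by (intro add_mono mult_left_mono) auto
    finally show ?thesis .
  qed
  note c = cut_sector[OF j(1-3), folded y]
  show "0 \<le> cut1 (g P1 y)" unfolding c using 1(1) j by (intro nn) (auto intro: less_imp_le)
  show "0 < cut1 (g P3 y)" unfolding c using 1(3) j by (intro pp) auto
  show "0 \<le> cut2 (g P1 y)" unfolding c using 1(4) j by (intro nn) (auto intro: less_imp_le)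
  show "0 < cut2 (g P2 y)" unfolding c using 1(5) j by (intro pp) auto
  have "0 \<le> (1 - a - b) * (- cut1 (centre P2)) + a * (- cut1 (W P2 j)) + b * (- cut1 (W P2 (j + 1)))"
    using 1(2) j by (intro nn) (auto intro: less_imp_le)
  then show "cut1 (g P2 y) \<le> 0" unfolding c by simp
  have "0 \<le> (1 - a - b) * (- cut2 (centre P3)) + a * (- cut2 (W P3 j)) + b * (- cut2 (W P3 (j + 1)))"
    using 1(6) j by (intro nn) (auto intro: less_imp_le)
  then show "cut2 (g P3 y) \<le> 0" unfolding c by simp
qed

text \<open>The preimage of a chord under \<open>g P1\<close> is one side of \<open>Q\<close>: a function which is affine on the seven
triangles, positive at the apex and at all vertices except the two ends of a side, vanishes only on
that side.\<close>
lemma zero_on_side: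
  assumes y: "y \<in> Q" and l: "l < 7"
    and lin: "\<And>j a b. j < 7 \<Longrightarrow> 0 \<le> a \<Longrightarrow> 0 \<le> b \<Longrightarrow>
      h (a *\<^sub>R V j + b *\<^sub>R V (j + 1)) = (1 - a - b) * c + a * p j + b * p (j + 1)"
    and per: "\<And>j. p (j mod 7) = p j"
    and c: "0 < c" and p0: "p l = 0" "p (l + 1) = 0"
    and p: "\<And>j. j < 7 \<Longrightarrow> j \<noteq> l \<Longrightarrow> j \<noteq> (l + 1) mod 7 \<Longrightarrow> 0 < p j"
    and z: "h y = 0"
  shows "\<exists>s. 0 \<le> s \<and> s \<le> 1 \<and> y = side l s"
proof -
  obtain j a b where j: "j < 7" "0 \<le> a" "0 \<le> b" "a + b \<le> 1" and yy: "y = a *\<^sub>R V j + b *\<^sub>R V (j + 1)"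
    using y by (rule Q_obtain)
  have p': "0 \<le> p k \<and> (p k = 0 \<longrightarrow> k mod 7 = l \<or> k mod 7 = (l + 1) mod 7)" for k
    using p[of "k mod 7"] per[of k] per[of "l + 1"] p0 by (metis less_irrefl less_imp_le mod_less_divisor order_refl zero_less_numeral)
  have "0 \<le> (1 - a - b) * c" "0 \<le> a * p j" "0 \<le> b * p (j + 1)"
    using j p'[of j] p'[of "j + 1"] c by auto
  then have zero: "(1 - a - b) * c = 0" "a * p j = 0" "b * p (j + 1) = 0"
    using z lin[OF j(1-3)] unfolding yy by (smt (verit))+
  then have ab: "a = 1 - b" using c by simp
  have vertex: ?thesis if k: "y = V k" "p k = 0" for k
  proof -
    have "k mod 7 = l \<or> k mod 7 = (l + 1) mod 7" using p'[of k] k by blast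
    then show ?thesis
    proof
      assume "k mod 7 = l" then show ?thesis using k V_per(1)[of k] by (intro exI[of _ 0]) (simp add: side_def)
    next
      assume "k mod 7 = (l + 1) mod 7"
      then have "y = V (l + 1)" using k V_per(1)[of k] V_per(1)[of "l + 1"] by metis
      then show ?thesis by (intro exI[of _ 1]) (simp add: side_def)
    qed
  qed
  consider "p j = 0 \<and> p (j + 1) = 0" | "a = 0" "p (j + 1) = 0" | "b = 0" "p j = 0" using zero ab by fastforce
  then show ?thesis
  proof cases
    case 1
    have "j = l \<or> j = (l + 1) mod 7" using p'[of j] 1 j(1) by simp
    moreover have "(j + 1) mod 7 = l \<or> (j + 1) mod 7 = (l + 1) mod 7" using p'[of "j + 1"] 1 by simp
    ultimately have "j = l" using j(1) l by (auto simp: mod_Suc split: if_splits)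
    then show ?thesis using ab j yy by (intro exI[of _ b]) (simp add: side_def)
  next
    case 2 then show ?thesis using ab yy by (intro vertex[of "j + 1"]) simp_all
  next
    case 3 then show ?thesis using ab yy by (intro vertex[of j]) simp_all
  qed
qed

lemma cut1_zero: assumes "y \<in> Q" "cut1 (g P1 y) = 0" shows "\<exists>s. 0 \<le> s \<and> s \<le> 1 \<and> y = side 0 s"
proof (rule zero_on_side[where h = "\<lambda>y. cut1 (g P1 y)" and c = "cut1 (centre P1)" and p = "\<lambda>j. cut1 (W P1 j)"])
  have "\<forall>j<7. j \<noteq> 0 \<longrightarrow> j \<noteq> (0 + 1) mod 7 \<longrightarrow> 0 < cut1 (W P1 j)"
    unfolding all_less_7 by (simp add: cut1_def)
  then show "0 < cut1 (W P1 j)" if "j < 7" "j \<noteq> 0" "j \<noteq> (0 + 1) mod 7" for j using that by blast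
  show "cut1 (W P1 (j mod 7)) = cut1 (W P1 j)" for j by (simp only: W_per)
  show "cut1 (g P1 (a *\<^sub>R V j + b *\<^sub>R V (j + 1))) =
      (1 - a - b) * cut1 (centre P1) + a * cut1 (W P1 j) + b * cut1 (W P1 (j + 1))"
    if "j < 7" "0 \<le> a" "0 \<le> b" for j a b using that by (rule cut_sector)
qed (use assms in \<open>simp_all add: cut1_def\<close>)

lemma cut2_zero: assumes "y \<in> Q" "cut2 (g P1 y) = 0" shows "\<exists>s. 0 \<le> s \<and> s \<le> 1 \<and> y = side 4 s"
proof (rule zero_on_side[where h = "\<lambda>y. cut2 (g P1 y)" and c = "cut2 (centre P1)" and p = "\<lambda>j. cut2 (W P1 j)"])
  have "\<forall>j<7. j \<noteq> 4 \<longrightarrow> j \<noteq> (4 + 1) mod 7 \<longrightarrow> 0 < cut2 (W P1 j)"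
    unfolding all_less_7 by (simp add: cut2_def)
  then show "0 < cut2 (W P1 j)" if "j < 7" "j \<noteq> 4" "j \<noteq> (4 + 1) mod 7" for j using that by blast
  show "cut2 (W P1 (j mod 7)) = cut2 (W P1 j)" for j by (simp only: W_per)
  show "cut2 (g P1 (a *\<^sub>R V j + b *\<^sub>R V (j + 1))) =
      (1 - a - b) * cut2 (centre P1) + a * cut2 (W P1 j) + b * cut2 (W P1 (j + 1))"
    if "j < 7" "0 \<le> a" "0 \<le> b" for j a b using that by (rule cut_sector)
qed (use assms in \<open>simp_all add: cut2_def\<close>)

lemma pieces_cover:
  assumes "x \<in> Q"
  shows "cut1 x \<le> 0 \<Longrightarrow> x \<in> cell P2" "0 \<le> cut1 x \<Longrightarrow> 0 \<le> cut2 x \<Longrightarrow> x \<in> cell P1" "cut2 x \<le> 0 \<Longrightarrow> x \<in> cell P3"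
proof -
  obtain X Y where x: "x = Complex X Y" by (cases x)
  have "\<forall>j<7. 0 \<le> edge V j x" using assms unfolding Q_def by blast
  note q = this[unfolded x all_less_7 edge_def V_def complex_diff, simplified]
  note c = x cut1_def cut2_def complex_diff cross_Complex
  show "x \<in> cell P2" if "cut1 x \<le> 0"
  proof -
    note d = that[unfolded c, simplified]
    show ?thesis unfolding x cell_def mem_Collect_eq all_less_7
      by (intro conjI; simp add: edge_def complex_diff; insert q d; linarith)
  qed
  show "x \<in> cell P1" if "0 \<le> cut1 x" "0 \<le> cut2 x"
  proof -
    note d = that[unfolded c, simplified]
    show ?thesis unfolding x cell_def mem_Collect_eq all_less_7
      by (intro conjI; simp add: edge_def complex_diff; insert q d; linarith)
  qed
  show "x \<in> cell P3" if "cut2 x \<le> 0"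
  proof -
    note d = that[unfolded c, simplified]
    show ?thesis unfolding x cell_def mem_Collect_eq all_less_7
      by (intro conjI; simp add: edge_def complex_diff; insert q d; linarith)
  qed
qed

lemma cell_subset_Q: "cell i \<subseteq> Q"
proof
  fix x assume a: "x \<in> cell i"
  obtain X Y where x: "x = Complex X Y" by (cases x)
  have a: "\<forall>j<7. 0 \<le> edge (W i) j x" using a unfolding cell_def by blast
  show "x \<in> Q"
  proof (cases i)
    case P1
    note q = a[unfolded P1 x all_less_7 edge_def complex_diff, simplified]
    show ?thesis unfolding x Q_def mem_Collect_eq all_less_7
      by (intro conjI; simp add: edge_def V_def complex_diff; insert q; linarith)
  next
    case P2
    note q = a[unfolded P2 x all_less_7 edge_def complex_diff, simplified]
    show ?thesis unfolding x Q_def mem_Collect_eq all_less_7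
      by (intro conjI; simp add: edge_def V_def complex_diff; insert q; linarith)
  next
    case P3
    note q = a[unfolded P3 x all_less_7 edge_def complex_diff, simplified]
    show ?thesis unfolding x Q_def mem_Collect_eq all_less_7
      by (intro conjI; simp add: edge_def V_def complex_diff; insert q; linarith)
  qed
qed

lemma Q_Union: "Q = (\<Union>i. g i ` Q)"
proof -
  have "x \<in> (\<Union>i. cell i)" if "x \<in> Q" for x
  proof -
    consider "cut1 x \<le> 0" | "cut2 x \<le> 0" | "0 \<le> cut1 x" "0 \<le> cut2 x" by linarith
    then show ?thesis using pieces_cover[OF that] by cases blast+
  qed
  then show ?thesis unfolding g_image using cell_subset_Q by blast
qed

lemma g_Q: "x \<in> Q \<Longrightarrow> g i x \<in> Q"
  using Q_Union by blast

lemma closed_edges: "closed {x. \<forall>j<7. 0 \<le> edge w j x}"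
proof -
  have "{x. \<forall>j<7. 0 \<le> edge w j x} = (\<Inter>j\<in>{..<7}. {x. 0 \<le> edge w j x})" by auto
  also have "closed \<dots>"
    unfolding edge_def cross_def by (intro closed_INT ballI closed_Collect_le continuous_intros)
  finally show ?thesis .
qed

lemma norm_Q: assumes "x \<in> Q" shows "norm x \<le> 200"
proof -
  obtain j a b where j: "j < 7" "0 \<le> a" "0 \<le> b" "a + b \<le> 1" and x: "x = a *\<^sub>R V j + b *\<^sub>R V (j + 1)"
    using assms by (rule Q_obtain)
  have "\<forall>j<7. \<bar>Re (V j)\<bar> + \<bar>Im (V j)\<bar> \<le> 200 \<and> \<bar>Re (V (j + 1))\<bar> + \<bar>Im (V (j + 1))\<bar> \<le> 200"
    by (simp add: all_less_7 V_def)
  then have "norm (V j) \<le> 200" "norm (V (j + 1)) \<le> 200" using j(1) cmod_le by (meson order_trans)+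
  then have "norm x \<le> a * 200 + b * 200"
    unfolding x using j by (intro norm_triangle_le add_mono) (simp_all add: mult_left_mono)
  then show ?thesis using j by linarith
qed

lemma compact_Q: "compact Q"
proof -
  have "closed Q" unfolding Q_def by (rule closed_edges)
  moreover have "bounded Q" using norm_Q unfolding bounded_iff by blast
  ultimately show ?thesis using compact_eq_bounded_closed by blast
qed

lemma half_Q: "cell P1 \<union> cell P3 = {x \<in> Q. 0 \<le> cut1 x}"
proof -
  have "0 \<le> cut1 x" if "x \<in> cell P1 \<union> cell P3" for x
    using that cut_signs(1) less_imp_le[OF cut_signs(3)] unfolding g_image[symmetric] by blast
  moreover have "x \<in> cell P1 \<union> cell P3" if "x \<in> Q" "0 \<le> cut1 x" for x
    using that pieces_cover(2,3)[of x] linear[of 0 "cut2 x"] by blast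
  ultimately show ?thesis using cell_subset_Q by blast
qed

text \<open>Two adjacent cells form the part of the heptagon on one side of a chord, a convex body.\<close>
lemma half_Q_disc: "cell P1 \<union> cell P3 homeomorphic cball (0::complex) 1"
proof (rule homeomorphic_convex_compact_cball)
  have lin: "convex {x. 0 \<le> cross u (x - v)}" for u v
  proof -
    have "{x. 0 \<le> cross u (x - v)} = {x. Complex (- Im u) (Re u) \<bullet> x \<ge> cross u v}"
      by (auto simp: cross_def inner_complex_def algebra_simps)
    then show ?thesis by (simp add: convex_halfspace_ge)
  qed
  have e: "cell P1 \<union> cell P3 = (\<Inter>j\<in>{..<7}. {x. 0 \<le> edge V j x}) \<inter> {x. 0 \<le> cut1 x}"
    unfolding half_Q Q_def by auto
  show "convex (cell P1 \<union> cell P3)"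
    unfolding e edge_def cut1_def by (intro convex_Int convex_INT lin)
  show "compact (cell P1 \<union> cell P3)"
  proof -
    have "compact (cell i)" for i
      using compact_Int_closed[OF compact_Q closed_edges[of "W i"]] cell_subset_Q[of i]
      unfolding cell_def by (simp add: inf.absorb2)
    then show ?thesis by (simp add: compact_Un)
  qed
  let ?O = "(\<Inter>j\<in>{..<7}. {x. 0 < edge V j x}) \<inter> {x. 0 < cut1 x}"
  have "open ?O" unfolding edge_def cut1_def cross_def
    by (intro open_Int open_INT ballI open_Collect_less continuous_intros) auto
  moreover have "?O \<subseteq> cell P1 \<union> cell P3" unfolding e by (auto intro: less_imp_le)
  moreover have "\<forall>j<7. 0 < edge V j 0" "0 < cut1 0" by (simp_all add: all_less_7 edge_def V_def cut1_def)
  then have "0 \<in> ?O" by blast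
  ultimately show "interior (cell P1 \<union> cell P3) \<noteq> {}" using interior_maximal by blast
qed simp

section \<open>Attractor of a system of injective maps\<close>

text \<open>The set is the intersection of the decreasing iterates of \<open>K\<close>. A point of the intersection has
preimages in every iterate, infinitely many of them under the same map; by injectivity they are all
the same point, which therefore lies in the intersection. The projection stays surjective because the
fibres in the iterates are nested nonempty compact sets.\<close>
lemma attractor_exists:
  fixes \<phi> :: "'i::finite \<Rightarrow> 'a::heine_borel \<Rightarrow> 'a" and \<pi> :: "'a \<Rightarrow> 'b::t1_space"
  assumes K: "compact K" "K \<noteq> {}"
    and cont: "\<And>i. continuous_on K (\<phi> i)" and inj: "\<And>i. inj_on (\<phi> i) K" and into: "\<And>i. \<phi> i ` K \<subseteq> K"
    and pi: "continuous_on K \<pi>" "\<And>i p. p \<in> K \<Longrightarrow> \<pi> (\<phi> i p) = G i (\<pi> p)" "\<pi> ` K \<subseteq> (\<Union>i. G i ` \<pi> ` K)"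
  obtains \<Gamma> where "compact \<Gamma>" "\<Gamma> \<subseteq> K" "\<Gamma> = (\<Union>i. \<phi> i ` \<Gamma>)" "\<pi> ` \<Gamma> = \<pi> ` K"
proof -
  define T where "T S = (\<Union>i. \<phi> i ` S)" for S
  define A where "A n = (T ^^ n) K" for n
  have A0: "A 0 = K" and AS: "A (Suc n) = T (A n)" for n by (simp_all add: A_def)
  have T_mono: "S \<subseteq> S' \<Longrightarrow> T S \<subseteq> T S'" for S S' unfolding T_def by blast
  have dec: "A (Suc n) \<subseteq> A n" for n
  proof (induction n)
    case 0 show ?case using into by (auto simp: A0 AS T_def)
  next
    case (Suc n) then show ?case using T_mono AS by metis
  qed
  have anti: "m \<le> n \<Longrightarrow> A n \<subseteq> A m" for m n by (rule lift_Suc_antimono_le[of A, OF dec])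
  have sub: "A n \<subseteq> K" for n using anti[of 0 n] A0 by simp
  have comp: "compact (A n)" for n
  proof (induction n)
    case (Suc n)
    have "compact (\<phi> i ` A n)" for i
      using Suc cont continuous_on_subset[OF _ sub] by (intro compact_continuous_image) auto
    then show ?case unfolding AS T_def by (intro compact_UN) auto
  qed (simp add: A0 K)
  define \<Gamma> where "\<Gamma> = (\<Inter>n. A n)"
  have compG: "compact \<Gamma>" unfolding \<Gamma>_def using comp by (intro compact_Inter) auto
  have subG: "\<Gamma> \<subseteq> K" unfolding \<Gamma>_def using A0 by blast
  have fix1: "T \<Gamma> \<subseteq> \<Gamma>"
  proof -
    have "T \<Gamma> \<subseteq> A n" for n
    proof -
      have "T \<Gamma> \<subseteq> A (Suc n)" unfolding AS by (rule T_mono) (auto simp: \<Gamma>_def)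
      then show ?thesis using dec by blast
    qed
    then show ?thesis unfolding \<Gamma>_def by blast
  qed
  have fix2: "\<Gamma> \<subseteq> T \<Gamma>"
  proof
    fix p assume "p \<in> \<Gamma>"
    then have "p \<in> T (A n)" for n unfolding \<Gamma>_def AS[symmetric] by blast
    then have "\<exists>i. p \<in> \<phi> i ` A n" for n unfolding T_def by blast
    then obtain c where c: "\<And>n. p \<in> \<phi> (c n) ` A n" by metis
    \<comment> \<open>Some map is used for infinitely many of the iterates, hence for all of them.\<close>
    obtain i where i: "infinite {n. c n = i}"
    proof -
      have "\<exists>n0\<in>UNIV. infinite {a \<in> UNIV. c a = c n0}"
        by (rule pigeonhole_infinite) (simp_all add: infinite_UNIV_nat)
      then obtain n0 where "infinite {a. c a = c n0}" by auto
      then show thesis by (rule that)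
    qed
    have mem: "p \<in> \<phi> i ` A n" for n
    proof -
      obtain m where m: "m \<ge> n" "c m = i" using i[unfolded infinite_nat_iff_unbounded_le] by auto
      show ?thesis using c[of m] m anti by blast
    qed
    then obtain q where q: "q \<in> K" "p = \<phi> i q" using sub by blast
    have "q \<in> A n" for n
      using mem[of n] q inj[of i] sub[of n] by (auto dest: inj_onD)
    then show "p \<in> T \<Gamma>" unfolding T_def \<Gamma>_def using q by blast
  qed
  have surj: "\<pi> ` K \<subseteq> \<pi> ` A n" for n
  proof (induction n)
    case (Suc n)
    show ?case
    proof
      fix x assume "x \<in> \<pi> ` K"
      then have "x \<in> (\<Union>i. G i ` \<pi> ` K)" using pi(3) by (rule rev_subsetD)
      then obtain i y where y: "y \<in> \<pi> ` K" "x = G i y" by auto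
      then obtain p where "p \<in> A n" "y = \<pi> p" using Suc by blast
      moreover from this have "\<pi> (\<phi> i p) = G i (\<pi> p)" using pi(2) sub by blast
      ultimately have "x = \<pi> (\<phi> i p)" "\<phi> i p \<in> A (Suc n)" using y(2) unfolding AS T_def by auto
      then show "x \<in> \<pi> ` A (Suc n)" by blast
    qed
  qed (simp add: A0)
  have "x \<in> \<pi> ` \<Gamma>" if "x \<in> \<pi> ` K" for x
  proof -
    define F where "F n = A n \<inter> \<pi> -` {x}" for n
    have "compact (F n)" for n
    proof -
      have "closedin (top_of_set (A n)) (A n \<inter> \<pi> -` {x})"
        using continuous_on_subset[OF pi(1) sub] by (intro continuous_closedin_preimage) auto
      from closedin_compact[OF comp this] show ?thesis unfolding F_def .
    qed
    moreover have "F n \<noteq> {}" for n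
    proof -
      have "x \<in> \<pi> ` A n" using surj that by (rule subsetD)
      then show ?thesis unfolding F_def by auto
    qed
    moreover have "m \<le> n \<Longrightarrow> F n \<subseteq> F m" for m n
      using anti[of m n] unfolding F_def by (rule Int_mono) simp_all
    ultimately have "\<Inter> (range F) \<noteq> {}" by (rule compact_nest)
    then obtain p where "\<And>n. p \<in> F n" by blast
    then have "p \<in> \<Gamma>" "\<pi> p = x" unfolding F_def \<Gamma>_def by auto
    then show ?thesis by blast
  qed
  then have "\<pi> ` K \<subseteq> \<pi> ` \<Gamma>" by (rule subsetI)
  with image_mono[OF subG] have "\<pi> ` \<Gamma> = \<pi> ` K" by (rule equalityI)
  moreover have "\<Gamma> = (\<Union>i. \<phi> i ` \<Gamma>)" using fix2 fix1 unfolding T_def by (rule equalityI)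
  ultimately show thesis by (intro that[OF compG subG])
qed

section \<open>Arithmetic of the cubic root\<close>

locale cubic_root =
  fixes \<alpha> :: complex
  assumes root: "\<alpha> ^ 3 - 2 * \<alpha> ^ 2 + \<alpha> - 1 = 0" and nonreal: "\<alpha> \<notin> \<real>"
begin

text \<open>Coordinates with respect to \<open>1, \<alpha>, \<alpha>\<^sup>2\<close>. Real coordinates are allowed because discs with centre \<open>1/4\<close> occur.\<close>
definition el :: "real \<Rightarrow> real \<Rightarrow> real \<Rightarrow> complex" where
  "el p q r = of_real p + of_real q * \<alpha> + of_real r * \<alpha>\<^sup>2"

lemma el_add: "el p q r + el p' q' r' = el (p + p') (q + q') (r + r')"
  and el_diff: "el p q r - el p' q' r' = el (p - p') (q - q') (r - r')"
  by (simp_all add: el_def algebra_simps)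

lemma cube: "\<alpha> ^ 3 = 2 * \<alpha>\<^sup>2 - \<alpha> + 1"
  using root by (simp add: algebra_simps eq_diff_eq)

lemma el_mult: "\<alpha> * el p q r = el r (p - r) (q + 2 * r)"
proof -
  have "\<alpha> * el p q r = of_real p * \<alpha> + of_real q * \<alpha>\<^sup>2 + of_real r * \<alpha> ^ 3"
    by (simp add: el_def algebra_simps power2_eq_square power3_eq_cube)
  also have "\<dots> = el r (p - r) (q + 2 * r)" unfolding cube by (simp add: el_def algebra_simps)
  finally show ?thesis .
qed

definition N :: real where "N = (norm \<alpha>)\<^sup>2"

text \<open>The roots have product \<open>1\<close> and sum \<open>2\<close>, so the real root is \<open>1 / N\<close> and \<open>2 Re \<alpha> = 2 - 1 / N\<close>. The proof
extracts this and the consequences for \<open>N\<close> from the real and imaginary parts of the equation, with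
\<open>s = 2 Re \<alpha>\<close> and \<open>N = (1 - s)\<^sup>2\<close>.\<close>
lemma N_facts:
  shows two_Re: "2 * Re \<alpha> = N - N\<^sup>2" and N_cubic: "N ^ 3 - N\<^sup>2 + 2 * N - 1 = 0"
    and sN: "2 * Re \<alpha> * N = 2 * N - 1" and s2: "(2 * Re \<alpha>)\<^sup>2 = 3 * N - 1 - 2 * N\<^sup>2"
proof -
  define x y where "x = Re \<alpha>" and "y = Im \<alpha>"
  have a: "\<alpha> = Complex x y" by (simp add: x_def y_def)
  have y0: "y \<noteq> 0" using nonreal complex_is_Real_iff y_def by auto
  have N: "N = x\<^sup>2 + y\<^sup>2" by (simp add: N_def cmod_power2 x_def y_def)
  have "Im (\<alpha> ^ 3 - 2 * \<alpha> ^ 2 + \<alpha> - 1) = y * (3 * x\<^sup>2 - y\<^sup>2 - 4 * x + 1)"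
    unfolding a by (simp add: power2_eq_square power3_eq_cube algebra_simps)
  then have y2: "y\<^sup>2 = 3 * x\<^sup>2 - 4 * x + 1" using root y0 by simp
  have "Re (\<alpha> ^ 3 - 2 * \<alpha> ^ 2 + \<alpha> - 1) = x ^ 3 - 3 * x * y\<^sup>2 - 2 * (x\<^sup>2 - y\<^sup>2) + x - 1"
    unfolding a by (simp add: power2_eq_square power3_eq_cube algebra_simps)
  then have re: "x ^ 3 - 3 * x * y\<^sup>2 - 2 * (x\<^sup>2 - y\<^sup>2) + x - 1 = 0" using root by simp
  define s where "s = 2 * x"
  have c: "s ^ 3 = 4 * s\<^sup>2 - 5 * s + 1"
    using re unfolding y2 s_def by (simp add: power2_eq_square power3_eq_cube algebra_simps)
  have Ns: "N = 1 - 2 * s + s\<^sup>2" unfolding N y2 s_def by (simp add: power2_eq_square algebra_simps)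
  have sN': "s * N = 2 * N - 1"
  proof -
    have "s * N = s - 2 * s\<^sup>2 + s ^ 3" unfolding Ns by (simp add: power2_eq_square power3_eq_cube algebra_simps)
    then show ?thesis unfolding c Ns by simp
  qed
  have N2: "N\<^sup>2 = N - s"
  proof -
    have "N\<^sup>2 = N - 2 * (s * N) + s * (s * N)" by (subst (2) Ns) (simp add: power2_eq_square Ns algebra_simps)
    moreover have "s * (s * N) = s * (2 * N - 1)" unfolding sN' ..
    then have "s * (s * N) = 2 * (s * N) - s" by (simp add: algebra_simps)
    ultimately show ?thesis using sN' by linarith
  qed
  show "2 * Re \<alpha> = N - N\<^sup>2" "2 * Re \<alpha> * N = 2 * N - 1" using N2 sN' by (simp_all add: s_def x_def)
  have "N ^ 3 = N * N\<^sup>2" by (simp add: power3_eq_cube power2_eq_square)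
  then have "N ^ 3 = N * N - s * N" unfolding N2 by (simp add: algebra_simps)
  then show "N ^ 3 - N\<^sup>2 + 2 * N - 1 = 0" unfolding sN' by (simp add: power2_eq_square)
  show "(2 * Re \<alpha>)\<^sup>2 = 3 * N - 1 - 2 * N\<^sup>2" using Ns N2 by (simp add: s_def x_def)
qed

lemma N_bounds: "0.5698 < N" "N < 0.5699"
proof -
  have p: "(N ^ 3 - N\<^sup>2 + 2 * N - 1) - (c ^ 3 - c\<^sup>2 + 2 * c - 1) = (N - c) * (N\<^sup>2 + N * c + c\<^sup>2 - N - c + 2)" for c
    by (simp add: power2_eq_square power3_eq_cube algebra_simps)
  have "0 \<le> (N - 1/2)\<^sup>2" by simp
  then have sq: "N - 1/4 \<le> N\<^sup>2" by (simp add: power2_eq_square algebra_simps)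
  have N0: "0 \<le> N" by (simp add: N_def)
  have K: "0 < N\<^sup>2 + N * c + c\<^sup>2 - N - c + 2" if "0 \<le> c" "c \<le> 1" for c
    using sq mult_nonneg_nonneg[OF N0 that(1)] that zero_le_power2[of c] by linarith
  show "0.5698 < N"
  proof (rule ccontr)
    assume "\<not> ?thesis"
    then have "(N - 0.5698) * (N\<^sup>2 + N * 0.5698 + 0.5698\<^sup>2 - N - 0.5698 + 2) \<le> 0"
      using K[of "0.5698"] by (intro mult_nonpos_nonneg) auto
    then show False using p[of "0.5698"] N_cubic by (simp add: power2_eq_square power3_eq_cube)
  qed
  show "N < 0.5699"
  proof (rule ccontr)
    assume "\<not> ?thesis"
    then have "(N - 0.5699) * (N\<^sup>2 + N * 0.5699 + 0.5699\<^sup>2 - N - 0.5699 + 2) \<ge> 0"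
      using K[of "0.5699"] by (intro mult_nonneg_nonneg) auto
    then show False using p[of "0.5699"] N_cubic by (simp add: power2_eq_square power3_eq_cube)
  qed
qed

lemma N2_bounds: "0.32467 < N\<^sup>2" "N\<^sup>2 < 0.32479"
proof -
  have "0.5698 * 0.5698 < N * N" "N * N < 0.5699 * 0.5699"
    using N_bounds by (intro mult_strict_mono; simp)+
  then show "0.32467 < N\<^sup>2" "N\<^sup>2 < 0.32479" by (simp_all add: power2_eq_square)
qed

text \<open>All inner products of \<open>1, \<alpha>, \<alpha>\<^sup>2\<close> are polynomials in \<open>N\<close>, by \<open>N_facts\<close>.\<close>
lemma norm_el: "(norm (el p q r))\<^sup>2 =
    p\<^sup>2 + q\<^sup>2 * N + r\<^sup>2 * N\<^sup>2 + p * q * (N - N\<^sup>2) + p * r * (N - 1 - 2 * N\<^sup>2) + q * r * (2 * N - 1)"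
proof -
  define x y where "x = Re \<alpha>" and "y = Im \<alpha>"
  have a: "Re (el p q r) = p + q * x + r * (x * x - y * y)" "Im (el p q r) = q * y + 2 * r * x * y"
    by (simp_all add: el_def x_def y_def power2_eq_square algebra_simps)
  have N: "N = x\<^sup>2 + y\<^sup>2" by (simp add: N_def cmod_power2 x_def y_def)
  have "(norm (el p q r))\<^sup>2 = p\<^sup>2 + q\<^sup>2 * (x\<^sup>2 + y\<^sup>2) + r\<^sup>2 * (x\<^sup>2 + y\<^sup>2)\<^sup>2 + p * q * (2 * x)
      + p * r * ((2 * x)\<^sup>2 - 2 * (x\<^sup>2 + y\<^sup>2)) + q * r * (2 * x * (x\<^sup>2 + y\<^sup>2))"
    unfolding cmod_power2 a by (simp add: power2_eq_square algebra_simps)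
  also have "(2 * x)\<^sup>2 - 2 * (x\<^sup>2 + y\<^sup>2) = N - 1 - 2 * N\<^sup>2"
    unfolding s2[folded x_def] N[symmetric] by simp
  finally show ?thesis unfolding N[symmetric] using two_Re sN by (simp add: x_def)
qed

lemma norm_\<alpha>: "norm \<alpha> < 0.755"
proof -
  have "(norm \<alpha>)\<^sup>2 < 0.755\<^sup>2" using N_bounds by (simp add: N_def power2_eq_square)
  then show ?thesis by (rule power2_less_imp_less) simp
qed

lemma norm_powers: "(norm \<alpha>)\<^sup>2 = N" "norm \<alpha> ^ 3 < 0.4303" "norm \<alpha> ^ 4 = N\<^sup>2"
proof -
  show "(norm \<alpha>)\<^sup>2 = N" by (simp add: N_def)
  have "norm \<alpha> ^ 3 = N * norm \<alpha>" by (simp add: N_def power2_eq_square power3_eq_cube)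
  also have "\<dots> \<le> 0.5699 * 0.755" using N_bounds norm_\<alpha> by (intro mult_mono) auto
  finally show "norm \<alpha> ^ 3 < 0.4303" by simp
  show "norm \<alpha> ^ 4 = N\<^sup>2" by (simp add: N_def flip: power_mult)
qed

end

section \<open>The product system\<close>

context cubic_root begin

definition f :: "piece \<Rightarrow> complex \<Rightarrow> complex" where
  "f i z = (case i of P1 \<Rightarrow> \<alpha> * z | P2 \<Rightarrow> 1 + \<alpha>\<^sup>2 * z | P3 \<Rightarrow> \<alpha> + \<alpha>\<^sup>2 + \<alpha> ^ 4 * z)"

lemma f_simps: "f P1 z = \<alpha> * z" "f P2 z = 1 + \<alpha>\<^sup>2 * z" "f P3 z = \<alpha> + \<alpha>\<^sup>2 + \<alpha> ^ 4 * z"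
  by (simp_all add: f_def)

lemma f_diff: "f P1 z - f P1 w = \<alpha> * (z - w)" "f P2 z - f P2 w = \<alpha>\<^sup>2 * (z - w)" "f P3 z - f P3 w = \<alpha> ^ 4 * (z - w)"
  by (simp_all add: f_simps algebra_simps)

lemma \<alpha>_nz: "\<alpha> \<noteq> 0" using root by auto

lemma norm_\<alpha>_le: "norm \<alpha> \<le> 1" "norm \<alpha> < 1" using norm_\<alpha> by auto

lemma f_contract: "norm (f i z - f i w) \<le> norm \<alpha> * norm (z - w)"
proof -
  have "norm \<alpha> ^ n \<le> norm \<alpha>" if "0 < n" for n
    using power_decreasing[of 1 n "norm \<alpha>"] that norm_\<alpha>_le by simp
  then show ?thesis
    by (cases i) (simp_all add: f_diff norm_mult norm_power mult_right_mono)
qed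

lemma f_inj: "f i z = f i w \<Longrightarrow> z = w"
  using \<alpha>_nz by (cases i) (simp_all add: f_simps)

lemma el_mult2: "\<alpha>\<^sup>2 * el p q r = \<alpha> * (\<alpha> * el p q r)" "\<alpha> ^ 4 * el p q r = \<alpha> * (\<alpha> * (\<alpha> * (\<alpha> * el p q r)))"
  "\<alpha> ^ 3 * el p q r = \<alpha> * (\<alpha> * (\<alpha> * el p q r))"
  by (simp_all add: power_numeral_reduce mult.assoc)

lemma el_one: "1 = el 1 0 0" and el_shift3: "\<alpha> + \<alpha>\<^sup>2 = el 0 1 1"
  by (simp_all add: el_def)

lemma f_el: "f P1 (el p q r) = el r (p - r) (q + 2 * r)"
  "f P2 (el p q r) = el 1 0 0 + \<alpha> * (\<alpha> * el p q r)"
  "f P3 (el p q r) = el 0 1 1 + \<alpha> * (\<alpha> * (\<alpha> * (\<alpha> * el p q r)))"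
  unfolding f_simps el_mult2 el_shift3 el_mult by (simp_all add: el_one)

text \<open>The squared norm, sorted as an affine expression in \<open>N\<close> and \<open>N\<^sup>2\<close>: for numerical coordinates, linear
arithmetic then decides every estimate from bounds on \<open>N\<close> and \<open>N\<^sup>2\<close>.\<close>
definition sq_norm :: "real \<Rightarrow> real \<Rightarrow> real \<Rightarrow> real" where
  "sq_norm p q r =
    (p * p - p * r - q * r) + (q * q + p * q + p * r + 2 * q * r) * N + (r * r - p * q - 2 * p * r) * N\<^sup>2"

lemma norm_el_sq_norm: "(norm (el p q r))\<^sup>2 = sq_norm p q r"
  unfolding norm_el sq_norm_def by (simp add: algebra_simps power2_eq_square)

lemma norm_el_leI:
  assumes "sq_norm p q r \<le> c * c" "0 \<le> c" shows "norm (el p q r) \<le> c"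
  using assms norm_el_sq_norm[of p q r] by (metis power2_eq_square power2_le_imp_le)

lemma N_range: "2849 / 5000 < N" "N < 5699 / 10000" "32467 / 100000 < N\<^sup>2" "N\<^sup>2 < 32479 / 100000"
  using N_bounds N2_bounds by simp_all

text \<open>A disc that the maps \<open>f i\<close> send into themselves. The radius is nearly the smallest one for which
the estimate for \<open>f P1\<close> works: the smaller the disc, the more differences are excluded by \<open>far_apart\<close>.\<close>
definition B :: "complex set" where "B = cball (1/4) (79/50)"

lemma f_B: assumes "z \<in> B" shows "f i z \<in> B"
proof -
  have z: "norm (z - 1/4) \<le> 79/50" using assms by (simp add: B_def dist_norm norm_minus_commute)
  have q: "1/4 = el (1/4) 0 0" by (simp add: el_def)
  have tri: "norm (f i z - 1/4) \<le> norm (f i z - f i (1/4)) + norm (f i (1/4) - 1/4)"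
    using norm_triangle_ineq[of "f i z - f i (1/4)" "f i (1/4) - 1/4"] by simp
  have "norm (f i z - f i (1/4)) + norm (f i (1/4) - 1/4) \<le> 79/50"
  proof (cases i)
    case P1
    have "norm (f P1 z - f P1 (1/4)) \<le> 0.755 * (79/50)"
      unfolding f_diff norm_mult using norm_\<alpha> z by (intro mult_mono) auto
    moreover have "norm (f P1 (1/4) - 1/4) \<le> 0.3871"
      unfolding q f_el el_diff
      by (rule norm_el_leI; simp add: sq_norm_def; insert N_range; linarith)
    ultimately show ?thesis unfolding P1 by simp
  next
    case P2
    have "norm (f P2 z - f P2 (1/4)) \<le> 0.5699 * (79/50)"
      unfolding f_diff norm_mult norm_power norm_powers using N_bounds z by (intro mult_mono) auto
    moreover have "norm (f P2 (1/4) - 1/4) \<le> 0.679"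
      unfolding q f_el el_mult el_add el_diff
      by (rule norm_el_leI; simp add: sq_norm_def; insert N_range; linarith)
    ultimately show ?thesis unfolding P2 by simp
  next
    case P3
    have "norm (f P3 z - f P3 (1/4)) \<le> 0.32479 * (79/50)"
      unfolding f_diff norm_mult norm_power norm_powers using N2_bounds z by (intro mult_mono) auto
    moreover have "norm (f P3 (1/4) - 1/4) \<le> 1.0666"
      unfolding q f_el el_mult el_add el_diff
      by (rule norm_el_leI; simp add: sq_norm_def; insert N_range; linarith)
    ultimately show ?thesis unfolding P3 by simp
  qed
  then show ?thesis using tri by (simp add: B_def dist_norm norm_minus_commute)
qed

text \<open>An attractor of the maps \<open>g i \<times> f i\<close>. It turns out to be the graph of a homeomorphism between \<open>Q\<close> and
a compact subset of the plane.\<close>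
definition Graph :: "(complex \<times> complex) set" where
  "Graph = (SOME S. compact S \<and> S \<subseteq> Q \<times> B \<and> S = (\<Union>i. (\<lambda>p. (g i (fst p), f i (snd p))) ` S) \<and> fst ` S = Q)"

lemma g_continuous: "continuous_on S (g i)"
proof -
  have "\<kappa>-lipschitz_on S (g i)"
    by (rule lipschitz_onI) (use g_lipschitz in \<open>auto simp: dist_norm \<kappa>_def\<close>)
  then show ?thesis by (rule lipschitz_on_continuous_on)
qed

lemma Graph: "compact Graph" "Graph \<subseteq> Q \<times> B" "Graph = (\<Union>i. (\<lambda>p. (g i (fst p), f i (snd p))) ` Graph)" "fst ` Graph = Q"
proof -
  let ?\<phi> = "\<lambda>i p. (g i (fst p), f i (snd p))"
  have B0: "B \<noteq> {}" by (simp add: B_def)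
  have Q0: "Q \<noteq> {}" using side_Q[of 0 0] by auto
  have fst: "fst ` (Q \<times> B) = Q" using B0 by simp
  obtain S where "compact S" "S \<subseteq> Q \<times> B" "S = (\<Union>i. ?\<phi> i ` S)" "fst ` S = fst ` (Q \<times> B)"
  proof (rule attractor_exists[where K = "Q \<times> B" and \<phi> = ?\<phi> and \<pi> = fst and G = g])
    show "compact (Q \<times> B)" using compact_Q by (simp add: B_def compact_Times)
    show "Q \<times> B \<noteq> {}" using B0 Q0 by simp
    show "continuous_on (Q \<times> B) (?\<phi> i)" for i
    proof (intro continuous_on_Pair)
      show "continuous_on (Q \<times> B) (\<lambda>p. g i (fst p))"
        by (intro continuous_on_compose2[OF g_continuous[of UNIV]] continuous_intros) auto
      show "continuous_on (Q \<times> B) (\<lambda>p. f i (snd p))"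
        by (cases i) (simp_all add: f_simps continuous_intros)
    qed
    show "inj_on (?\<phi> i) (Q \<times> B)" for i
      by (rule inj_onI) (simp add: prod_eq_iff, metis g_inj f_inj)
    show "?\<phi> i ` (Q \<times> B) \<subseteq> Q \<times> B" for i using g_Q f_B by auto
    show "fst ` (Q \<times> B) \<subseteq> (\<Union>i. g i ` fst ` (Q \<times> B))" unfolding fst using Q_Union by simp
  qed (simp_all add: continuous_on_fst continuous_on_id)
  then have "\<exists>S. compact S \<and> S \<subseteq> Q \<times> B \<and> S = (\<Union>i. ?\<phi> i ` S) \<and> fst ` S = Q"
    unfolding fst by (intro exI[of _ S] conjI)
  note G = someI_ex[OF this, folded Graph_def]
  show "compact Graph" by (rule conjunct1[OF G])
  show "Graph \<subseteq> Q \<times> B" by (rule conjunct1[OF conjunct2[OF G]])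
  show "Graph = (\<Union>i. (\<lambda>p. (g i (fst p), f i (snd p))) ` Graph)" by (rule conjunct1[OF conjunct2[OF conjunct2[OF G]]])
  show "fst ` Graph = Q" by (rule conjunct2[OF conjunct2[OF conjunct2[OF G]]])
qed

lemma Graph_Q: "(x, u) \<in> Graph \<Longrightarrow> x \<in> Q" and Graph_B: "(x, u) \<in> Graph \<Longrightarrow> u \<in> B"
  using Graph(2) by auto

lemma Graph_step: assumes "(x, u) \<in> Graph" obtains i y v where "(y, v) \<in> Graph" "x = g i y" "u = f i v"
proof -
  have "(x, u) \<in> (\<Union>i. (\<lambda>p. (g i (fst p), f i (snd p))) ` Graph)"
    by (rule subsetD[OF equalityD1[OF Graph(3)] assms])
  then show thesis using that by auto
qed

lemma Graph_intro: "(y, v) \<in> Graph \<Longrightarrow> (g i y, f i v) \<in> Graph"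
  by (rule subsetD[OF equalityD2[OF Graph(3)]]) force

end

text \<open>Uniqueness statements below are proved by letting an error shrink under repeated subdivision.\<close>
lemma geometric_zero:
  fixes x r D :: real
  assumes "\<And>n. x \<le> r ^ n * D" "0 \<le> r" "r < 1" shows "x \<le> 0"
proof -
  have "(\<lambda>n. r ^ n * D) \<longlonglongrightarrow> 0 * D" using assms by (intro tendsto_mult LIMSEQ_realpow_zero) auto
  then show ?thesis using assms(1) by (intro LIMSEQ_le_const[of "\<lambda>n. r ^ n * D" 0 x]) auto
qed

section \<open>Sides and vertices\<close>

lemma side_0 [simp]: "side j 0 = V j" and side_1: "side j 1 = V (j + 1)"
  by (simp_all add: side_def)

lemma g_V: "j < 7 \<Longrightarrow> g i (V j) = W i j"
  using g_side[of j 0 i] by simp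

lemma V_Q: "j < 7 \<Longrightarrow> V j \<in> Q"
  using side_Q[of j 0] by simp

text \<open>How the maps subdivide the sides. In the order of orientation, with cut points at the stated ratios:
\<open>a\<close> consists of \<open>g\<^sub>2 n\<close> and \<open>g\<^sub>1 m\<close>; \<open>Y\<close> of \<open>g\<^sub>1 n\<close>, \<open>g\<^sub>3 a\<close>, \<open>g\<^sub>3 m\<close> and \<open>g\<^sub>3 Y\<close>; \<open>n\<close> of \<open>g\<^sub>3 n\<close>, \<open>g\<^sub>1 p\<close> and \<open>g\<^sub>1 q\<close>;
while \<open>m = g\<^sub>1 Y\<close>, \<open>e = g\<^sub>2 a\<close>, \<open>p = g\<^sub>2 m\<close> and \<open>q = g\<^sub>2 Y\<close>. The boundary arcs of the attractor in the
plane obey the same rules.\<close>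
lemma side_images:
  assumes t: "0 \<le> t" "t \<le> 1"
  shows "g P3 (side 3 t) = side 3 (t / 4)" "g P1 (side 5 t) = side 3 ((1 + t) / 4)" "g P1 (side 6 t) = side 3 ((1 + t) / 2)"
    "g P3 (side 2 t) = side 2 ((3 + t) / 4)" "g P3 (side 0 t) = side 2 (1 / 2 + t / 8)" "g P3 (side 1 t) = side 2 (5 / 8 + t / 8)"
    "g P1 (side 3 t) = side 2 (t / 2)" "g P1 (side 2 t) = side 1 t"
    "g P2 (side 2 t) = side 6 t" "g P2 (side 1 t) = side 5 t" "g P2 (side 0 t) = side 4 t"
    "g P1 (side 1 t) = side 0 ((1 + t) / 2)" "g P2 (side 3 t) = side 0 (t / 2)"
  using t by (simp_all add: g_side) (simp_all add: side_def V_def complex_eq_iff field_simps)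

lemma cut_side:
  "cut1 (side j s) = (1 - s) * cut1 (V j) + s * cut1 (V (j + 1))"
  "cut2 (side j s) = (1 - s) * cut2 (V j) + s * cut2 (V (j + 1))"
  by (simp_all add: side_def cut1_def cut2_def algebra_simps)

lemma cut_V:
  "cut1 (V 0) = -12928" "cut1 (V 1) = 12928" "cut1 (V 2) = 20608" "cut1 (V 3) = 15104" "cut1 (V 4) = 0"
  "cut1 (V 5) = -9216" "cut1 (V 6) = -13056" "cut1 (V 7) = -12928"
  "cut2 (V 0) = 13280" "cut2 (V 1) = 6496" "cut2 (V 2) = 1120" "cut2 (V 3) = -1120" "cut2 (V 4) = 3360"
  "cut2 (V 5) = 7200" "cut2 (V 6) = 9888" "cut2 (V 7) = 13280"
  by (simp_all add: cut1_def cut2_def V_def)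

lemma only_piece:
  assumes "y \<in> Q"
  shows "cut1 (g i y) < 0 \<Longrightarrow> i = P2" "0 < cut1 (g i y) \<Longrightarrow> 0 < cut2 (g i y) \<Longrightarrow> i = P1"
    "cut2 (g i y) < 0 \<Longrightarrow> i = P3" "0 < cut1 (g i y) \<Longrightarrow> i = P1 \<or> i = P3" "0 < cut2 (g i y) \<Longrightarrow> i = P1 \<or> i = P2"
  using cut_signs[OF assms] by (cases i; simp)+

text \<open>The sides \<open>m\<close> and \<open>a\<close> as one curve, traversed backwards from \<open>V 2\<close> to \<open>V 0\<close>.\<close>
definition arc_am :: "real \<Rightarrow> complex" where
  "arc_am t = (if t \<le> 1/2 then side 1 (1 - 2 * t) else side 0 (2 - 2 * t))"

text \<open>The sides \<open>q, p, e\<close> as one curve, traversed backwards from \<open>V 0\<close> to \<open>V 4\<close>; the breakpoints \<open>1/2\<close> and \<open>3/4\<close> are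
those at which the images of these sides meet on a chord.\<close>
definition arc_qpe :: "real \<Rightarrow> complex" where
  "arc_qpe t = (if t \<le> 1/2 then side 6 (1 - 2 * t) else if t \<le> 3/4 then side 5 (3 - 4 * t) else side 4 (4 - 4 * t))"

lemma arc_am_Q: "0 \<le> t \<Longrightarrow> t \<le> 1 \<Longrightarrow> arc_am t \<in> Q" and arc_qpe_Q: "0 \<le> t \<Longrightarrow> t \<le> 1 \<Longrightarrow> arc_qpe t \<in> Q"
  by (auto simp: arc_am_def arc_qpe_def intro!: side_Q)

lemma g3_am: assumes "0 \<le> t" "t \<le> 1" shows "g P3 (arc_am t) = side 2 (3 / 4 - t / 4)"
proof -
  have e: "5 / 8 + (1 - 2 * t) / 8 = 3 / 4 - t / 4" "1 / 2 + (2 - 2 * t) / 8 = 3 / 4 - t / 4" by (simp_all add: field_simps)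
  show ?thesis using assms side_images(5)[of "2 - 2 * t"] side_images(6)[of "1 - 2 * t"] by (simp add: arc_am_def e)
qed

lemma g2_am: assumes "0 \<le> t" "t \<le> 1" shows "g P2 (arc_am t) = arc_qpe ((1 + t) / 2)"
proof (cases "t = 0")
  case True
  have "side 6 0 = side 5 1" by (simp add: side_1)
  then show ?thesis using True side_images(10)[of 1] by (simp add: arc_am_def arc_qpe_def)
next
  case False
  have e: "3 - 4 * ((1 + t) / 2) = 1 - 2 * t" "4 - 4 * ((1 + t) / 2) = 2 - 2 * t" by (simp_all add: field_simps)
  show ?thesis using False assms side_images(11)[of "2 - 2 * t"] side_images(10)[of "1 - 2 * t"]
    unfolding arc_am_def arc_qpe_def e by auto
qed

text \<open>The chords seen from both sides: each is the image of one side of \<open>Q\<close> under \<open>g P1\<close>, and the image of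
three sides under the map of the other cell.\<close>
lemma chord1: assumes "0 \<le> t" "t \<le> 1" shows "g P2 (arc_qpe t) = g P1 (side 0 t)"
  using assms by (auto simp: arc_qpe_def g_side complex_eq_iff field_simps)

lemma chord2: assumes "0 \<le> t" "t \<le> 1" shows "g P3 (arc_qpe t) = g P1 (side 4 t)"
  using assms by (auto simp: arc_qpe_def g_side complex_eq_iff field_simps)

declare side_Q [intro] arc_am_Q [intro]

context cubic_root begin

text \<open>The points of the plane that correspond to the vertices of \<open>Q\<close>. They are determined by \<open>f_vertex_image\<close>,
starting from the fixed point of \<open>f P3\<close> at the fixed vertex \<open>V 3\<close>.\<close>
definition vertex_image :: "nat \<Rightarrow> complex" where
  "vertex_image = cyclic [el 1 (-1) 0, el 0 (-1) 0, el (-1) 0 0, el (-1) 2 (-1), el 0 1 (-1), el 0 1 (-2), el 1 0 (-1)]"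

lemma vertex_image_vals: "vertex_image 0 = el 1 (-1) 0" "vertex_image (Suc 0) = el 0 (-1) 0" "vertex_image 2 = el (-1) 0 0" "vertex_image 3 = el (-1) 2 (-1)"
  "vertex_image 4 = el 0 1 (-1)" "vertex_image 5 = el 0 1 (-2)" "vertex_image 6 = el 1 0 (-1)" "vertex_image 7 = el 1 (-1) 0"
  by (simp_all add: vertex_image_def)

lemma f_vertex_image:
  "f P2 (vertex_image 3) = vertex_image 0" "f P1 (vertex_image 2) = vertex_image 1" "f P1 (vertex_image 3) = vertex_image 2" "f P3 (vertex_image 3) = vertex_image 3" "f P1 (vertex_image 0) = vertex_image 4"
  "f P2 (vertex_image 0) = vertex_image 4" "f P2 (vertex_image 1) = vertex_image 5" "f P2 (vertex_image 2) = vertex_image 6"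
  by (simp_all add: vertex_image_vals f_el el_mult el_add)

lemma vertex_pre:
  assumes y: "y \<in> Q" and e: "g i y = V j" and j: "j < 7"
  shows "\<exists>l<7. y = V l \<and> f i (vertex_image l) = vertex_image j"
proof -
  have pre: "\<exists>l<7. y = V l \<and> f i (vertex_image l) = vertex_image j" if "l < 7" "W i l = V j" "f i (vertex_image l) = vertex_image j" for l
    using g_inj[of i y "V l"] e that g_V by metis
  have "j = 0 \<or> j = 1 \<or> j = 2 \<or> j = 3 \<or> j = 4 \<or> j = 5 \<or> j = 6" using j by linarith
  then show ?thesis
  proof (elim disjE)
    assume j: "j = 0"
    have i: "i = P2" by (rule only_piece(1)[OF y]) (simp add: e j cut_V)
    show ?thesis by (rule pre[of 3]) (simp_all add: i j V_def f_vertex_image[simplified])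
  next
    assume j: "j = 1"
    have i: "i = P1" by (rule only_piece(2)[OF y]) (simp_all add: e j cut_V[simplified])
    show ?thesis by (rule pre[of 2]) (simp_all add: i j V_def f_vertex_image[simplified])
  next
    assume j: "j = 2"
    have i: "i = P1" by (rule only_piece(2)[OF y]) (simp_all add: e j cut_V)
    show ?thesis by (rule pre[of 3]) (simp_all add: i j V_def f_vertex_image[simplified])
  next
    assume j: "j = 3"
    have i: "i = P3" by (rule only_piece(3)[OF y]) (simp add: e j cut_V)
    show ?thesis by (rule pre[of 3]) (simp_all add: i j V_def f_vertex_image[simplified])
  next
    assume j: "j = 4"
    have "i = P1 \<or> i = P2" by (rule only_piece(5)[OF y]) (simp add: e j cut_V)
    then show ?thesis by (intro pre[of 0]) (auto simp: j V_def f_vertex_image)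
  next
    assume j: "j = 5"
    have i: "i = P2" by (rule only_piece(1)[OF y]) (simp add: e j cut_V)
    show ?thesis by (rule pre[of 1]) (simp_all add: i j V_def f_vertex_image[simplified])
  next
    assume j: "j = 6"
    have i: "i = P2" by (rule only_piece(1)[OF y]) (simp add: e j cut_V)
    show ?thesis by (rule pre[of 2]) (simp_all add: i j V_def f_vertex_image[simplified])
  qed
qed

lemma norm_B: "u \<in> B \<Longrightarrow> norm u \<le> 2"
  using norm_triangle_ineq[of "u - 1/4" "1/4"] by (simp add: B_def dist_norm norm_minus_commute norm_divide)

text \<open>The preimage of a vertex under any of the maps is again a vertex, and the distance to the expected
value shrinks by \<open>|\<alpha>|\<close> with each preimage.\<close>
lemma fibre_vertex:
  assumes "(V j, u) \<in> Graph" "j < 7" shows "u = vertex_image j"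
proof -
  define D where "D = 2 + (\<Sum>j<7. norm (vertex_image j))"
  have D: "norm (u - vertex_image j) \<le> D" if "u \<in> B" "j < 7" for u j
  proof -
    have "norm (vertex_image j) \<le> (\<Sum>j<7. norm (vertex_image j))" using that by (intro member_le_sum) auto
    then show ?thesis using norm_triangle_ineq4[of u "vertex_image j"] norm_B[OF that(1)] unfolding D_def by linarith
  qed
  have "norm (u - vertex_image j) \<le> norm \<alpha> ^ n * D" if "(V j, u) \<in> Graph" "j < 7" for n u j
    using that
  proof (induction n arbitrary: u j)
    case 0 then show ?case using D Graph_B by simp
  next
    case (Suc n)
    obtain i y v where s: "(y, v) \<in> Graph" "V j = g i y" "u = f i v" using Graph_step[OF Suc.prems(1)] .
    obtain l where l: "l < 7" "y = V l" "f i (vertex_image l) = vertex_image j"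
      using vertex_pre[OF Graph_Q[OF s(1)] s(2)[symmetric] Suc.prems(2)] by blast
    have "norm (u - vertex_image j) \<le> norm \<alpha> * norm (v - vertex_image l)" using f_contract[of i v "vertex_image l"] s(3) l(3) by simp
    also have "\<dots> \<le> norm \<alpha> * (norm \<alpha> ^ n * D)"
      using Suc.IH s(1) l by (intro mult_left_mono) auto
    finally show ?case by (simp add: mult.assoc)
  qed
  then have "norm (u - vertex_image j) \<le> 0" using assms by (intro geometric_zero[of _ "norm \<alpha>" D]) (auto simp: norm_\<alpha>_le)
  then show ?thesis by simp
qed

text \<open>The points at which the folding relations are cut in \<open>fold_estimate\<close>. Where such a point is the end of
a chord it lies in two cells, and both descriptions lead to the same value.\<close>
lemma fibre_junction:
  "(side 3 (1/4), u) \<in> Graph \<Longrightarrow> u = el (-2) 2 (-3)"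
  "(side 3 (1/2), u) \<in> Graph \<Longrightarrow> u = el (-1) 2 (-2)"
  "(side 2 (1/2), u) \<in> Graph \<Longrightarrow> u = el (-1) 1 (-1)"
  "(side 2 (3/4), u) \<in> Graph \<Longrightarrow> u = el (-2) 2 (-2)"
  "(side 0 (1/2), u) \<in> Graph \<Longrightarrow> u = el 0 0 (-1)"
proof -
  have fib: "u = c" if x: "(x, u) \<in> Graph"
    and pre: "\<And>i y. y \<in> Q \<Longrightarrow> x = g i y \<Longrightarrow> \<exists>l<7. W i l = x \<and> f i (vertex_image l) = c" for x u c
  proof -
    obtain i y v where s: "(y, v) \<in> Graph" "x = g i y" "u = f i v" using Graph_step[OF x] .
    obtain l where l: "l < 7" "W i l = x" "f i (vertex_image l) = c" using pre[OF Graph_Q[OF s(1)] s(2)] by blast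
    have "y = V l" using g_inj[of i y "V l"] s(2) l g_V by metis
    then show ?thesis using fibre_vertex s l by blast
  qed
  show "u = el (-2) 2 (-3)" if h: "(side 3 (1/4), u) \<in> Graph"
  proof (rule fib[OF h])
    fix i y assume y: "y \<in> Q" and e: "side 3 (1/4) = g i y"
    have "i = P1 \<or> i = P3" by (rule only_piece(4)[OF y]) (simp add: e[symmetric] cut_side cut_V cut_V[simplified])
    then show "\<exists>l<7. W i l = side 3 (1/4) \<and> f i (vertex_image l) = el (-2) 2 (-3)"
      by (intro exI[of _ "if i = P1 then 5 else 4"]) (auto simp: side_def V_def complex_eq_iff vertex_image_vals f_el el_mult el_add)
  qed
  show "u = el (-1) 2 (-2)" if h: "(side 3 (1/2), u) \<in> Graph"
  proof (rule fib[OF h])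
    fix i y assume y: "y \<in> Q" and e: "side 3 (1/2) = g i y"
    have "i = P1" by (rule only_piece(2)[OF y]) (simp_all add: e[symmetric] cut_side cut_V cut_V[simplified])
    then show "\<exists>l<7. W i l = side 3 (1/2) \<and> f i (vertex_image l) = el (-1) 2 (-2)"
      by (intro exI[of _ "6"]) (auto simp: side_def V_def complex_eq_iff vertex_image_vals f_el el_mult el_add)
  qed
  show "u = el (-1) 1 (-1)" if h: "(side 2 (1/2), u) \<in> Graph"
  proof (rule fib[OF h])
    fix i y assume y: "y \<in> Q" and e: "side 2 (1/2) = g i y"
    have "i = P1 \<or> i = P3" by (rule only_piece(4)[OF y]) (simp add: e[symmetric] cut_side cut_V cut_V[simplified])
    then show "\<exists>l<7. W i l = side 2 (1/2) \<and> f i (vertex_image l) = el (-1) 1 (-1)"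
      by (intro exI[of _ "if i = P1 then 4 else 0"]) (auto simp: side_def V_def complex_eq_iff vertex_image_vals f_el el_mult el_add)
  qed
  show "u = el (-2) 2 (-2)" if h: "(side 2 (3/4), u) \<in> Graph"
  proof (rule fib[OF h])
    fix i y assume y: "y \<in> Q" and e: "side 2 (3/4) = g i y"
    have "i = P3" by (rule only_piece(3)[OF y]) (simp add: e[symmetric] cut_side cut_V cut_V[simplified])
    then show "\<exists>l<7. W i l = side 2 (3/4) \<and> f i (vertex_image l) = el (-2) 2 (-2)"
      by (intro exI[of _ "2"]) (auto simp: side_def V_def complex_eq_iff vertex_image_vals f_el el_mult el_add)
  qed
  show "u = el 0 0 (-1)" if h: "(side 0 (1/2), u) \<in> Graph"
  proof (rule fib[OF h])
    fix i y assume y: "y \<in> Q" and e: "side 0 (1/2) = g i y"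
    have "i = P1 \<or> i = P2" by (rule only_piece(5)[OF y]) (simp add: e[symmetric] cut_side cut_V cut_V[simplified])
    then show "\<exists>l<7. W i l = side 0 (1/2) \<and> f i (vertex_image l) = el 0 0 (-1)"
      by (intro exI[of _ "if i = P1 then 1 else 4"]) (auto simp: side_def V_def complex_eq_iff vertex_image_vals f_el el_mult el_add)
  qed
qed

end

section \<open>The projection to the heptagon is injective\<close>

context cubic_root begin

lemma pull1:
  assumes "(x, u) \<in> Graph" "x = g P1 y" "y \<in> Q" "0 < cut1 x" "0 < cut2 x"
  obtains v where "(y, v) \<in> Graph" "u = f P1 v"
proof -
  obtain i z v where z: "(z, v) \<in> Graph" "x = g i z" "u = f i v" using Graph_step[OF assms(1)] .
  have "i = P1" using only_piece[OF Graph_Q[OF z(1)], of i] assms(4,5) z(2) by simp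
  then show thesis using that z assms(2) g_inj by metis
qed

lemma pull2:
  assumes "(x, u) \<in> Graph" "x = g P2 y" "y \<in> Q" "cut1 x < 0"
  obtains v where "(y, v) \<in> Graph" "u = f P2 v"
proof -
  obtain i z v where z: "(z, v) \<in> Graph" "x = g i z" "u = f i v" using Graph_step[OF assms(1)] .
  have "i = P2" using only_piece[OF Graph_Q[OF z(1)], of i] assms(4) z(2) by simp
  then show thesis using that z assms(2) g_inj by metis
qed

lemma pull3:
  assumes "(x, u) \<in> Graph" "x = g P3 y" "y \<in> Q" "cut2 x < 0"
  obtains v where "(y, v) \<in> Graph" "u = f P3 v"
proof -
  obtain i z v where z: "(z, v) \<in> Graph" "x = g i z" "u = f i v" using Graph_step[OF assms(1)] .
  have "i = P3" using only_piece[OF Graph_Q[OF z(1)], of i] assms(4) z(2) by simp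
  then show thesis using that z assms(2) g_inj by metis
qed

lemma cut_sides:
  "cut1 (side 0 s) = 12928 * (2 * s - 1)" "cut2 (side 0 s) = 13280 - 6784 * s"
  "cut1 (side 1 s) = 12928 + 7680 * s" "cut2 (side 1 s) = 6496 - 5376 * s"
  "cut1 (side 2 s) = 20608 - 5504 * s" "cut2 (side 2 s) = 1120 * (1 - 2 * s)"
  "cut1 (side 3 s) = 15104 * (1 - s)" "cut2 (side 3 s) = 1120 * (4 * s - 1)"
  "cut1 (side 4 s) = - 9216 * s" "cut1 (side 5 s) = - 9216 - 3840 * s" "cut1 (side 6 s) = 128 * s - 13056"
  by (simp_all add: side_def V_def cut1_def cut2_def algebra_simps)

lemmas cut_sides' = cut_sides cut_sides(3,4)[unfolded One_nat_def]

lemma shrink: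
  fixes e e' :: complex
  assumes "e = c * e'" "norm e' \<le> norm \<alpha> ^ n * D" "norm c \<le> norm \<alpha>"
  shows "norm e \<le> norm \<alpha> ^ Suc n * D"
proof -
  have "norm e = norm c * norm e'" using assms(1) by (simp add: norm_mult)
  also have "\<dots> \<le> norm \<alpha> * (norm \<alpha> ^ n * D)" using assms by (intro mult_mono) auto
  finally show ?thesis by (simp add: mult.assoc)
qed

lemma norm_pow_le: "0 < n \<Longrightarrow> norm (\<alpha> ^ n) \<le> norm \<alpha>" "0 < n \<Longrightarrow> norm (- (\<alpha> ^ n)) \<le> norm \<alpha>"
  using power_decreasing[of 1 n "norm \<alpha>"] norm_\<alpha>_le by (simp_all add: norm_power)

text \<open>The folding relation of the sides \<open>n\<close> and \<open>Y\<close> splits at \<open>s = 1/4\<close> and \<open>s = 1/2\<close> into a copy of itself, a copy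
of the relation of \<open>Y\<close> with \<open>m \<union> a\<close>, and a copy of itself with exchanged roles. The latter relation splits
into three such copies at \<open>t = 1/2\<close> and \<open>t = 3/4\<close>. In every case the error is multiplied by a power of \<open>\<alpha>\<close>.\<close>
lemma fold_estimate:
  fixes D :: real
  defines "D \<equiv> 4 + norm (2 * \<alpha> - \<alpha>\<^sup>2) + norm (\<alpha> - 1)"
  shows "(\<forall>s u v. 0 \<le> s \<longrightarrow> s \<le> 1 \<longrightarrow> (side 3 s, u) \<in> Graph \<longrightarrow> (side 2 (1 - s), v) \<in> Graph \<longrightarrow>
            norm (u - (\<alpha> * v + (2 * \<alpha> - \<alpha>\<^sup>2))) \<le> norm \<alpha> ^ n * D) \<and>
         (\<forall>t u v. 0 \<le> t \<longrightarrow> t \<le> 1 \<longrightarrow> (side 2 t, u) \<in> Graph \<longrightarrow> (arc_am t, v) \<in> Graph \<longrightarrow>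
            norm (u - (\<alpha> * v + (\<alpha> - 1))) \<le> norm \<alpha> ^ n * D)"
proof (induction n)
  case 0
  have b: "norm (u - (\<alpha> * v + c)) \<le> 4 + norm c" if "(x, u) \<in> Graph" "(y, v) \<in> Graph" for x y u v c
  proof -
    have "norm u \<le> 2" "norm v \<le> 2" using that Graph_B norm_B by blast+
    moreover have "norm \<alpha> * norm v \<le> 1 * norm v" using norm_\<alpha>_le by (intro mult_right_mono) auto
    ultimately show ?thesis
      using norm_triangle_ineq4[of u "\<alpha> * v + c"] norm_triangle_ineq[of "\<alpha> * v" c] by (simp add: norm_mult)
  qed
  have "norm (u - (\<alpha> * v + (2 * \<alpha> - \<alpha>\<^sup>2))) \<le> D \<and> norm (u - (\<alpha> * v + (\<alpha> - 1))) \<le> D"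
    if "(x, u) \<in> Graph" "(y, v) \<in> Graph" for x y u v
    using b[OF that, of "2 * \<alpha> - \<alpha>\<^sup>2"] b[OF that, of "\<alpha> - 1"] norm_ge_zero[of "2 * \<alpha> - \<alpha>\<^sup>2"] norm_ge_zero[of "\<alpha> - 1"]
    unfolding D_def by linarith
  then show ?case by simp
next
  case (Suc n)
  have D0: "0 \<le> D" unfolding D_def by simp
  have IX: "norm (u - (\<alpha> * v + (2 * \<alpha> - \<alpha>\<^sup>2))) \<le> norm \<alpha> ^ n * D"
    if "(side 3 s, u) \<in> Graph" "(side 2 (1 - s), v) \<in> Graph" "0 \<le> s" "s \<le> 1" for s u v
    using Suc that by blast
  have IY: "norm (u - (\<alpha> * v + (\<alpha> - 1))) \<le> norm \<alpha> ^ n * D"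
    if "(side 2 t, u) \<in> Graph" "(arc_am t, v) \<in> Graph" "0 \<le> t" "t \<le> 1" for t u v
    using Suc that by blast
  have zero: "norm e \<le> norm \<alpha> ^ Suc n * D" if "e = 0" for e :: complex
    using that D0 by simp
  have X: "norm (u - (\<alpha> * v + (2 * \<alpha> - \<alpha>\<^sup>2))) \<le> norm \<alpha> ^ Suc n * D"
    if s: "0 \<le> s" "s \<le> 1" and u: "(side 3 s, u) \<in> Graph" and v: "(side 2 (1 - s), v) \<in> Graph" for s u v
  proof -
    consider "s < 1/4" | "s = 1/4" | "1/4 < s" "s < 1/2" | "s = 1/2" | "1/2 < s" "s < 1" | "s = 1"
      using s by linarith
    then show ?thesis
    proof cases
      case 1
      obtain u' where u': "(side 3 (4 * s), u') \<in> Graph" "u = f P3 u'"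
        by (rule pull3[OF u, of "side 3 (4 * s)"]) (use 1 s side_images(1)[of "4 * s"] in \<open>auto simp: cut_sides'\<close>)
      obtain v' where v': "(side 2 (1 - 4 * s), v') \<in> Graph" "v = f P3 v'"
      proof (rule pull3[OF v, of "side 2 (1 - 4 * s)"])
        have e: "(3 + (1 - 4 * s)) / 4 = 1 - s" by simp
        show "side 2 (1 - s) = g P3 (side 2 (1 - 4 * s))"
          using 1 s side_images(4)[of "1 - 4 * s", unfolded e] by simp
      qed (use 1 s in \<open>auto simp: cut_sides'\<close>)
      have "u - (\<alpha> * v + (2 * \<alpha> - \<alpha>\<^sup>2)) = \<alpha> ^ 4 * (u' - (\<alpha> * v' + (2 * \<alpha> - \<alpha>\<^sup>2)))"
        unfolding u'(2) v'(2) f_simps using cube by algebra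
      then show ?thesis using IX[OF u'(1) v'(1)] 1 s by (elim shrink) (auto intro: norm_pow_le)
    next
      case 2
      have "u = el (-2) 2 (-3)" "v = el (-2) 2 (-2)"
        using u[unfolded 2] v[unfolded 2] by (simp_all add: fibre_junction)
      then show ?thesis using cube by (intro zero) (simp add: el_def, algebra)
    next
      case 3
      define t where "t = 4 * s - 1"
      have t: "0 < t" "t < 1" "s = (1 + t) / 4" using 3 by (auto simp: t_def)
      obtain u1 where u1: "(side 5 t, u1) \<in> Graph" "u = f P1 u1"
        by (rule pull1[OF u[unfolded t(3)], of "side 5 t"]) (use t(1,2) side_images(2)[of t] in \<open>auto simp: cut_sides'\<close>)
      obtain u2 where u2: "(side 1 t, u2) \<in> Graph" "u1 = f P2 u2"
        by (rule pull2[OF u1(1), of "side 1 t"]) (use t(1,2) side_images(10)[of t] in \<open>auto simp: cut_sides'\<close>)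
      obtain u3 where u3: "(side 2 t, u3) \<in> Graph" "u2 = f P1 u3"
        by (rule pull1[OF u2(1), of "side 2 t"]) (use t(1,2) side_images(8)[of t] in \<open>auto simp: cut_sides'\<close>)
      have e: "1 - s = 3 / 4 - t / 4" using t by (simp add: field_simps)
      obtain v' where v': "(arc_am t, v') \<in> Graph" "v = f P3 v'"
        by (rule pull3[OF v[unfolded e], of "arc_am t"]) (use t(1,2) g3_am[of t] in \<open>auto simp: cut_sides'\<close>)
      have "u - (\<alpha> * v + (2 * \<alpha> - \<alpha>\<^sup>2)) = \<alpha> ^ 4 * (u3 - (\<alpha> * v' + (\<alpha> - 1)))"
        unfolding u1(2) u2(2) u3(2) v'(2) f_simps using cube by algebra
      then show ?thesis using IY[OF u3(1) v'(1)] t by (elim shrink) (auto intro: norm_pow_le)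
    next
      case 4
      have "u = el (-1) 2 (-2)" "v = el (-1) 1 (-1)"
        using u[unfolded 4] v[unfolded 4] by (simp_all add: fibre_junction)
      then show ?thesis using cube by (intro zero) (simp add: el_def, algebra)
    next
      case 5
      define t where "t = 2 * s - 1"
      have t: "0 < t" "t < 1" "s = (1 + t) / 2" "1 - s = (1 - t) / 2" using 5 by (auto simp: t_def)
      obtain u1 where u1: "(side 6 t, u1) \<in> Graph" "u = f P1 u1"
        by (rule pull1[OF u[unfolded t(3)], of "side 6 t"]) (use t(1,2) side_images(3)[of t] in \<open>auto simp: cut_sides'\<close>)
      obtain u2 where u2: "(side 2 t, u2) \<in> Graph" "u1 = f P2 u2"
        by (rule pull2[OF u1(1), of "side 2 t"]) (use t(1,2) side_images(9)[of t] in \<open>auto simp: cut_sides'\<close>)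
      obtain v' where v': "(side 3 (1 - t), v') \<in> Graph" "v = f P1 v'"
        by (rule pull1[OF v[unfolded t(4)], of "side 3 (1 - t)"])
          (use t(1,2) side_images(7)[of "1 - t"] in \<open>auto simp: cut_sides' field_simps\<close>)
      have "u - (\<alpha> * v + (2 * \<alpha> - \<alpha>\<^sup>2)) = - (\<alpha> ^ 2) * (v' - (\<alpha> * u2 + (2 * \<alpha> - \<alpha>\<^sup>2)))"
        unfolding u1(2) u2(2) v'(2) f_simps using cube by algebra
      then show ?thesis using IX[OF v'(1), of u2] u2(1) t by (elim shrink) (auto intro: norm_pow_le)
    next
      case 6
      then have "(V 4, u) \<in> Graph" "(V 2, v) \<in> Graph" using u v by (simp_all add: side_1)
      then have "u = vertex_image 4" "v = vertex_image 2" by (auto intro: fibre_vertex)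
      then show ?thesis by (intro zero) (simp add: vertex_image_vals el_def)
    qed
  qed
  have Y: "norm (u - (\<alpha> * v + (\<alpha> - 1))) \<le> norm \<alpha> ^ Suc n * D"
    if t: "0 \<le> t" "t \<le> 1" and u: "(side 2 t, u) \<in> Graph" and v: "(arc_am t, v) \<in> Graph" for t u v
  proof -
    consider "t = 0" | "0 < t" "t < 1/2" | "t = 1/2" | "1/2 < t" "t < 3/4" | "t = 3/4" | "3/4 < t"
      using t by linarith
    then show ?thesis
    proof cases
      case 1
      then have "(V 2, u) \<in> Graph" "(V 2, v) \<in> Graph" using u v by (simp_all add: arc_am_def side_1 numeral_2_eq_2)
      then have "u = vertex_image 2" "v = vertex_image 2" by (auto intro: fibre_vertex)
      then show ?thesis by (intro zero) (simp add: vertex_image_vals el_def)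
    next
      case 2
      have arc_am: "arc_am t = side 1 (1 - 2 * t)" using 2 by (simp add: arc_am_def)
      obtain u' where u': "(side 3 (2 * t), u') \<in> Graph" "u = f P1 u'"
        by (rule pull1[OF u, of "side 3 (2 * t)"]) (use 2 side_images(7)[of "2 * t"] in \<open>auto simp: cut_sides'\<close>)
      obtain v' where v': "(side 2 (1 - 2 * t), v') \<in> Graph" "v = f P1 v'"
        by (rule pull1[OF v[unfolded arc_am], of "side 2 (1 - 2 * t)"])
          (use 2 side_images(8)[of "1 - 2 * t"] in \<open>auto simp: cut_sides'\<close>)
      have "u - (\<alpha> * v + (\<alpha> - 1)) = \<alpha> ^ 1 * (u' - (\<alpha> * v' + (2 * \<alpha> - \<alpha>\<^sup>2)))"
        unfolding u'(2) v'(2) f_simps using cube by algebra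
      then show ?thesis using IX[OF u'(1) v'(1)] 2 by (elim shrink) (auto intro: norm_pow_le)
    next
      case 3
      have "arc_am (1/2) = V 1" by (simp add: arc_am_def)
      then have "(V 1, v) \<in> Graph" using v unfolding 3 by simp
      then have "v = vertex_image 1" by (rule fibre_vertex) simp
      moreover have "u = el (-1) 1 (-1)" using u[unfolded 3] by (rule fibre_junction)
      ultimately show ?thesis by (intro zero) (simp add: vertex_image_vals el_def power2_eq_square)
    next
      case 4
      define s where "s = 3 - 4 * t"
      have s: "0 < s" "s < 1" "t = 3 / 4 - s / 4" using 4 by (auto simp: s_def field_simps)
      have "2 - 2 * t = (1 + s) / 2" by (simp add: s_def field_simps)
      then have arc_am: "arc_am t = side 0 ((1 + s) / 2)" using 4 by (simp only: arc_am_def) simp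
      obtain u' where u': "(arc_am s, u') \<in> Graph" "u = f P3 u'"
        by (rule pull3[OF u[unfolded s(3)], of "arc_am s"]) (use s(1,2) g3_am[of s] in \<open>auto simp: cut_sides'\<close>)
      obtain v1 where v1: "(side 1 s, v1) \<in> Graph" "v = f P1 v1"
        by (rule pull1[OF v[unfolded arc_am], of "side 1 s"]) (use s(1,2) side_images(12)[of s] in \<open>auto simp: cut_sides'\<close>)
      obtain v2 where v2: "(side 2 s, v2) \<in> Graph" "v1 = f P1 v2"
        by (rule pull1[OF v1(1), of "side 2 s"]) (use s(1,2) side_images(8)[of s] in \<open>auto simp: cut_sides'\<close>)
      have "u - (\<alpha> * v + (\<alpha> - 1)) = - (\<alpha> ^ 3) * (v2 - (\<alpha> * u' + (\<alpha> - 1)))"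
        unfolding u'(2) v1(2) v2(2) f_simps using cube by algebra
      then show ?thesis using IY[OF v2(1) u'(1)] s by (elim shrink) (auto intro: norm_pow_le)
    next
      case 5
      have "arc_am (3/4) = side 0 (1/2)" by (simp add: arc_am_def)
      then have "(side 0 (1/2), v) \<in> Graph" using v unfolding 5 by simp
      then have "u = el (-2) 2 (-2)" "v = el 0 0 (-1)"
        using u[unfolded 5] by (simp_all add: fibre_junction)
      then show ?thesis using cube by (intro zero) (simp add: el_def, algebra)
    next
      case 6
      have "2 - 2 * t = (4 - 4 * t) / 2" by (simp add: field_simps)
      then have arc_am: "arc_am t = side 0 ((4 - 4 * t) / 2)" using 6 by (simp only: arc_am_def) simp
      obtain u' where u': "(side 2 (4 * t - 3), u') \<in> Graph" "u = f P3 u'"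
        by (rule pull3[OF u, of "side 2 (4 * t - 3)"]) (use 6 t side_images(4)[of "4 * t - 3"] in \<open>auto simp: cut_sides'\<close>)
      obtain v' where v': "(side 3 (4 - 4 * t), v') \<in> Graph" "v = f P2 v'"
        by (rule pull2[OF v[unfolded arc_am], of "side 3 (4 - 4 * t)"])
          (use 6 t side_images(13)[of "4 - 4 * t"] in \<open>auto simp: cut_sides'\<close>)
      have "u - (\<alpha> * v + (\<alpha> - 1)) = - (\<alpha> ^ 3) * (v' - (\<alpha> * u' + (2 * \<alpha> - \<alpha>\<^sup>2)))"
        unfolding u'(2) v'(2) f_simps using cube by algebra
      then show ?thesis using IX[OF v'(1), of u'] u'(1) 6 t by (elim shrink) (auto intro: norm_pow_le)
    qed
  qed
  show ?case using X Y by blast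
qed

lemma foldX:
  assumes "(side 3 s, u) \<in> Graph" "(side 2 (1 - s), v) \<in> Graph" "0 \<le> s" "s \<le> 1"
  shows "u = \<alpha> * v + (2 * \<alpha> - \<alpha>\<^sup>2)"
proof -
  have "norm (u - (\<alpha> * v + (2 * \<alpha> - \<alpha>\<^sup>2))) \<le> 0"
    by (rule geometric_zero[OF _ norm_ge_zero norm_\<alpha>_le(2)]) (use fold_estimate assms in blast)
  then show ?thesis by simp
qed

lemma foldY:
  assumes "(side 2 t, u) \<in> Graph" "(arc_am t, v) \<in> Graph" "0 \<le> t" "t \<le> 1"
  shows "u = \<alpha> * v + (\<alpha> - 1)"
proof -
  have "norm (u - (\<alpha> * v + (\<alpha> - 1))) \<le> 0"
    by (rule geometric_zero[OF _ norm_ge_zero norm_\<alpha>_le(2)]) (use fold_estimate assms in blast)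
  then show ?thesis by simp
qed

text \<open>The first half of the chord is governed by \<open>foldX\<close>, the second half by \<open>foldY\<close>.\<close>
lemma chord1_fibres:
  assumes u: "(side 0 t, u) \<in> Graph" and v: "(arc_qpe t, v) \<in> Graph" and t: "0 \<le> t" "t \<le> 1"
  shows "f P1 u = f P2 v"
proof -
  consider "t = 0" | "0 < t" "t < 1/2" | "t = 1/2" | "1/2 < t" "t < 1" | "t = 1" using t by linarith
  then show ?thesis
  proof cases
    case 1
    then have "(V 0, u) \<in> Graph" "(V 0, v) \<in> Graph" using u v V_per(2)[of 0] by (simp_all add: arc_qpe_def side_1)
    then have "u = vertex_image 0" "v = vertex_image 0" by (auto intro: fibre_vertex)
    then show ?thesis by (simp add: f_vertex_image)
  next
    case 2
    have arc_qpe: "arc_qpe t = side 6 (1 - 2 * t)" using 2 by (simp add: arc_qpe_def)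
    obtain u' where u': "(side 3 (2 * t), u') \<in> Graph" "u = f P2 u'"
      by (rule pull2[OF u, of "side 3 (2 * t)"]) (use 2 side_images(13)[of "2 * t"] in \<open>auto simp: cut_sides'\<close>)
    obtain v' where v': "(side 2 (1 - 2 * t), v') \<in> Graph" "v = f P2 v'"
      by (rule pull2[OF v[unfolded arc_qpe], of "side 2 (1 - 2 * t)"])
        (use 2 side_images(9)[of "1 - 2 * t"] in \<open>auto simp: cut_sides'\<close>)
    have "u' = \<alpha> * v' + (2 * \<alpha> - \<alpha>\<^sup>2)" by (rule foldX[OF u'(1) v'(1)]) (use 2 in auto)
    then show ?thesis unfolding u'(2) v'(2) f_simps using cube by algebra
  next
    case 3
    have "arc_qpe (1/2) = V 6" by (simp add: arc_qpe_def)
    then have "(V 6, v) \<in> Graph" using v unfolding 3 by simp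
    then have "v = vertex_image 6" "u = el 0 0 (-1)"
      using u[unfolded 3] by (auto intro: fibre_vertex simp: fibre_junction)
    then show ?thesis by (simp add: vertex_image_vals f_el el_mult el_add)
  next
    case 4
    define s where "s = 2 * t - 1"
    have s: "0 < s" "s < 1" "t = (1 + s) / 2" using 4 by (auto simp: s_def)
    obtain u1 where u1: "(side 1 s, u1) \<in> Graph" "u = f P1 u1"
      by (rule pull1[OF u[unfolded s(3)], of "side 1 s"]) (use s(1,2) side_images(12)[of s] in \<open>auto simp: cut_sides'\<close>)
    obtain u2 where u2: "(side 2 s, u2) \<in> Graph" "u1 = f P1 u2"
      by (rule pull1[OF u1(1), of "side 2 s"]) (use s(1,2) side_images(8)[of s] in \<open>auto simp: cut_sides'\<close>)
    have "cut1 (arc_qpe t) < 0" using 4 by (auto simp: arc_qpe_def cut_sides)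
    then have "cut1 (arc_qpe ((1 + s) / 2)) < 0" unfolding s(3) .
    then obtain v' where v': "(arc_am s, v') \<in> Graph" "v = f P2 v'"
      by (rule pull2[OF v[unfolded s(3)], of "arc_am s", rotated 2]) (use s(1,2) g2_am[of s] in \<open>auto intro!: arc_am_Q\<close>)
    have "u2 = \<alpha> * v' + (\<alpha> - 1)" by (rule foldY[OF u2(1) v'(1)]) (use s(1,2) in auto)
    then show ?thesis unfolding u1(2) u2(2) v'(2) f_simps using cube by algebra
  next
    case 5
    then have "(V 1, u) \<in> Graph" "(V 4, v) \<in> Graph" using u v side_1[of 0] by (simp_all add: arc_qpe_def)
    then have "u = vertex_image 1" "v = vertex_image 4" by (auto intro: fibre_vertex)
    then show ?thesis by (simp add: vertex_image_vals f_el el_mult el_add)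
  qed
qed

text \<open>As \<open>e = g\<^sub>2 a\<close>, this is \<open>chord1_fibres\<close> after one more map, by \<open>f\<^sub>1 (f\<^sub>2 u) = \<alpha> + \<alpha>\<^sup>3 u\<close>.\<close>
lemma chord2_fibres:
  assumes u: "(side 4 t, u) \<in> Graph" and v: "(arc_qpe t, v) \<in> Graph" and t: "0 \<le> t" "t \<le> 1"
  shows "f P1 u = f P3 v"
proof (cases "t = 0")
  case True
  then have "(V 4, u) \<in> Graph" "(V 0, v) \<in> Graph" using u v V_per(2)[of 0] by (simp_all add: arc_qpe_def side_1)
  then have "u = vertex_image 4" "v = vertex_image 0" by (auto intro: fibre_vertex)
  then show ?thesis by (simp add: vertex_image_vals f_el el_mult el_add)
next
  case False
  obtain u' where u': "(side 0 t, u') \<in> Graph" "u = f P2 u'"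
    by (rule pull2[OF u, of "side 0 t"]) (use False t side_images(11)[of t] in \<open>auto simp: cut_sides'\<close>)
  have "f P1 u' = f P2 v" by (rule chord1_fibres[OF u'(1) v t])
  then show ?thesis unfolding u'(2) f_simps by algebra
qed

lemma common_point:
  assumes "y \<in> Q" "z \<in> Q"
  shows "g P1 y = g P2 z \<Longrightarrow> \<exists>t. 0 \<le> t \<and> t \<le> 1 \<and> y = side 0 t \<and> z = arc_qpe t"
    and "g P1 y = g P3 z \<Longrightarrow> \<exists>t. 0 \<le> t \<and> t \<le> 1 \<and> y = side 4 t \<and> z = arc_qpe t"
    and "g P2 y \<noteq> g P3 z"
proof -
  show "\<exists>t. 0 \<le> t \<and> t \<le> 1 \<and> y = side 0 t \<and> z = arc_qpe t" if e: "g P1 y = g P2 z"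
  proof -
    have "cut1 (g P1 y) = 0" using cut_signs(1)[OF assms(1)] cut_signs(2)[OF assms(2)] e by simp
    then obtain t where t: "0 \<le> t" "t \<le> 1" "y = side 0 t" using cut1_zero[OF assms(1)] by blast
    then have "g P2 z = g P2 (arc_qpe t)" using chord1[of t] e by simp
    then show ?thesis using t g_inj by blast
  qed
  show "\<exists>t. 0 \<le> t \<and> t \<le> 1 \<and> y = side 4 t \<and> z = arc_qpe t" if e: "g P1 y = g P3 z"
  proof -
    have "cut2 (g P1 y) = 0" using cut_signs(4)[OF assms(1)] cut_signs(6)[OF assms(2)] e by simp
    then obtain t where t: "0 \<le> t" "t \<le> 1" "y = side 4 t" using cut2_zero[OF assms(1)] by blast
    then have "g P3 z = g P3 (arc_qpe t)" using chord2[of t] e by simp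
    then show ?thesis using t g_inj by blast
  qed
  show "g P2 y \<noteq> g P3 z" using cut_signs(2)[OF assms(1)] cut_signs(3)[OF assms(2)] by auto
qed

lemma common_fibres:
  assumes y: "(y, u) \<in> Graph" and z: "(z, v) \<in> Graph" and e: "g i y = g j z" and ij: "i \<noteq> j"
  shows "f i u = f j v"
proof -
  note cp = common_point[OF Graph_Q[OF y] Graph_Q[OF z]] and cp' = common_point[OF Graph_Q[OF z] Graph_Q[OF y]]
  have 12: "f i u = f j v" if "i = P1" "j = P2" using cp(1) e that chord1_fibres y z by blast
  have 21: "f i u = f j v" if "i = P2" "j = P1" using cp'(1) e[symmetric] that chord1_fibres y z by metis
  have 13: "f i u = f j v" if "i = P1" "j = P3" using cp(2) e that chord2_fibres y z by blast
  have 31: "f i u = f j v" if "i = P3" "j = P1" using cp'(2) e[symmetric] that chord2_fibres y z by metis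
  show ?thesis using 12 21 13 31 cp(3) cp'(3) e ij by (cases i; cases j) auto
qed

text \<open>As long as the two descriptions of \<open>x\<close> choose the same cell, the distance of the values shrinks; once
they choose different cells, \<open>x\<close> is on a chord and the values agree.\<close>
lemma fibre_unique: assumes "(x, u) \<in> Graph" "(x, v) \<in> Graph" shows "u = v"
proof -
  have "norm (u - v) \<le> norm \<alpha> ^ n * 4" if "(x, u) \<in> Graph" "(x, v) \<in> Graph" for n x u v
    using that
  proof (induction n arbitrary: x u v)
    case 0
    then have "norm u \<le> 2" "norm v \<le> 2" using Graph_B norm_B by blast+
    then show ?case using norm_triangle_ineq4[of u v] by simp
  next
    case (Suc n)
    obtain i y u' where s: "(y, u') \<in> Graph" "x = g i y" "u = f i u'" using Graph_step[OF Suc.prems(1)] .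
    obtain j z v' where s': "(z, v') \<in> Graph" "x = g j z" "v = f j v'" using Graph_step[OF Suc.prems(2)] .
    show ?case
    proof (cases "i = j")
      case True
      then have yz: "z = y" using s s' g_inj by metis
      have "norm (u - v) \<le> norm \<alpha> * norm (u' - v')" using f_contract s s' True by simp
      also have "\<dots> \<le> norm \<alpha> * (norm \<alpha> ^ n * 4)"
        using Suc.IH[OF s(1) s'(1)[unfolded yz]] by (intro mult_left_mono) auto
      finally show ?thesis by (simp add: mult.assoc)
    next
      case False
      have "g i y = g j z" using s s' by simp
      from common_fibres[OF s(1) s'(1) this False] show ?thesis using s s' by simp
    qed
  qed
  from geometric_zero[OF this[OF assms] norm_ge_zero norm_\<alpha>_le(2)] show ?thesis by simp
qed

end

section \<open>Neighbours of the attractor in the plane\<close>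

fun exponent :: "piece \<Rightarrow> nat" where "exponent P1 = 1" | "exponent P2 = 2" | "exponent P3 = 4"

context cubic_root begin

text \<open>The attractor in the plane and its copy under \<open>v \<mapsto> \<alpha>\<^sup>k v + d\<close> have a common point, which the two
sets describe by the points \<open>x\<close> and \<open>y\<close> of \<open>Q\<close>.\<close>
definition touch :: "nat \<Rightarrow> complex \<Rightarrow> complex \<Rightarrow> complex \<Rightarrow> bool" where
  "touch k d x y \<longleftrightarrow> (\<exists>u v. (x, u) \<in> Graph \<and> (y, v) \<in> Graph \<and> u = \<alpha> ^ k * v + d)"

lemma touchI: "(x, u) \<in> Graph \<Longrightarrow> (y, v) \<in> Graph \<Longrightarrow> u = \<alpha> ^ k * v + d \<Longrightarrow> touch k d x y"
  unfolding touch_def by blast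

lemma f_diff_exponent: "f i z - f i w = \<alpha> ^ exponent i * (z - w)"
  by (cases i) (simp_all add: f_diff)

text \<open>Subdividing the first partner by \<open>f i\<close> and cancelling the smaller of the two powers of \<open>\<alpha>\<close> gives
another relation of the same kind; in \<open>cancel_lt\<close> the partners change places.\<close>
lemma cancel_ge:
  assumes "f i w = \<alpha> ^ k * v + d" "d = f i d'" "k = exponent i + j" shows "w = \<alpha> ^ j * v + d'"
proof -
  have "f i w - f i d' = \<alpha> ^ k * v" unfolding assms(1,2) by simp
  then have "\<alpha> ^ exponent i * (w - d') = \<alpha> ^ exponent i * (\<alpha> ^ j * v)"
    unfolding f_diff_exponent assms(3) power_add mult.assoc .
  then have "w - d' = \<alpha> ^ j * v" using \<alpha>_nz by (metis mult_left_cancel power_not_zero)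
  then show ?thesis by (simp add: algebra_simps)
qed

lemma cancel_lt:
  assumes "f i w = \<alpha> ^ k * v + d" "f i 0 = \<alpha> ^ k * d' + d" "exponent i = k + j" shows "v = \<alpha> ^ j * w + d'"
proof -
  have "\<alpha> ^ k * v = \<alpha> ^ k * (\<alpha> ^ j * w + d')"
    using assms f_diff_exponent[of i w 0] by (simp add: power_add algebra_simps)
  then show ?thesis using \<alpha>_nz by simp
qed

lemma divide_first:
  assumes "touch k d x y"
  obtains
    (P1) z where "x = g P1 z" "\<And>j d'. k = exponent P1 + j \<Longrightarrow> d = f P1 d' \<Longrightarrow> touch j d' z y"
      "\<And>j d'. exponent P1 = k + j \<Longrightarrow> f P1 0 = \<alpha> ^ k * d' + d \<Longrightarrow> touch j d' y z"
  | (P2) z where "x = g P2 z" "\<And>j d'. k = exponent P2 + j \<Longrightarrow> d = f P2 d' \<Longrightarrow> touch j d' z y"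
      "\<And>j d'. exponent P2 = k + j \<Longrightarrow> f P2 0 = \<alpha> ^ k * d' + d \<Longrightarrow> touch j d' y z"
  | (P3) z where "x = g P3 z" "\<And>j d'. k = exponent P3 + j \<Longrightarrow> d = f P3 d' \<Longrightarrow> touch j d' z y"
      "\<And>j d'. exponent P3 = k + j \<Longrightarrow> f P3 0 = \<alpha> ^ k * d' + d \<Longrightarrow> touch j d' y z"
proof -
  obtain u v where a: "(x, u) \<in> Graph" "(y, v) \<in> Graph" "u = \<alpha> ^ k * v + d" using assms unfolding touch_def by blast
  obtain i z w where s: "(z, w) \<in> Graph" "x = g i z" "u = f i w" using Graph_step[OF a(1)] .
  note h = a(3)[unfolded s(3)]
  have ge: "touch j d' z y" if "k = exponent i + j" "d = f i d'" for j d'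
    by (rule touchI[OF s(1) a(2) cancel_ge[OF h that(2,1)]])
  have lt: "touch j d' y z" if "exponent i = k + j" "f i 0 = \<alpha> ^ k * d' + d" for j d'
    by (rule touchI[OF a(2) s(1) cancel_lt[OF h that(2,1)]])
  show thesis by (cases i) (use that s(2) ge lt in blast)+
qed

lemma divide_second:
  assumes "touch 0 d x y"
  obtains (P1) z where "y = g P1 z" "\<And>k d'. k = exponent P1 \<Longrightarrow> d' = f P1 0 + d \<Longrightarrow> touch k d' x z"
  | (P2) z where "y = g P2 z" "\<And>k d'. k = exponent P2 \<Longrightarrow> d' = f P2 0 + d \<Longrightarrow> touch k d' x z"
  | (P3) z where "y = g P3 z" "\<And>k d'. k = exponent P3 \<Longrightarrow> d' = f P3 0 + d \<Longrightarrow> touch k d' x z"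
proof -
  obtain u v where a: "(x, u) \<in> Graph" "(y, v) \<in> Graph" "u = \<alpha> ^ 0 * v + d" using assms unfolding touch_def by blast
  obtain i z w where s: "(z, w) \<in> Graph" "y = g i z" "v = f i w" using Graph_step[OF a(2)] .
  have "touch k d' x z" if "k = exponent i" "d' = f i 0 + d" for k d'
  proof (rule touchI[OF a(1) s(1)])
    show "u = \<alpha> ^ k * w + d'" using a(3) that f_diff_exponent[of i w 0] s(3) by (simp add: algebra_simps)
  qed
  then show thesis by (cases i) (use that s(2) in blast)+
qed

lemma f_el_0: "f P1 0 = el 0 0 0" "f P2 0 = el 1 0 0" "f P3 0 = el 0 1 1"
  by (simp_all add: f_simps el_def)

lemma el_mult_pow: "\<alpha> ^ 0 * el p q r = el p q r" "\<alpha> ^ 1 * el p q r = el r (p - r) (q + 2 * r)"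
  "\<alpha> ^ 2 * el p q r = \<alpha> * (\<alpha> * el p q r)" "\<alpha> ^ 3 * el p q r = \<alpha> * (\<alpha> * (\<alpha> * el p q r))"
  by (simp_all add: el_mult el_mult2)

lemmas el_rules = f_el f_el_0 el_mult_pow el_mult el_add

lemma fourth: "\<alpha> ^ 4 = 3 * \<alpha>\<^sup>2 - \<alpha> + 2"
  using cube by algebra

text \<open>Both partners lie in the disc \<open>B\<close> with centre \<open>1/4\<close> and radius \<open>79/50\<close>, which bounds the difference of
the centres of \<open>B\<close> and its copy. The instances for each exponent \<open>k\<close> have the coordinates of that
difference worked out.\<close>
lemma far_apart:
  assumes n: "touch k d x y" and a: "norm (\<alpha> ^ k) \<le> c"
    and e: "d - (1 - \<alpha> ^ k) / 4 = el p q s" and far: "(79 / 50 * (1 + c)) * (79 / 50 * (1 + c)) < sq_norm p q s"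
  shows False
proof -
  obtain u v where "(x, u) \<in> Graph" "(y, v) \<in> Graph" and r: "u = \<alpha> ^ k * v + d" using n unfolding touch_def by blast
  then have "u \<in> B" "v \<in> B" using Graph_B by auto
  then have B': "norm (u - 1/4) \<le> 79/50" "norm (v - 1/4) \<le> 79/50"
    by (simp_all add: B_def dist_norm norm_minus_commute)
  have "el p q s = (u - 1/4) - \<alpha> ^ k * (v - 1/4)" unfolding e[symmetric] r by (simp add: algebra_simps diff_divide_distrib)
  then have "norm (el p q s) \<le> norm (u - 1/4) + norm (\<alpha> ^ k) * norm (v - 1/4)"
    using norm_triangle_ineq4[of "u - 1/4" "\<alpha> ^ k * (v - 1/4)"] by (simp add: norm_mult)
  also have "\<dots> \<le> 79/50 + c * (79/50)" using B' a by (intro add_mono mult_mono) (auto intro: order_trans[OF norm_ge_zero])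
  finally have "norm (el p q s) \<le> 79 / 50 * (1 + c)" by (simp add: algebra_simps)
  then have "(norm (el p q s))\<^sup>2 \<le> (79 / 50 * (1 + c))\<^sup>2" by (intro power_mono) auto
  then show False using far unfolding norm_el_sq_norm power2_eq_square[of "79 / 50 * (1 + c)"] by linarith
qed

lemma far_apart0:
  assumes "touch 0 (el p q s) x y" "(79 / 50 * (1 + 1)) * (79 / 50 * (1 + 1)) < sq_norm p q s"
  shows thesis
proof -
  have False
  proof (rule far_apart[OF assms(1) _ _ assms(2)])
    show "norm (\<alpha> ^ 0) \<le> 1" using norm_\<alpha> norm_powers N_range by (simp add: norm_power)
    show "el p q s - (1 - \<alpha> ^ 0) / 4 = el p q s"
      by (simp add: el_def cube fourth algebra_simps add_divide_distrib diff_divide_distrib)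
  qed
  then show thesis ..
qed

lemma far_apart1:
  assumes "touch 1 (el p q s) x y" "(79 / 50 * (1 + 755/1000)) * (79 / 50 * (1 + 755/1000)) < sq_norm (p - 1/4) (q + 1/4) s"
  shows thesis
proof -
  have False
  proof (rule far_apart[OF assms(1) _ _ assms(2)])
    show "norm (\<alpha> ^ 1) \<le> 755/1000" using norm_\<alpha> norm_powers N_range by (simp add: norm_power)
    show "el p q s - (1 - \<alpha> ^ 1) / 4 = el (p - 1/4) (q + 1/4) s"
      by (simp add: el_def cube fourth algebra_simps add_divide_distrib diff_divide_distrib)
  qed
  then show thesis ..
qed

lemma far_apart2:
  assumes "touch 2 (el p q s) x y" "(79 / 50 * (1 + 5699/10000)) * (79 / 50 * (1 + 5699/10000)) < sq_norm (p - 1/4) q (s + 1/4)"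
  shows thesis
proof -
  have False
  proof (rule far_apart[OF assms(1) _ _ assms(2)])
    show "norm (\<alpha> ^ 2) \<le> 5699/10000" using norm_\<alpha> norm_powers N_range by (simp add: norm_power)
    show "el p q s - (1 - \<alpha> ^ 2) / 4 = el (p - 1/4) q (s + 1/4)"
      by (simp add: el_def cube fourth algebra_simps add_divide_distrib diff_divide_distrib)
  qed
  then show thesis ..
qed

lemma far_apart3:
  assumes "touch 3 (el p q s) x y" "(79 / 50 * (1 + 4303/10000)) * (79 / 50 * (1 + 4303/10000)) < sq_norm p (q - 1/4) (s + 1/2)"
  shows thesis
proof -
  have False
  proof (rule far_apart[OF assms(1) _ _ assms(2)])
    show "norm (\<alpha> ^ 3) \<le> 4303/10000" using norm_\<alpha> norm_powers N_range by (simp add: norm_power)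
    show "el p q s - (1 - \<alpha> ^ 3) / 4 = el p (q - 1/4) (s + 1/2)"
      by (simp add: el_def cube fourth algebra_simps add_divide_distrib diff_divide_distrib)
  qed
  then show thesis ..
qed

lemma far_apart4:
  assumes "touch 4 (el p q s) x y" "(79 / 50 * (1 + 32479/100000)) * (79 / 50 * (1 + 32479/100000)) < sq_norm (p + 1/4) (q - 1/4) (s + 3/4)"
  shows thesis
proof -
  have False
  proof (rule far_apart[OF assms(1) _ _ assms(2)])
    show "norm (\<alpha> ^ 4) \<le> 32479/100000" using norm_\<alpha> norm_powers N_range by (simp add: norm_power)
    show "el p q s - (1 - \<alpha> ^ 4) / 4 = el (p + 1/4) (q - 1/4) (s + 3/4)"
      by (simp add: el_def cube fourth algebra_simps add_divide_distrib diff_divide_distrib)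
  qed
  then show thesis ..
qed

declare el_rules [simp] sq_norm_def [simp]

text \<open>Some differences are not excluded by their size, but by the size of all differences obtained after
finitely many subdivisions. The following list is ordered such that each branch ends either in a
difference that is too large or in one that comes earlier in the list.\<close>
lemma no_neighbour_1:
  assumes "touch 1 (el 1 (-4) 2) x y" shows thesis
  using assms
proof (cases rule: divide_first)
  case (P1 z)
  have "touch 0 (el (-3) 0 1) z y" by (rule P1(2)) simp_all
  then show ?thesis by (rule far_apart0) (simp, insert N_range, linarith)
next
  case (P2 z)
  have "touch 1 (el 4 (-2) 0) y z" by (rule P2(3)) simp_all
  then show ?thesis by (rule far_apart1) (simp, insert N_range, linarith)
next
  case (P3 z)
  have "touch 3 (el 4 1 (-1)) y z" by (rule P3(3)) simp_all
  then show ?thesis by (rule far_apart3) (simp, insert N_range, linarith)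
qed

lemma no_neighbour_2:
  assumes "touch 0 (el 1 3 (-2)) x y" shows thesis
  using assms
proof (cases rule: divide_first)
  case (P1 z)
  have "touch 1 (el (-1) (-3) 2) y z" by (rule P1(3)) simp_all
  then show ?thesis by (rule far_apart1) (simp, insert N_range, linarith)
next
  case (P2 z)
  have "touch 2 (el 0 (-3) 2) y z" by (rule P2(3)) simp_all
  then show ?thesis by (rule far_apart2) (simp, insert N_range, linarith)
next
  case (P3 z)
  have "touch 4 (el (-1) (-2) 3) y z" by (rule P3(3)) simp_all
  then show ?thesis by (rule far_apart4) (simp, insert N_range, linarith)
qed

lemma no_neighbour_3:
  assumes "touch 3 (el 0 (-2) 2) x y" shows thesis
  using assms
proof (cases rule: divide_first)
  case (P1 z)
  have "touch 2 (el (-2) 2 0) z y" by (rule P1(2)) simp_all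
  then show ?thesis by (rule far_apart2) (simp, insert N_range, linarith)
next
  case (P2 z)
  have "touch 1 (el 1 5 (-3)) z y" by (rule P2(2)) simp_all
  then show ?thesis by (rule far_apart1) (simp, insert N_range, linarith)
next
  case (P3 z)
  have "touch 1 (el (-4) (-1) 2) y z" by (rule P3(3)) simp_all
  then show ?thesis by (rule far_apart1) (simp, insert N_range, linarith)
qed

lemma no_neighbour_4:
  assumes "touch 1 (el (-2) 3 (-1)) x y" shows thesis
  using assms
proof (cases rule: divide_first)
  case (P1 z)
  have "touch 0 (el 1 3 (-2)) z y" by (rule P1(2)) simp_all
  then show ?thesis by (rule no_neighbour_2)
next
  case (P2 z)
  have "touch 1 (el 0 (-5) 3) y z" by (rule P2(3)) simp_all
  then show ?thesis by (rule far_apart1) (simp, insert N_range, linarith)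
next
  case (P3 z)
  have "touch 3 (el 0 (-2) 2) y z" by (rule P3(3)) simp_all
  then show ?thesis by (rule no_neighbour_3)
qed

lemma no_neighbour_5:
  assumes "touch 1 (el 2 1 (-1)) x y" shows thesis
  using assms
proof (cases rule: divide_first)
  case (P1 z)
  have "touch 0 (el 3 (-5) 2) z y" by (rule P1(2)) simp_all
  then show ?thesis by (rule far_apart0) (simp, insert N_range, linarith)
next
  case (P2 z)
  have "touch 1 (el (-2) 3 (-1)) y z" by (rule P2(3)) simp_all
  then show ?thesis by (rule no_neighbour_4)
next
  case (P3 z)
  have "touch 3 (el (-2) 6 (-2)) y z" by (rule P3(3)) simp_all
  then show ?thesis by (rule far_apart3) (simp, insert N_range, linarith)
qed

lemma no_neighbour_6:
  assumes "touch 0 (el (-1) 4 (-2)) x y" shows thesis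
  using assms
proof (cases rule: divide_first)
  case (P1 z)
  have "touch 1 (el 1 (-4) 2) y z" by (rule P1(3)) simp_all
  then show ?thesis by (rule no_neighbour_1)
next
  case (P2 z)
  have "touch 2 (el 2 (-4) 2) y z" by (rule P2(3)) simp_all
  then show ?thesis by (rule far_apart2) (simp, insert N_range, linarith)
next
  case (P3 z)
  have "touch 4 (el 1 (-3) 3) y z" by (rule P3(3)) simp_all
  then show ?thesis by (rule far_apart4) (simp, insert N_range, linarith)
qed

lemma no_neighbour_7:
  assumes "touch 3 (el 2 (-3) 2) x y" shows thesis
  using assms
proof (cases rule: divide_first)
  case (P1 z)
  have "touch 2 (el (-1) (-2) 2) z y" by (rule P1(2)) simp_all
  then show ?thesis by (rule far_apart2) (simp, insert N_range, linarith)
next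
  case (P2 z)
  have "touch 1 (el (-2) 5 (-2)) z y" by (rule P2(2)) simp_all
  then show ?thesis by (rule far_apart1) (simp, insert N_range, linarith)
next
  case (P3 z)
  have "touch 1 (el (-1) (-8) 5) y z" by (rule P3(3)) simp_all
  then show ?thesis by (rule far_apart1) (simp, insert N_range, linarith)
qed

lemma no_neighbour_8:
  assumes "touch 1 (el (-2) 1 0) x y" shows thesis
  using assms
proof (cases rule: divide_first)
  case (P1 z)
  have "touch 0 (el (-1) 4 (-2)) z y" by (rule P1(2)) simp_all
  then show ?thesis by (rule no_neighbour_6)
next
  case (P2 z)
  have "touch 1 (el 2 (-6) 3) y z" by (rule P2(3)) simp_all
  then show ?thesis by (rule far_apart1) (simp, insert N_range, linarith)
next
  case (P3 z)
  have "touch 3 (el 2 (-3) 2) y z" by (rule P3(3)) simp_all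
  then show ?thesis by (rule no_neighbour_7)
qed

lemma no_neighbour_9:
  assumes "touch 1 (el 3 (-3) 1) x y" shows thesis
  using assms
proof (cases rule: divide_first)
  case (P1 z)
  have "touch 0 (el 0 (-5) 3) z y" by (rule P1(2)) simp_all
  then show ?thesis by (rule far_apart0) (simp, insert N_range, linarith)
next
  case (P2 z)
  have "touch 1 (el 1 3 (-2)) y z" by (rule P2(3)) simp_all
  then show ?thesis by (rule far_apart1) (simp, insert N_range, linarith)
next
  case (P3 z)
  have "touch 3 (el 1 6 (-3)) y z" by (rule P3(3)) simp_all
  then show ?thesis by (rule far_apart3) (simp, insert N_range, linarith)
qed

lemma no_neighbour_10:
  assumes "touch 0 (el 1 (-4) 2) x y" shows thesis
  using assms
proof (cases rule: divide_first)
  case (P1 z)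
  have "touch 1 (el (-1) 4 (-2)) y z" by (rule P1(3)) simp_all
  then show ?thesis by (rule far_apart1) (simp, insert N_range, linarith)
next
  case (P2 z)
  have "touch 2 (el 0 4 (-2)) y z" by (rule P2(3)) simp_all
  then show ?thesis by (rule far_apart2) (simp, insert N_range, linarith)
next
  case (P3 z)
  have "touch 4 (el (-1) 5 (-1)) y z" by (rule P3(3)) simp_all
  then show ?thesis by (rule far_apart4) (simp, insert N_range, linarith)
qed

lemma no_neighbour_11:
  assumes "touch 2 (el 1 2 (-1)) x y" shows thesis
  using assms
proof (cases rule: divide_first)
  case (P1 z)
  have "touch 1 (el 3 (-3) 1) z y" by (rule P1(2)) simp_all
  then show ?thesis by (rule no_neighbour_9)
next
  case (P2 z)
  have "touch 0 (el 1 (-4) 2) z y" by (rule P2(2)) simp_all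
  then show ?thesis by (rule no_neighbour_10)
next
  case (P3 z)
  have "touch 2 (el 2 3 (-2)) y z" by (rule P3(3)) simp_all
  then show ?thesis by (rule far_apart2) (simp, insert N_range, linarith)
qed

lemma no_neighbour_12:
  assumes "touch 0 (el (-1) (-3) 2) x y" shows thesis
  using assms
proof (cases rule: divide_first)
  case (P1 z)
  have "touch 1 (el 1 3 (-2)) y z" by (rule P1(3)) simp_all
  then show ?thesis by (rule far_apart1) (simp, insert N_range, linarith)
next
  case (P2 z)
  have "touch 2 (el 2 3 (-2)) y z" by (rule P2(3)) simp_all
  then show ?thesis by (rule far_apart2) (simp, insert N_range, linarith)
next
  case (P3 z)
  have "touch 4 (el 1 4 (-1)) y z" by (rule P3(3)) simp_all
  then show ?thesis by (rule far_apart4) (simp, insert N_range, linarith)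
qed

lemma no_neighbour_13:
  assumes "touch 2 (el 2 1 (-1)) x y" shows thesis
  using assms
proof (cases rule: divide_first)
  case (P1 z)
  have "touch 1 (el 3 (-5) 2) z y" by (rule P1(2)) simp_all
  then show ?thesis by (rule far_apart1) (simp, insert N_range, linarith)
next
  case (P2 z)
  have "touch 0 (el (-1) (-3) 2) z y" by (rule P2(2)) simp_all
  then show ?thesis by (rule no_neighbour_12)
next
  case (P3 z)
  have "touch 2 (el 4 2 (-2)) y z" by (rule P3(3)) simp_all
  then show ?thesis by (rule far_apart2) (simp, insert N_range, linarith)
qed

lemma no_neighbour_14:
  assumes "touch 4 (el 1 2 0) x y" shows thesis
  using assms
proof (cases rule: divide_first)
  case (P1 z)
  have "touch 3 (el 3 (-2) 1) z y" by (rule P1(2)) simp_all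
  then show ?thesis by (rule far_apart3) (simp, insert N_range, linarith)
next
  case (P2 z)
  have "touch 2 (el 2 (-4) 2) z y" by (rule P2(2)) simp_all
  then show ?thesis by (rule far_apart2) (simp, insert N_range, linarith)
next
  case (P3 z)
  have "touch 0 (el 0 7 (-4)) z y" by (rule P3(2)) simp_all
  then show ?thesis by (rule far_apart0) (simp, insert N_range, linarith)
qed

lemma no_neighbour_15:
  assumes "touch 0 (el (-3) 2 0) x y" shows thesis
  using assms
proof (cases rule: divide_first)
  case (P1 z)
  have "touch 1 (el 3 (-2) 0) y z" by (rule P1(3)) simp_all
  then show ?thesis by (rule far_apart1) (simp, insert N_range, linarith)
next
  case (P2 z)
  have "touch 2 (el 4 (-2) 0) y z" by (rule P2(3)) simp_all
  then show ?thesis by (rule far_apart2) (simp, insert N_range, linarith)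
next
  case (P3 z)
  have "touch 4 (el 3 (-1) 1) y z" by (rule P3(3)) simp_all
  then show ?thesis by (rule far_apart4) (simp, insert N_range, linarith)
qed

lemma no_neighbour_16:
  assumes "touch 1 (el 0 (-3) 2) x y" shows thesis
  using assms
proof (cases rule: divide_first)
  case (P1 z)
  have "touch 0 (el (-3) 2 0) z y" by (rule P1(2)) simp_all
  then show ?thesis by (rule no_neighbour_15)
next
  case (P2 z)
  have "touch 1 (el 4 (-4) 1) y z" by (rule P2(3)) simp_all
  then show ?thesis by (rule far_apart1) (simp, insert N_range, linarith)
next
  case (P3 z)
  have "touch 3 (el 4 (-1) 0) y z" by (rule P3(3)) simp_all
  then show ?thesis by (rule far_apart3) (simp, insert N_range, linarith)
qed

text \<open>The graph of the relations that do occur; the suffix names the vertex of the graph. The vertices \<open>X\<close>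
and \<open>Y\<close> are the two folding relations, \<open>a\<close> and \<open>e\<close> the contacts along the two chords, and \<open>P\<close> is realised
by a single point. As the first partner is at least as large as the second, it
is the one to be subdivided, except in \<open>h\<close> and \<open>c2\<close>, where the sizes are equal and the second is subdivided.\<close>
lemma neighbour_X:
  assumes "touch 1 (el 0 2 (-1)) x y"
  shows "(\<exists>z. x = g P1 z \<and> touch 0 (el 2 (-1) 0) z y) \<or>
    (\<exists>z. x = g P2 z \<and> touch 1 (el (-1) (-1) 1) y z) \<or>
    (\<exists>z. x = g P3 z \<and> touch 3 (el (-1) 2 0) y z)"
  using assms
proof (cases rule: divide_first)
  case (P1 z)
  have "touch 0 (el 2 (-1) 0) z y" by (rule P1(2)) simp_all
  then show ?thesis using P1(1) by blast
next
  case (P2 z)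
  have "touch 1 (el (-1) (-1) 1) y z" by (rule P2(3)) simp_all
  then show ?thesis using P2(1) by blast
next
  case (P3 z)
  have "touch 3 (el (-1) 2 0) y z" by (rule P3(3)) simp_all
  then show ?thesis using P3(1) by blast
qed

lemma neighbour_Y:
  assumes "touch 1 (el (-1) 1 0) x y"
  shows "(\<exists>z. x = g P1 z \<and> touch 0 (el 0 2 (-1)) z y) \<or>
    (\<exists>z. x = g P3 z \<and> touch 3 (el 1 (-1) 1) y z)"
  using assms
proof (cases rule: divide_first)
  case (P1 z)
  have "touch 0 (el 0 2 (-1)) z y" by (rule P1(2)) simp_all
  then show ?thesis using P1(1) by blast
next
  case (P2 z)
  have "touch 1 (el 1 (-4) 2) y z" by (rule P2(3)) simp_all
  then show ?thesis by (rule no_neighbour_1)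
next
  case (P3 z)
  have "touch 3 (el 1 (-1) 1) y z" by (rule P3(3)) simp_all
  then show ?thesis using P3(1) by blast
qed

lemma neighbour_P:
  assumes "touch 2 (el (-1) 3 (-1)) x y"
  shows "(\<exists>z. x = g P3 z \<and> touch 2 (el (-1) 3 (-1)) y z)"
  using assms
proof (cases rule: divide_first)
  case (P1 z)
  have "touch 1 (el 2 1 (-1)) z y" by (rule P1(2)) simp_all
  then show ?thesis by (rule no_neighbour_5)
next
  case (P2 z)
  have "touch 0 (el 4 (-4) 1) z y" by (rule P2(2)) simp_all
  then show ?thesis by (rule far_apart0) (simp, insert N_range, linarith)
next
  case (P3 z)
  have "touch 2 (el (-1) 3 (-1)) y z" by (rule P3(3)) simp_all
  then show ?thesis using P3(1) by blast
qed

lemma neighbour_i: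
  assumes "touch 0 (el 2 (-1) 0) x y"
  shows "(\<exists>z. x = g P2 z \<and> touch 2 (el (-1) 1 0) y z)"
  using assms
proof (cases rule: divide_first)
  case (P1 z)
  have "touch 1 (el (-2) 1 0) y z" by (rule P1(3)) simp_all
  then show ?thesis by (rule no_neighbour_8)
next
  case (P2 z)
  have "touch 2 (el (-1) 1 0) y z" by (rule P2(3)) simp_all
  then show ?thesis using P2(1) by blast
next
  case (P3 z)
  have "touch 4 (el (-2) 2 1) y z" by (rule P3(3)) simp_all
  then show ?thesis by (rule far_apart4) (simp, insert N_range, linarith)
qed

lemma neighbour_l:
  assumes "touch 2 (el (-1) 1 0) x y"
  shows "(\<exists>z. x = g P1 z \<and> touch 1 (el 0 2 (-1)) z y) \<or>
    (\<exists>z. x = g P3 z \<and> touch 2 (el 0 (-1) 1) y z)"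
  using assms
proof (cases rule: divide_first)
  case (P1 z)
  have "touch 1 (el 0 2 (-1)) z y" by (rule P1(2)) simp_all
  then show ?thesis using P1(1) by blast
next
  case (P2 z)
  have "touch 0 (el 3 0 (-1)) z y" by (rule P2(2)) simp_all
  then show ?thesis by (rule far_apart0) (simp, insert N_range, linarith)
next
  case (P3 z)
  have "touch 2 (el 0 (-1) 1) y z" by (rule P3(3)) simp_all
  then show ?thesis using P3(1) by blast
qed

lemma neighbour_m:
  assumes "touch 2 (el 0 (-1) 1) x y"
  shows "(\<exists>z. x = g P1 z \<and> touch 1 (el (-1) 1 0) z y)"
  using assms
proof (cases rule: divide_first)
  case (P1 z)
  have "touch 1 (el (-1) 1 0) z y" by (rule P1(2)) simp_all
  then show ?thesis using P1(1) by blast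
next
  case (P2 z)
  have "touch 0 (el 1 3 (-2)) z y" by (rule P2(2)) simp_all
  then show ?thesis by (rule no_neighbour_2)
next
  case (P3 z)
  have "touch 2 (el 2 (-4) 2) y z" by (rule P3(3)) simp_all
  then show ?thesis by (rule far_apart2) (simp, insert N_range, linarith)
qed

lemma neighbour_c1:
  assumes "touch 1 (el (-1) (-1) 1) x y"
  shows "(\<exists>z. x = g P1 z \<and> touch 0 (el (-2) 3 (-1)) z y)"
  using assms
proof (cases rule: divide_first)
  case (P1 z)
  have "touch 0 (el (-2) 3 (-1)) z y" by (rule P1(2)) simp_all
  then show ?thesis using P1(1) by blast
next
  case (P2 z)
  have "touch 1 (el 3 (-5) 2) y z" by (rule P2(3)) simp_all
  then show ?thesis by (rule far_apart1) (simp, insert N_range, linarith)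
next
  case (P3 z)
  have "touch 3 (el 3 (-2) 1) y z" by (rule P3(3)) simp_all
  then show ?thesis by (rule far_apart3) (simp, insert N_range, linarith)
qed

lemma neighbour_c2:
  assumes "touch 0 (el (-2) 3 (-1)) x y"
  shows "(\<exists>z. y = g P2 z \<and> touch 2 (el (-1) 3 (-1)) x z)"
  using assms
proof (cases rule: divide_second)
  case (P1 z)
  have "touch 1 (el (-2) 3 (-1)) x z" by (rule P1(2)) simp_all
  then show ?thesis by (rule no_neighbour_4)
next
  case (P2 z)
  have "touch 2 (el (-1) 3 (-1)) x z" by (rule P2(2)) simp_all
  then show ?thesis using P2(1) by blast
next
  case (P3 z)
  have "touch 4 (el (-2) 4 0) x z" by (rule P3(2)) simp_all
  then show ?thesis by (rule far_apart4) (simp, insert N_range, linarith)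
qed

lemma neighbour_o:
  assumes "touch 3 (el (-1) 2 0) x y"
  shows "(\<exists>z. x = g P3 z \<and> touch 1 (el 0 2 (-1)) y z)"
  using assms
proof (cases rule: divide_first)
  case (P1 z)
  have "touch 2 (el 1 2 (-1)) z y" by (rule P1(2)) simp_all
  then show ?thesis by (rule no_neighbour_11)
next
  case (P2 z)
  have "touch 1 (el 4 (-2) 0) z y" by (rule P2(2)) simp_all
  then show ?thesis by (rule far_apart1) (simp, insert N_range, linarith)
next
  case (P3 z)
  have "touch 1 (el 0 2 (-1)) y z" by (rule P3(3)) simp_all
  then show ?thesis using P3(1) by blast
qed

lemma neighbour_h:
  assumes "touch 0 (el 0 2 (-1)) x y"
  shows "(\<exists>z. y = g P1 z \<and> touch 1 (el 0 2 (-1)) x z)"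
  using assms
proof (cases rule: divide_second)
  case (P1 z)
  have "touch 1 (el 0 2 (-1)) x z" by (rule P1(2)) simp_all
  then show ?thesis using P1(1) by blast
next
  case (P2 z)
  have "touch 2 (el 1 2 (-1)) x z" by (rule P2(2)) simp_all
  then show ?thesis by (rule no_neighbour_11)
next
  case (P3 z)
  have "touch 4 (el 0 3 0) x z" by (rule P3(2)) simp_all
  then show ?thesis by (rule far_apart4) (simp, insert N_range, linarith)
qed

lemma neighbour_n:
  assumes "touch 3 (el 1 (-1) 1) x y"
  shows "(\<exists>z. x = g P1 z \<and> touch 2 (el 0 (-1) 1) z y) \<or>
    (\<exists>z. x = g P2 z \<and> touch 1 (el 0 2 (-1)) z y)"
  using assms
proof (cases rule: divide_first)
  case (P1 z)
  have "touch 2 (el 0 (-1) 1) z y" by (rule P1(2)) simp_all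
  then show ?thesis using P1(1) by blast
next
  case (P2 z)
  have "touch 1 (el 0 2 (-1)) z y" by (rule P2(2)) simp_all
  then show ?thesis using P2(1) by blast
next
  case (P3 z)
  have "touch 1 (el 0 (-5) 3) y z" by (rule P3(3)) simp_all
  then show ?thesis by (rule far_apart1) (simp, insert N_range, linarith)
qed

lemma neighbour_a:
  assumes "touch 1 (el 1 (-2) 1) x y"
  shows "(\<exists>z. x = g P1 z \<and> touch 0 (el (-1) (-1) 1) z y) \<or>
    (\<exists>z. x = g P2 z \<and> touch 1 (el 2 (-1) 0) y z)"
  using assms
proof (cases rule: divide_first)
  case (P1 z)
  have "touch 0 (el (-1) (-1) 1) z y" by (rule P1(2)) simp_all
  then show ?thesis using P1(1) by blast
next
  case (P2 z)
  have "touch 1 (el 2 (-1) 0) y z" by (rule P2(3)) simp_all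
  then show ?thesis using P2(1) by blast
next
  case (P3 z)
  have "touch 3 (el 2 2 (-1)) y z" by (rule P3(3)) simp_all
  then show ?thesis by (rule far_apart3) (simp, insert N_range, linarith)
qed

lemma neighbour_b:
  assumes "touch 0 (el (-1) (-1) 1) x y"
  shows "(\<exists>z. x = g P1 z \<and> touch 1 (el 1 1 (-1)) y z)"
  using assms
proof (cases rule: divide_first)
  case (P1 z)
  have "touch 1 (el 1 1 (-1)) y z" by (rule P1(3)) simp_all
  then show ?thesis using P1(1) by blast
next
  case (P2 z)
  have "touch 2 (el 2 1 (-1)) y z" by (rule P2(3)) simp_all
  then show ?thesis by (rule no_neighbour_13)
next
  case (P3 z)
  have "touch 4 (el 1 2 0) y z" by (rule P3(3)) simp_all
  then show ?thesis by (rule no_neighbour_14)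
qed

lemma neighbour_c:
  assumes "touch 1 (el 1 1 (-1)) x y"
  shows "(\<exists>z. x = g P1 z \<and> touch 0 (el 2 (-3) 1) z y) \<or>
    (\<exists>z. x = g P2 z \<and> touch 1 (el (-1) 1 0) y z)"
  using assms
proof (cases rule: divide_first)
  case (P1 z)
  have "touch 0 (el 2 (-3) 1) z y" by (rule P1(2)) simp_all
  then show ?thesis using P1(1) by blast
next
  case (P2 z)
  have "touch 1 (el (-1) 1 0) y z" by (rule P2(3)) simp_all
  then show ?thesis using P2(1) by blast
next
  case (P3 z)
  have "touch 3 (el (-1) 4 (-1)) y z" by (rule P3(3)) simp_all
  then show ?thesis by (rule far_apart3) (simp, insert N_range, linarith)
qed

lemma neighbour_c3:
  assumes "touch 0 (el 2 (-3) 1) x y"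
  shows "(\<exists>z. x = g P2 z \<and> touch 2 (el (-1) 3 (-1)) y z)"
  using assms
proof (cases rule: divide_first)
  case (P1 z)
  have "touch 1 (el (-2) 3 (-1)) y z" by (rule P1(3)) simp_all
  then show ?thesis by (rule no_neighbour_4)
next
  case (P2 z)
  have "touch 2 (el (-1) 3 (-1)) y z" by (rule P2(3)) simp_all
  then show ?thesis using P2(1) by blast
next
  case (P3 z)
  have "touch 4 (el (-2) 4 0) y z" by (rule P3(3)) simp_all
  then show ?thesis by (rule far_apart4) (simp, insert N_range, linarith)
qed

lemma neighbour_k:
  assumes "touch 1 (el 2 (-1) 0) x y"
  shows "(\<exists>z. x = g P2 z \<and> touch 1 (el 0 2 (-1)) y z)"
  using assms
proof (cases rule: divide_first)
  case (P1 z)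
  have "touch 0 (el 1 (-4) 2) z y" by (rule P1(2)) simp_all
  then show ?thesis by (rule no_neighbour_10)
next
  case (P2 z)
  have "touch 1 (el 0 2 (-1)) y z" by (rule P2(3)) simp_all
  then show ?thesis using P2(1) by blast
next
  case (P3 z)
  have "touch 3 (el 0 5 (-2)) y z" by (rule P3(3)) simp_all
  then show ?thesis by (rule far_apart3) (simp, insert N_range, linarith)
qed

lemma neighbour_e:
  assumes "touch 3 (el 1 1 0) x y"
  shows "(\<exists>z. x = g P1 z \<and> touch 2 (el 2 (-2) 1) z y) \<or>
    (\<exists>z. x = g P2 z \<and> touch 1 (el 1 (-2) 1) z y)"
  using assms
proof (cases rule: divide_first)
  case (P1 z)
  have "touch 2 (el 2 (-2) 1) z y" by (rule P1(2)) simp_all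
  then show ?thesis using P1(1) by blast
next
  case (P2 z)
  have "touch 1 (el 1 (-2) 1) z y" by (rule P2(2)) simp_all
  then show ?thesis using P2(1) by blast
next
  case (P3 z)
  have "touch 1 (el 3 (-5) 2) y z" by (rule P3(3)) simp_all
  then show ?thesis by (rule far_apart1) (simp, insert N_range, linarith)
qed

lemma neighbour_c4:
  assumes "touch 2 (el 2 (-2) 1) x y"
  shows "(\<exists>z. x = g P2 z \<and> touch 0 (el (-2) 3 (-1)) z y)"
  using assms
proof (cases rule: divide_first)
  case (P1 z)
  have "touch 1 (el 0 (-3) 2) z y" by (rule P1(2)) simp_all
  then show ?thesis by (rule no_neighbour_16)
next
  case (P2 z)
  have "touch 0 (el (-2) 3 (-1)) z y" by (rule P2(2)) simp_all
  then show ?thesis using P2(1) by blast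
next
  case (P3 z)
  have "touch 2 (el 5 (-4) 1) y z" by (rule P3(3)) simp_all
  then show ?thesis by (rule far_apart2) (simp, insert N_range, linarith)
qed

declare el_rules [simp del] sq_norm_def [simp del]

end

section \<open>The projection to the plane is injective\<close>

context cubic_root begin

lemma touch_Q: assumes "touch k d x y" shows "x \<in> Q" "y \<in> Q"
  using assms Graph_Q unfolding touch_def by blast+

lemma \<kappa>_bounds: "0 \<le> \<kappa>" "\<kappa> < 1" "\<kappa> \<le> 1" by (simp_all add: \<kappa>_def)

definition near :: "nat \<Rightarrow> complex \<Rightarrow> complex \<Rightarrow> bool" where
  "near n x y \<longleftrightarrow> norm (x - y) \<le> \<kappa> ^ n * 400"

lemma near_weaken: "near n x y \<Longrightarrow> near n (g i x) (g i y)"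
  using g_lipschitz[of i x y] mult_right_mono[OF \<kappa>_bounds(3), of "norm (x - y)"] by (simp add: near_def)

lemma near_step: "near n x y \<Longrightarrow> near (Suc n) (g i x) (g i y)"
  using g_lipschitz[of i x y] mult_left_mono[OF _ \<kappa>_bounds(1), of "norm (x - y)" "\<kappa> ^ n * 400"]
  by (simp add: near_def mult.assoc)

lemma near_start: "x \<in> Q \<Longrightarrow> y \<in> Q \<Longrightarrow> near 0 x y"
  using norm_triangle_ineq4[of x y] norm_Q[of x] norm_Q[of y] by (simp add: near_def)

lemma near_refl: "near n x x"
  using \<kappa>_bounds by (simp add: near_def)

lemma near_eq: "(\<And>n. near n x y) \<Longrightarrow> x = y"
  using geometric_zero[of "norm (x - y)" \<kappa> 400] \<kappa>_bounds by (simp add: near_def)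

lemma g_vertices: "g P1 (V 0) = V 4" "g P1 (V 2) = V 1" "g P1 (V 3) = V 2" "g P2 (V 0) = V 4" "g P2 (V 3) = V 0" "g P3 (V 3) = V 3"
  by (simp_all add: g_V) (simp_all add: V_def)

text \<open>The relation only leads to itself, with both partners in the image of \<open>g P3\<close>; hence both points are
the fixed point \<open>V 3\<close> of that map.\<close>
lemma neighbours_P_vertex:
  assumes "touch 2 (el (-1) 3 (-1)) x y" shows "x = V 3" "y = V 3"
proof -
  have step: "near n x (V 3) \<and> near n y (V 3)"
    if "touch 2 (el (-1) 3 (-1)) x y" for n x y
    using that
  proof (induction n arbitrary: x y)
    case 0 then show ?case using near_start touch_Q V_Q[of 3] by simp
  next
    case (Suc n)
    obtain z where z: "x = g P3 z" "touch 2 (el (-1) 3 (-1)) y z" using neighbour_P[OF Suc.prems] by blast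
    obtain z' where z': "y = g P3 z'" "touch 2 (el (-1) 3 (-1)) z z'" using neighbour_P[OF z(2)] by blast
    show ?case using Suc.IH[OF z'(2)] near_step[of n z "V 3" P3] near_step[of n z' "V 3" P3]
      by (simp add: z(1) z'(1) g_vertices)
  qed
  show "x = V 3" "y = V 3" using step[OF assms] near_eq by blast+
qed

text \<open>The paths in the graph from \<open>X\<close> back to \<open>X\<close>, \<open>Y\<close> or \<open>P\<close>, that is, the subdivision used in \<open>fold_estimate\<close>
read in the opposite direction.\<close>
lemma split_X:
  assumes "touch 1 (el 0 2 (-1)) x y"
  shows "(\<exists>z z'. x = g P1 (g P2 z) \<and> y = g P1 z' \<and> touch 1 (el 0 2 (-1)) z' z) \<or>
    (\<exists>z z'. x = g P1 (g P2 (g P1 z)) \<and> y = g P3 z' \<and> touch 1 (el (-1) 1 0) z z') \<or>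
    (x = V 4 \<and> y = V 2) \<or>
    (\<exists>z z'. x = g P3 z \<and> y = g P3 z' \<and> touch 1 (el 0 2 (-1)) z z')"
  using neighbour_X[OF assms]
proof (elim disjE exE conjE)
  fix z assume x: "x = g P1 z" and n: "touch 0 (el 2 (-1) 0) z y"
  obtain z1 where z1: "z = g P2 z1" "touch 2 (el (-1) 1 0) y z1" using neighbour_i[OF n] by blast
  show ?thesis using neighbour_l[OF z1(2)]
  proof (elim disjE exE conjE)
    fix z' assume "y = g P1 z'" "touch 1 (el 0 2 (-1)) z' z1"
    then show ?thesis using x z1(1) by blast
  next
    fix z' assume y: "y = g P3 z'" and "touch 2 (el 0 (-1) 1) z1 z'"
    then obtain z2 where "z1 = g P1 z2" "touch 1 (el (-1) 1 0) z2 z'" using neighbour_m by blast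
    then show ?thesis using x y z1(1) by blast
  qed
next
  fix z assume x: "x = g P2 z" and n: "touch 1 (el (-1) (-1) 1) y z"
  obtain z' where y: "y = g P1 z'" "touch 0 (el (-2) 3 (-1)) z' z" using neighbour_c1[OF n] by blast
  obtain z1 where z1: "z = g P2 z1" "touch 2 (el (-1) 3 (-1)) z' z1" using neighbour_c2[OF y(2)] by blast
  have "z' = V 3" "z1 = V 3" using neighbours_P_vertex[OF z1(2)] by auto
  then show ?thesis using x y(1) z1(1) by (simp add: g_vertices)
next
  fix z assume x: "x = g P3 z" and n: "touch 3 (el (-1) 2 0) y z"
  obtain z' where "y = g P3 z'" "touch 1 (el 0 2 (-1)) z z'" using neighbour_o[OF n] by blast
  then show ?thesis using x by blast
qed

lemma split_Y:
  assumes "touch 1 (el (-1) 1 0) x y"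
  shows "(\<exists>z z'. x = g P1 z \<and> y = g P1 z' \<and> touch 1 (el 0 2 (-1)) z z') \<or>
    (\<exists>z z'. x = g P3 z \<and> y = g P1 (g P1 z') \<and> touch 1 (el (-1) 1 0) z' z) \<or>
    (\<exists>z z'. x = g P3 z \<and> y = g P2 z' \<and> touch 1 (el 0 2 (-1)) z' z)"
  using neighbour_Y[OF assms]
proof (elim disjE exE conjE)
  fix z assume x: "x = g P1 z" and n: "touch 0 (el 0 2 (-1)) z y"
  obtain z' where "y = g P1 z'" "touch 1 (el 0 2 (-1)) z z'" using neighbour_h[OF n] by blast
  then show ?thesis using x by blast
next
  fix z assume x: "x = g P3 z" and n: "touch 3 (el 1 (-1) 1) y z"
  show ?thesis using neighbour_n[OF n]
  proof (elim disjE exE conjE)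
    fix z' assume y: "y = g P1 z'" and "touch 2 (el 0 (-1) 1) z' z"
    then obtain z2 where "z' = g P1 z2" "touch 1 (el (-1) 1 0) z2 z" using neighbour_m by blast
    then show ?thesis using x y by blast
  next
    fix z' assume "y = g P2 z'" "touch 1 (el 0 2 (-1)) z' z"
    then show ?thesis using x by blast
  qed
qed

text \<open>Converse to the folding identities. By \<open>split_X\<close> and \<open>split_Y\<close>, an estimate for the parts gives one for
the whole that is better by the contraction factor \<open>\<kappa>\<close>; the initial bound \<open>400\<close> exceeds the diameter
of \<open>Q\<close>.\<close>
lemma neighbours_near_sides:
  "(\<forall>x y. touch 1 (el 0 2 (-1)) x y \<longrightarrow>
      (\<exists>s. 0 \<le> s \<and> s \<le> 1 \<and> near n x (side 3 s) \<and> near n y (side 2 (1 - s)))) \<and>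
   (\<forall>x y. touch 1 (el (-1) 1 0) x y \<longrightarrow>
      (\<exists>t. 0 \<le> t \<and> t \<le> 1 \<and> near n x (side 2 t) \<and> near n y (arc_am t)))"
proof (induction n)
  case 0
  have "\<exists>s. 0 \<le> s \<and> s \<le> 1 \<and> near 0 x (side 3 s) \<and> near 0 y (side 2 (1 - s))"
    if "touch 1 (el 0 2 (-1)) x y" for x y
    using touch_Q[OF that] side_Q[of 3 0] side_Q[of 2 1] by (intro exI[of _ 0] conjI near_start) simp_all
  moreover have "\<exists>t. 0 \<le> t \<and> t \<le> 1 \<and> near 0 x (side 2 t) \<and> near 0 y (arc_am t)"
    if "touch 1 (el (-1) 1 0) x y" for x y
    using touch_Q[OF that] side_Q[of 2 0] arc_am_Q[of 0] by (intro exI[of _ 0] conjI near_start) simp_all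
  ultimately show ?case by blast
next
  case (Suc n)
  have IX: "\<exists>s. 0 \<le> s \<and> s \<le> 1 \<and> near n x (side 3 s) \<and> near n y (side 2 (1 - s))"
    if "touch 1 (el 0 2 (-1)) x y" for x y using Suc that by blast
  have IY: "\<exists>t. 0 \<le> t \<and> t \<le> 1 \<and> near n x (side 2 t) \<and> near n y (arc_am t)"
    if "touch 1 (el (-1) 1 0) x y" for x y using Suc that by blast
  have X: "\<exists>s. 0 \<le> s \<and> s \<le> 1 \<and> near (Suc n) x (side 3 s) \<and> near (Suc n) y (side 2 (1 - s))"
    if "touch 1 (el 0 2 (-1)) x y" for x y
    using split_X[OF that]
  proof (elim disjE exE conjE)
    fix z z' assume x: "x = g P1 (g P2 z)" and y: "y = g P1 z'" and "touch 1 (el 0 2 (-1)) z' z"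
    then obtain s where s: "0 \<le> s" "s \<le> 1" "near n z' (side 3 s)" "near n z (side 2 (1 - s))"
      using IX by blast
    have e: "g P1 (g P2 (side 2 (1 - s))) = side 3 (1 - s / 2)" "g P1 (side 3 s) = side 2 (1 - (1 - s / 2))"
      using s side_images(9)[of "1 - s"] side_images(3)[of "1 - s"] side_images(7)[of s] by (simp_all add: diff_divide_distrib)
    show ?thesis using s x y near_step[OF near_weaken[OF s(4), of P2], of P1] near_step[OF s(3), of P1]
      unfolding e by (intro exI[of _ "1 - s / 2"]) simp
  next
    fix z z' assume x: "x = g P1 (g P2 (g P1 z))" and y: "y = g P3 z'" and "touch 1 (el (-1) 1 0) z z'"
    then obtain t where t: "0 \<le> t" "t \<le> 1" "near n z (side 2 t)" "near n z' (arc_am t)"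
      using IY by blast
    have e': "3 / 4 - t / 4 = 1 - (1 + t) / 4" by (simp add: field_simps)
    have e: "g P1 (g P2 (g P1 (side 2 t))) = side 3 ((1 + t) / 4)" "g P3 (arc_am t) = side 2 (1 - (1 + t) / 4)"
      using t side_images(8)[of t] side_images(10)[of t] side_images(2)[of t] g3_am[of t, unfolded e'] by simp_all
    show ?thesis using t x y near_step[OF near_weaken[OF near_weaken[OF t(3), of P1], of P2], of P1] near_step[OF t(4), of P3]
      unfolding e by (intro exI[of _ "(1 + t) / 4"]) simp
  next
    assume "x = V 4" "y = V 2"
    then show ?thesis by (intro exI[of _ 1]) (simp add: side_1 near_refl)
  next
    fix z z' assume x: "x = g P3 z" and y: "y = g P3 z'" and "touch 1 (el 0 2 (-1)) z z'"
    then obtain s where s: "0 \<le> s" "s \<le> 1" "near n z (side 3 s)" "near n z' (side 2 (1 - s))"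
      using IX by blast
    have e': "(3 + (1 - s)) / 4 = 1 - s / 4" by (simp add: field_simps)
    have e: "g P3 (side 3 s) = side 3 (s / 4)" "g P3 (side 2 (1 - s)) = side 2 (1 - s / 4)"
      using s side_images(1)[of s] side_images(4)[of "1 - s", unfolded e'] by simp_all
    show ?thesis using s x y near_step[OF s(3), of P3] near_step[OF s(4), of P3]
      unfolding e by (intro exI[of _ "s / 4"]) simp
  qed
  have Y: "\<exists>t. 0 \<le> t \<and> t \<le> 1 \<and> near (Suc n) x (side 2 t) \<and> near (Suc n) y (arc_am t)"
    if "touch 1 (el (-1) 1 0) x y" for x y
    using split_Y[OF that]
  proof (elim disjE exE conjE)
    fix z z' assume x: "x = g P1 z" and y: "y = g P1 z'" and "touch 1 (el 0 2 (-1)) z z'"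
    then obtain s where s: "0 \<le> s" "s \<le> 1" "near n z (side 3 s)" "near n z' (side 2 (1 - s))"
      using IX by blast
    have e: "g P1 (side 3 s) = side 2 (s / 2)" "g P1 (side 2 (1 - s)) = arc_am (s / 2)"
      using s side_images(7)[of s] side_images(8)[of "1 - s"] by (simp_all add: arc_am_def)
    show ?thesis using s x y near_step[OF s(3), of P1] near_step[OF s(4), of P1]
      unfolding e by (intro exI[of _ "s / 2"]) simp
  next
    fix z z' assume x: "x = g P3 z" and y: "y = g P1 (g P1 z')" and "touch 1 (el (-1) 1 0) z' z"
    then obtain t where t: "0 \<le> t" "t \<le> 1" "near n z' (side 2 t)" "near n z (arc_am t)"
      using IY by blast
    have "arc_am (3 / 4 - t / 4) = side 0 ((1 + t) / 2)"
    proof (cases "t = 1")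
      case True then show ?thesis using side_1[of 0] by (simp add: arc_am_def)
    next
      case False
      have e': "2 - 2 * (3 / 4 - t / 4) = (1 + t) / 2" by (simp add: field_simps)
      have "\<not> 3 / 4 - t / 4 \<le> 1 / 2" using t False by simp
      then show ?thesis unfolding arc_am_def e' by simp
    qed
    then have e: "g P3 (arc_am t) = side 2 (3 / 4 - t / 4)" "g P1 (g P1 (side 2 t)) = arc_am (3 / 4 - t / 4)"
      using t g3_am[of t] side_images(8)[of t] side_images(12)[of t] by simp_all
    show ?thesis using t x y near_step[OF near_weaken[OF t(3), of P1], of P1] near_step[OF t(4), of P3]
      unfolding e by (intro exI[of _ "3 / 4 - t / 4"]) simp
  next
    fix z z' assume x: "x = g P3 z" and y: "y = g P2 z'" and "touch 1 (el 0 2 (-1)) z' z"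
    then obtain s where s: "0 \<le> s" "s \<le> 1" "near n z' (side 3 s)" "near n z (side 2 (1 - s))"
      using IX by blast
    have e': "(3 + (1 - s)) / 4 = 1 - s / 4" "2 - 2 * (1 - s / 4) = s / 2" by (simp_all add: field_simps)
    have arc_am: "arc_am (1 - s / 4) = side 0 (s / 2)" using s unfolding arc_am_def e'(2) by auto
    have e: "g P3 (side 2 (1 - s)) = side 2 (1 - s / 4)" "g P2 (side 3 s) = arc_am (1 - s / 4)"
      using s side_images(4)[of "1 - s", unfolded e'(1)] side_images(13)[of s] arc_am by simp_all
    show ?thesis using s x y near_step[OF s(3), of P2] near_step[OF s(4), of P3]
      unfolding e by (intro exI[of _ "1 - s / 4"]) simp
  qed
  show ?case using X Y by blast
qed

lemma closed_curve_limit: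
  fixes a b :: "real \<Rightarrow> complex"
  assumes "continuous_on {0..1} a" "continuous_on {0..1} b"
    and "\<And>n. \<exists>s. 0 \<le> s \<and> s \<le> 1 \<and> near n x (a s) \<and> near n y (b s)"
  shows "\<exists>s. 0 \<le> s \<and> s \<le> 1 \<and> x = a s \<and> y = b s"
proof -
  let ?S = "(\<lambda>s. (a s, b s)) ` {0..1::real}"
  have "compact ?S" using assms(1,2) by (intro compact_continuous_image continuous_on_Pair) auto
  then have "closed ?S" by (rule compact_imp_closed)
  obtain c where c: "\<And>n. c n \<in> {0..1} \<and> near n x (a (c n)) \<and> near n y (b (c n))"
    using assms(3) by (metis atLeastAtMost_iff)
  have lim: "(\<lambda>n. \<kappa> ^ n * 400) \<longlonglongrightarrow> 0"
    using tendsto_mult[OF LIMSEQ_realpow_zero[OF \<kappa>_bounds(1,2)] tendsto_const[of 400]] by simp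
  have "(\<lambda>n. a (c n)) \<longlonglongrightarrow> x"
    by (rule LIM_zero_cancel, rule Lim_null_comparison[OF _ lim]) (use c in \<open>simp add: near_def norm_minus_commute\<close>)
  moreover have "(\<lambda>n. b (c n)) \<longlonglongrightarrow> y"
    by (rule LIM_zero_cancel, rule Lim_null_comparison[OF _ lim]) (use c in \<open>simp add: near_def norm_minus_commute\<close>)
  ultimately have lim2: "(\<lambda>n. (a (c n), b (c n))) \<longlonglongrightarrow> (x, y)" by (rule tendsto_Pair)
  have mem: "(a (c n), b (c n)) \<in> ?S" for n using c by blast
  have "(x, y) \<in> ?S" by (rule closed_sequentially[OF \<open>closed ?S\<close> mem lim2])
  then show ?thesis by auto
qed

lemma side_continuous: "continuous_on S (side j)"
  unfolding side_def by (intro continuous_intros)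

lemma arc_am_continuous: "continuous_on {0..1} arc_am"
proof -
  have "continuous_on {0..1/2} arc_am"
  proof (rule continuous_on_eq)
    show "continuous_on {0..1/2} (\<lambda>t. side 1 (1 - 2 * t))" unfolding side_def by (intro continuous_intros)
  qed (simp add: arc_am_def)
  moreover have "continuous_on {1/2..1} arc_am"
  proof (rule continuous_on_eq)
    show "continuous_on {1/2..1} (\<lambda>t. side 0 (2 - 2 * t))" unfolding side_def by (intro continuous_intros)
    show "side 0 (2 - 2 * t) = arc_am t" if "t \<in> {1/2..1}" for t
    proof (cases "t = 1/2")
      case True
      have "side 0 (2 - 2 * (1/2)) = arc_am (1/2)" by (simp add: arc_am_def side_1)
      then show ?thesis unfolding True .
    next
      case False
      then have "\<not> t \<le> 1/2" using that by simp
      then show ?thesis unfolding arc_am_def by simp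
    qed
  qed
  ultimately have "continuous_on ({0..1/2} \<union> {1/2..1}) arc_am" by (intro continuous_on_closed_Un) auto
  moreover have "{0..1} = {0..1/2} \<union> {1/2..1::real}" by (rule ivl_disj_un_two_touch(4)[symmetric]) auto
  ultimately show ?thesis by simp
qed

lemma neighbours_X_sides:
  assumes a: "touch 1 (el 0 2 (-1)) x y" shows "\<exists>s. 0 \<le> s \<and> s \<le> 1 \<and> x = side 3 s \<and> y = side 2 (1 - s)"
proof -
  have c: "continuous_on {0..1} (\<lambda>s. side 2 (1 - s))" unfolding side_def by (intro continuous_intros)
  have e: "\<exists>s. 0 \<le> s \<and> s \<le> 1 \<and> near n x (side 3 s) \<and> near n y (side 2 (1 - s))" for n
    by (rule mp[OF spec[OF spec[OF conjunct1[OF neighbours_near_sides[of n]]]] a])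
  show ?thesis by (rule closed_curve_limit[OF side_continuous c e])
qed

lemma neighbours_Y_sides:
  assumes a: "touch 1 (el (-1) 1 0) x y" shows "\<exists>t. 0 \<le> t \<and> t \<le> 1 \<and> x = side 2 t \<and> y = arc_am t"
proof -
  have e: "\<exists>t. 0 \<le> t \<and> t \<le> 1 \<and> near n x (side 2 t) \<and> near n y (arc_am t)" for n
    by (rule mp[OF spec[OF spec[OF conjunct2[OF neighbours_near_sides[of n]]]] a])
  show ?thesis by (rule closed_curve_limit[OF side_continuous arc_am_continuous e])
qed

lemma neighbours_chord1:
  assumes "touch 1 (el 1 (-2) 1) x y" shows "\<exists>t. 0 \<le> t \<and> t \<le> 1 \<and> x = side 0 t \<and> y = arc_qpe t"
  using neighbour_a[OF assms]
proof (elim disjE exE conjE)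
  fix z assume x: "x = g P1 z" and n: "touch 0 (el (-1) (-1) 1) z y"
  obtain z1 where z1: "z = g P1 z1" "touch 1 (el 1 1 (-1)) y z1" using neighbour_b[OF n] by blast
  show ?thesis using neighbour_c[OF z1(2)]
  proof (elim disjE exE conjE)
    fix z' assume y: "y = g P1 z'" and n: "touch 0 (el 2 (-3) 1) z' z1"
    obtain z2 where z2: "z' = g P2 z2" "touch 2 (el (-1) 3 (-1)) z1 z2" using neighbour_c3[OF n] by blast
    have "z1 = V 3" "z2 = V 3" using neighbours_P_vertex[OF z2(2)] by auto
    then have "x = V 1" "y = V 4" using x y z1(1) z2(1) by (simp_all add: g_vertices)
    then show ?thesis using side_1[of 0] by (intro exI[of _ 1]) (simp add: arc_qpe_def)
  next
    fix z' assume y: "y = g P2 z'" and "touch 1 (el (-1) 1 0) z1 z'"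
    then obtain t where t: "0 \<le> t" "t \<le> 1" "z1 = side 2 t" "z' = arc_am t" using neighbours_Y_sides by blast
    have "x = side 0 ((1 + t) / 2)" "y = arc_qpe ((1 + t) / 2)"
      using x y z1(1) t side_images(8)[of t] side_images(12)[of t] g2_am[of t] by simp_all
    then show ?thesis using t by (intro exI[of _ "(1 + t) / 2"]) simp
  qed
next
  fix z assume x: "x = g P2 z" and n: "touch 1 (el 2 (-1) 0) y z"
  obtain z' where y: "y = g P2 z'" "touch 1 (el 0 2 (-1)) z z'" using neighbour_k[OF n] by blast
  obtain s where s: "0 \<le> s" "s \<le> 1" "z = side 3 s" "z' = side 2 (1 - s)" using neighbours_X_sides[OF y(2)] by blast
  have "x = side 0 (s / 2)" "y = arc_qpe (s / 2)"
    using x y s side_images(13)[of s] side_images(9)[of "1 - s"] by (simp_all add: arc_qpe_def)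
  then show ?thesis using s by (intro exI[of _ "s / 2"]) simp
qed

lemma neighbours_chord2:
  assumes "touch 3 (el 1 1 0) x y" shows "\<exists>t. 0 \<le> t \<and> t \<le> 1 \<and> x = side 4 t \<and> y = arc_qpe t"
  using neighbour_e[OF assms]
proof (elim disjE exE conjE)
  fix z assume x: "x = g P1 z" and n: "touch 2 (el 2 (-2) 1) z y"
  obtain z1 where z1: "z = g P2 z1" "touch 0 (el (-2) 3 (-1)) z1 y" using neighbour_c4[OF n] by blast
  obtain z2 where z2: "y = g P2 z2" "touch 2 (el (-1) 3 (-1)) z1 z2" using neighbour_c2[OF z1(2)] by blast
  have "z1 = V 3" "z2 = V 3" using neighbours_P_vertex[OF z2(2)] by auto
  then have "x = V 4" "y = V 0" using x z1(1) z2(1) by (simp_all add: g_vertices)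
  then show ?thesis using V_per(2)[of 0] by (intro exI[of _ 0]) (simp add: arc_qpe_def side_1)
next
  fix z assume x: "x = g P2 z" and n: "touch 1 (el 1 (-2) 1) z y"
  obtain t where t: "0 \<le> t" "t \<le> 1" "z = side 0 t" "y = arc_qpe t" using neighbours_chord1[OF n] by blast
  then show ?thesis using x side_images(11)[of t] by (intro exI[of _ t]) simp
qed

text \<open>Coincidences in the plane come from coincidences in the polygon: contacts of \<open>f\<^sub>1 C\<close> with \<open>f\<^sub>2 C\<close> and
\<open>f\<^sub>3 C\<close> are the relations \<open>a\<close> and \<open>e\<close> of the neighbour graph, and \<open>f\<^sub>2 C\<close>, \<open>f\<^sub>3 C\<close> are too far apart.\<close>
lemma pieces_meet:
  assumes u: "(x, u) \<in> Graph" and v: "(y, v) \<in> Graph"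
  shows "f P1 u = f P2 v \<Longrightarrow> g P1 x = g P2 y" "f P1 u = f P3 v \<Longrightarrow> g P1 x = g P3 y" "f P2 u \<noteq> f P3 v"
proof -
  show "g P1 x = g P2 y" if e: "f P1 u = f P2 v"
  proof -
    have h: "f P1 u = \<alpha> ^ 2 * v + el 1 0 0" using e by (simp add: f_simps el_def)
    have "u = \<alpha> ^ 1 * v + el 1 (-2) 1" by (rule cancel_ge[OF h]) (simp_all add: f_el)
    from neighbours_chord1[OF touchI[OF u v this]] show ?thesis using chord1 by auto
  qed
  show "g P1 x = g P3 y" if e: "f P1 u = f P3 v"
  proof -
    have h: "f P1 u = \<alpha> ^ 4 * v + el 0 1 1" using e by (simp add: f_simps el_def)
    have "u = \<alpha> ^ 3 * v + el 1 1 0" by (rule cancel_ge[OF h]) (simp_all add: f_el)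
    from neighbours_chord2[OF touchI[OF u v this]] show ?thesis using chord2 by auto
  qed
  show "f P2 u \<noteq> f P3 v"
  proof
    assume e: "f P2 u = f P3 v"
    have h: "f P2 u = \<alpha> ^ 4 * v + el 0 1 1" using e by (simp add: f_simps el_def)
    have "u = \<alpha> ^ 2 * v + el 3 (-1) 0" by (rule cancel_ge[OF h]) (simp_all add: f_el el_mult el_add)
    from touchI[OF u v this] show False by (rule far_apart2) (simp add: sq_norm_def, insert N_range, linarith)
  qed
qed

text \<open>The argument of \<open>fibre_unique\<close> with the roles of \<open>Q\<close> and the plane exchanged.\<close>
lemma point_unique: assumes "(x, u) \<in> Graph" "(y, u) \<in> Graph" shows "x = y"
proof -
  have "near n x y" if "(x, u) \<in> Graph" "(y, u) \<in> Graph" for n x y u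
    using that
  proof (induction n arbitrary: x y u)
    case 0 then show ?case using near_start Graph_Q by blast
  next
    case (Suc n)
    obtain i z w where s: "(z, w) \<in> Graph" "x = g i z" "u = f i w" using Graph_step[OF Suc.prems(1)] .
    obtain j z' w' where s': "(z', w') \<in> Graph" "y = g j z'" "u = f j w'" using Graph_step[OF Suc.prems(2)] .
    note m = pieces_meet[OF s(1) s'(1)] and m' = pieces_meet[OF s'(1) s(1)]
    show ?case
    proof (cases "i = j")
      case True
      then have "w' = w" using s s' f_inj by metis
      then show ?thesis using Suc.IH[OF s(1), of z'] s'(1) near_step[of n z z' j] s(2) s'(2) True by simp
    next
      case False
      then have "x = y" using m m' s(2,3) s'(2,3) by (cases i; cases j) auto
      then show ?thesis using near_refl by simp
    qed
  qed
  from near_eq[OF this[OF assms]] show ?thesis .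
qed

section \<open>Two cells form a disc\<close>

definition C :: "complex set" where "C = snd ` Graph"

lemma f_C: "C = (\<Union>i. f i ` C)"
proof
  show "C \<subseteq> (\<Union>i. f i ` C)"
  proof
    fix u assume "u \<in> C"
    then obtain x where "(x, u) \<in> Graph" unfolding C_def by auto
    then obtain i y v where "(y, v) \<in> Graph" "u = f i v" using Graph_step by metis
    then show "u \<in> (\<Union>i. f i ` C)" unfolding C_def by force
  qed
  show "(\<Union>i. f i ` C) \<subseteq> C" unfolding C_def using Graph_intro by force
qed

lemma compact_C: "compact C"
  unfolding C_def by (intro compact_continuous_image Graph(1) continuous_on_snd continuous_on_id)

lemma C_nonempty: "C \<noteq> {}"
  using Graph(4) V_Q[of 0] unfolding C_def by auto

text \<open>Both projections of the part of \<open>Graph\<close> over two cells are continuous bijections from a compact set.\<close>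
lemma two_pieces_disc: "f P1 ` C \<union> f P3 ` C homeomorphic cball (0::complex) 1"
proof -
  define G where "G = {p \<in> Graph. fst p \<in> cell P1 \<union> cell P3}"
  have G: "G = Graph \<inter> fst -` (cell P1 \<union> cell P3)" by (auto simp: G_def)
  have "compact (cell P1 \<union> cell P3)" using half_Q_disc homeomorphic_compactness compact_cball by blast
  then have "closed (fst -` (cell P1 \<union> cell P3) :: (complex \<times> complex) set)"
    by (intro closed_vimage compact_imp_closed continuous_intros)
  then have comp: "compact G" unfolding G using Graph(1) by (rule compact_Int_closed[rotated])
  have sub: "G \<subseteq> Graph" by (auto simp: G_def)
  have fst: "fst ` G = cell P1 \<union> cell P3"
  proof
    show "cell P1 \<union> cell P3 \<subseteq> fst ` G"
    proof
      fix x assume x: "x \<in> cell P1 \<union> cell P3"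
      then have "x \<in> fst ` Graph" using cell_subset_Q Graph(4) by blast
      then show "x \<in> fst ` G" using x unfolding G_def by auto
    qed
  qed (auto simp: G_def)
  have snd: "snd ` G = f P1 ` C \<union> f P3 ` C"
  proof
    show "snd ` G \<subseteq> f P1 ` C \<union> f P3 ` C"
    proof
      fix u assume "u \<in> snd ` G"
      then obtain x where x: "(x, u) \<in> Graph" "x \<in> cell P1 \<union> cell P3" unfolding G_def by auto
      then obtain j where j: "j = P1 \<or> j = P3" "x \<in> g j ` Q" using g_image by auto
      then obtain y where y: "y \<in> Q" "x = g j y" by blast
      then obtain w where w: "(y, w) \<in> Graph" using Graph(4) by (metis imageE prod.collapse)
      then have "u = f j w" using fibre_unique[OF x(1)] Graph_intro[OF w, of j] y(2) by simp
      then show "u \<in> f P1 ` C \<union> f P3 ` C" using w j(1) unfolding C_def by force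
    qed
    show "f P1 ` C \<union> f P3 ` C \<subseteq> snd ` G"
    proof
      fix u assume "u \<in> f P1 ` C \<union> f P3 ` C"
      then obtain j y w where w: "j = P1 \<or> j = P3" "(y, w) \<in> Graph" "u = f j w" unfolding C_def by force
      then have "(g j y, u) \<in> Graph" "g j y \<in> cell P1 \<union> cell P3"
        using Graph_intro g_image Graph_Q by blast+
      then show "u \<in> snd ` G" unfolding G_def by force
    qed
  qed
  have "G homeomorphic cell P1 \<union> cell P3"
  proof (rule homeomorphic_compact[OF comp _ fst])
    show "inj_on fst G"
    proof (rule inj_onI)
      fix p q assume pq: "p \<in> G" "q \<in> G" and e: "fst p = fst q"
      have "(fst p, snd p) \<in> Graph" using subsetD[OF sub pq(1)] by simp
      moreover have "(fst p, snd q) \<in> Graph" using subsetD[OF sub pq(2)] unfolding e by simp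
      ultimately have "snd p = snd q" by (rule fibre_unique)
      then show "p = q" using e by (simp add: prod_eq_iff)
    qed
  qed (intro continuous_intros)
  moreover have "G homeomorphic f P1 ` C \<union> f P3 ` C"
  proof (rule homeomorphic_compact[OF comp _ snd])
    show "inj_on snd G"
    proof (rule inj_onI)
      fix p q assume pq: "p \<in> G" "q \<in> G" and e: "snd p = snd q"
      have "(fst p, snd p) \<in> Graph" using subsetD[OF sub pq(1)] by simp
      moreover have "(fst q, snd p) \<in> Graph" using subsetD[OF sub pq(2)] unfolding e by simp
      ultimately have "fst p = fst q" by (rule point_unique)
      then show "p = q" using e by (simp add: prod_eq_iff)
    qed
  qed (intro continuous_intros)
  ultimately have "f P1 ` C \<union> f P3 ` C homeomorphic cell P1 \<union> cell P3"
    using homeomorphic_trans[OF iffD1[OF homeomorphic_sym]] by blast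
  then show ?thesis by (rule homeomorphic_trans[OF _ half_Q_disc])
qed

end

section \<open>Digit expansions\<close>

context cubic_root begin

text \<open>The sums \<open>\<Sum> d\<^sub>n \<alpha>\<^sup>n\<close> of the digits to come after the digits \<open>a, b, c\<close>, the most recent one first.
Only four different sets occur, all of them described by \<open>C\<close>: after \<open>0\<close> preceded by \<open>1\<close> it is \<open>C\<close> itself.\<close>
definition tail_set :: "nat \<Rightarrow> nat \<Rightarrow> nat \<Rightarrow> complex set" where
  "tail_set a b c =
    (if a = 0 then if b = 0 then C \<union> (\<lambda>v. 1 + \<alpha> + \<alpha> ^ 3 * v) ` C else C
     else if b = 0 \<and> c = 0 then (\<lambda>v. \<alpha> * v) ` C \<union> (\<lambda>v. 1 + \<alpha>\<^sup>2 * v) ` C else (\<lambda>v. \<alpha> * v) ` C)"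

lemma C_cases:
  assumes "w \<in> C" obtains v where "v \<in> C" "w = \<alpha> * v" | v where "v \<in> C" "w = 1 + \<alpha> * (\<alpha> * v)"
    | v where "v \<in> C" "w = \<alpha> * (1 + \<alpha> + \<alpha> ^ 3 * v)"
proof -
  have "w \<in> (\<Union>i. f i ` C)" by (rule subsetD[OF equalityD1[OF f_C] assms])
  then obtain i v where v: "v \<in> C" "w = f i v" by auto
  show thesis
  proof (cases i)
    case P1 show thesis by (rule that(1)[OF v(1)]) (simp add: v(2) P1 f_simps)
  next
    case P2 show thesis by (rule that(2)[OF v(1)]) (simp add: v(2) P2 f_simps power2_eq_square mult.assoc)
  next
    case P3 show thesis by (rule that(3)[OF v(1)]) (simp add: v(2) P3 f_simps power_numeral_reduce algebra_simps)
  qed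
qed

lemma C_intros:
  assumes "v \<in> C" shows "\<alpha> * v \<in> C" "1 + \<alpha> * (\<alpha> * v) \<in> C" "\<alpha> * (1 + \<alpha> + \<alpha> ^ 3 * v) \<in> C"
proof -
  have i: "f i v \<in> C" for i by (rule subsetD[OF equalityD2[OF f_C]]) (use assms in blast)
  show "\<alpha> * v \<in> C" "1 + \<alpha> * (\<alpha> * v) \<in> C" "\<alpha> * (1 + \<alpha> + \<alpha> ^ 3 * v) \<in> C"
    using i[of P1] i[of P2] i[of P3] by (simp_all add: f_simps power_numeral_reduce algebra_simps)
qed

text \<open>The digit \<open>e\<close> may follow \<open>a\<close>, \<open>b\<close>, \<open>c\<close>, where \<open>a\<close> is the most recent digit: the blocks 111 and 1011 are
avoided.\<close>
definition allowed :: "nat \<Rightarrow> nat \<Rightarrow> nat \<Rightarrow> nat \<Rightarrow> bool" where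
  "allowed e a b c \<longleftrightarrow> e \<in> {0, 1} \<and> (e = 1 \<longrightarrow> a = 1 \<longrightarrow> b = 0 \<and> c = 0)"

text \<open>Choice of the next digit. Together with \<open>tail_set_intro\<close> this is the equation
\<open>tail_set a b c = (\<Union>e. e + \<alpha> tail_set e a b)\<close>, over the allowed digits \<open>e\<close>; it holds because of the
decomposition of \<open>C\<close> into \<open>\<alpha> C\<close>, \<open>1 + \<alpha>\<^sup>2 C\<close> and \<open>\<alpha> (1 + \<alpha> + \<alpha>\<^sup>3 C)\<close>.\<close>
lemma tail_set_step:
  assumes w: "w \<in> tail_set a b c" and d: "a \<in> {0, 1}" "b \<in> {0, 1}"
  shows "\<exists>e w'. allowed e a b c \<and> w' \<in> tail_set e a b \<and> w = of_nat e + \<alpha> * w'"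
proof -
  have zero: ?thesis if "w' \<in> tail_set 0 a b" "w = \<alpha> * w'" for w'
    using that by (intro exI[of _ 0] exI[of _ w']) (simp add: allowed_def)
  have one: ?thesis if "w' \<in> tail_set 1 a b" "w = 1 + \<alpha> * w'" "a = 1 \<longrightarrow> b = 0 \<and> c = 0" for w'
    using that by (intro exI[of _ 1] exI[of _ w']) (simp add: allowed_def)
  show ?thesis
  proof (cases "a = 0")
    case a: True
    have C: ?thesis if "w \<in> C"
    proof (rule C_cases[OF that])
      fix v assume "v \<in> C" "w = \<alpha> * v" then show ?thesis using a by (intro zero[of v]) (auto simp: tail_set_def)
    next
      fix v assume "v \<in> C" "w = 1 + \<alpha> * (\<alpha> * v)"
      then show ?thesis using a by (intro one[of "\<alpha> * v"]) (auto simp: tail_set_def)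
    next
      fix v assume "v \<in> C" "w = \<alpha> * (1 + \<alpha> + \<alpha> ^ 3 * v)"
      then show ?thesis using a by (intro zero[of "1 + \<alpha> + \<alpha> ^ 3 * v"]) (auto simp: tail_set_def)
    qed
    show ?thesis
    proof (cases "w \<in> C")
      case False
      then obtain v where v: "b = 0" "v \<in> C" "w = 1 + \<alpha> + \<alpha> ^ 3 * v" using w a by (auto simp: tail_set_def split: if_splits)
      then have "w = 1 + \<alpha> * (1 + \<alpha>\<^sup>2 * v)" by (simp add: power2_eq_square power3_eq_cube algebra_simps)
      then show ?thesis using a v by (intro one[of "1 + \<alpha>\<^sup>2 * v"]) (auto simp: tail_set_def)
    qed (rule C)
  next
    case False
    then have a: "a = 1" using d by simp
    show ?thesis
    proof (cases "w \<in> (\<lambda>v. \<alpha> * v) ` C")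
      case True
      then obtain v where "v \<in> C" "w = \<alpha> * v" by blast
      then show ?thesis using a by (intro zero[of v]) (auto simp: tail_set_def)
    next
      case False
      then obtain v where v: "b = 0" "c = 0" "v \<in> C" "w = 1 + \<alpha>\<^sup>2 * v" using w a by (auto simp: tail_set_def split: if_splits)
      then show ?thesis using a by (intro one[of "\<alpha> * v"]) (auto simp: tail_set_def power2_eq_square)
    qed
  qed
qed

lemma tail_set_intro:
  assumes e: "allowed e a b c" and w: "w \<in> tail_set e a b" and d: "a \<in> {0, 1}" "b \<in> {0, 1}"
  shows "of_nat e + \<alpha> * w \<in> tail_set a b c"
proof -
  have "e = 0 \<or> e = 1" using e by (auto simp: allowed_def)
  then show ?thesis
  proof
    assume e0: "e = 0"
    have aC: "\<alpha> * w \<in> C" if "a = 0" using w that e0 C_intros by (auto simp: tail_set_def)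
    show ?thesis
    proof (cases "a = 0")
      case True then show ?thesis using aC e0 by (simp add: tail_set_def)
    next
      case False then show ?thesis using w e0 by (auto simp: tail_set_def)
    qed
  next
    assume e1: "e = 1"
    show ?thesis
    proof (cases "a = 0")
      case a: True
      show ?thesis
      proof (cases "w \<in> (\<lambda>v. \<alpha> * v) ` C")
        case True then show ?thesis using C_intros(2) a e1 by (auto simp: tail_set_def)
      next
        case False
        then obtain v where v: "b = 0" "v \<in> C" "w = 1 + \<alpha>\<^sup>2 * v" using w a e1 by (auto simp: tail_set_def split: if_splits)
        have "1 + \<alpha> * w = 1 + \<alpha> + \<alpha> ^ 3 * v" unfolding v(3) by (simp add: power2_eq_square power3_eq_cube algebra_simps)
        then show ?thesis using a e1 v by (auto simp: tail_set_def)
      qed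
    next
      case False
      then have a: "a = 1" "b = 0" "c = 0" using e e1 d by (auto simp: allowed_def)
      then obtain v where v: "v \<in> C" "w = \<alpha> * v" using w e1 by (auto simp: tail_set_def)
      have "1 + \<alpha> * w = 1 + \<alpha>\<^sup>2 * v" unfolding v(2) by (simp add: power2_eq_square)
      then have "1 + \<alpha> * w \<in> (\<lambda>v. 1 + \<alpha>\<^sup>2 * v) ` C" using v(1) by blast
      then show ?thesis using a e1 by (simp add: tail_set_def)
    qed
  qed
qed

lemma C_B: "C \<subseteq> B" unfolding C_def using Graph_B by auto

lemma tail_set_norm: assumes "w \<in> tail_set a b c" shows "norm w \<le> 4"
proof -
  have n: "norm (\<alpha> ^ n * v) \<le> 2" if "v \<in> C" for n v
  proof -
    have "norm \<alpha> ^ n * norm v \<le> 1 * 2"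
      using norm_B C_B that norm_\<alpha>_le power_le_one[of "norm \<alpha>" n] by (intro mult_mono) auto
    then show ?thesis by (simp add: norm_mult norm_power)
  qed
  consider v where "v \<in> C" "w = \<alpha> ^ 0 * v" | v where "v \<in> C" "w = \<alpha> ^ 1 * v" | v where "v \<in> C" "w = 1 + \<alpha> ^ 2 * v"
    | v where "v \<in> C" "w = (1 + \<alpha>) + \<alpha> ^ 3 * v"
    using assms by (auto simp: tail_set_def split: if_splits)
  then show ?thesis
  proof cases
    case 1 then show ?thesis using n[of _ 0] by fastforce
  next
    case 2 then show ?thesis using n[of _ 1] by fastforce
  next
    case (3 v) then show ?thesis using n[of v 2] norm_triangle_ineq[of 1 "\<alpha> ^ 2 * v"] by simp
  next
    case (4 v) then show ?thesis
      using n[of v 3] norm_triangle_ineq[of "1 + \<alpha>" "\<alpha> ^ 3 * v"] norm_triangle_ineq[of 1 \<alpha>] norm_\<alpha>_le by simp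
  qed
qed

lemma tail_set_compact: "compact (tail_set a b c)"
  unfolding tail_set_def using compact_C
  by (auto intro!: compact_Un compact_continuous_image continuous_intros)

lemma tail_set_nonempty: "tail_set a b c \<noteq> {}"
  unfolding tail_set_def using C_nonempty by auto

text \<open>Replacing the remainder after \<open>n\<close> digits by any element of the appropriate tail set gives a point of
\<open>tail_set 0 0 0\<close>, by \<open>tail_set_intro\<close>, and changes the sum by at most a constant times \<open>|\<alpha>|\<^sup>n\<close>; the set is closed.\<close>
lemma digit_sums_subset:
  fixes d :: "int \<Rightarrow> nat"
  assumes adm: "\<And>i. 2 \<le> i \<Longrightarrow> allowed (d i) (d (i - 1)) (d (i - 2)) (d (i - 3))"
    and init: "d 1 = 0" "d 0 = 0" "d (-1) = 0"
    and sums: "(\<lambda>n. of_nat (d (int n + 2)) * \<alpha> ^ n) sums w"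
  shows "w \<in> tail_set 0 0 0"
proof -
  have dig: "d i \<in> {0, 1}" if "-1 \<le> i" for i
  proof (cases "2 \<le> i")
    case True then show ?thesis using adm[of i] by (simp add: allowed_def)
  next
    case False
    then have "i = -1 \<or> i = 0 \<or> i = 1" using that by auto
    then show ?thesis using init by auto
  qed
  have summable: "summable (\<lambda>n. of_nat (d (int n + 2 + int m)) * \<alpha> ^ n)" for m :: nat
  proof (rule summable_comparison_test')
    show "summable (\<lambda>n. norm \<alpha> ^ n)" using norm_\<alpha>_le by (intro summable_geometric) simp
    show "norm (of_nat (d (int n + 2 + int m)) * \<alpha> ^ n) \<le> norm \<alpha> ^ n" for n
      using dig[of "int n + 2 + int m"] by (auto simp: norm_mult norm_power)
  qed
  define T where "T m = (\<Sum>n. of_nat (d (int n + 2 + int m)) * \<alpha> ^ n)" for m :: nat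
  have T0: "T 0 = w" unfolding T_def using sums by (simp add: sums_unique[symmetric])
  have TS: "T m = of_nat (d (2 + int m)) + \<alpha> * T (Suc m)" for m
  proof -
    have "T m = of_nat (d (2 + int m)) + (\<Sum>n. of_nat (d (int (Suc n) + 2 + int m)) * \<alpha> ^ Suc n)"
      unfolding T_def using suminf_split_head[OF summable[of m]] by simp
    also have "(\<Sum>n. of_nat (d (int (Suc n) + 2 + int m)) * \<alpha> ^ Suc n) = \<alpha> * T (Suc m)"
      unfolding T_def suminf_mult[OF summable, symmetric] by (simp add: algebra_simps)
    finally show ?thesis .
  qed
  have Tb: "norm (T m) \<le> 1 / (1 - norm \<alpha>)" for m
  proof -
    have "norm (T m) \<le> (\<Sum>n. norm \<alpha> ^ n)"
      unfolding T_def
    proof (rule norm_suminf_le)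
      show "summable (\<lambda>n. norm \<alpha> ^ n)" using norm_\<alpha>_le by (intro summable_geometric) simp
      show "norm (of_nat (d (int n + 2 + int m)) * \<alpha> ^ n) \<le> norm \<alpha> ^ n" for n
        using dig[of "int n + 2 + int m"] by (auto simp: norm_mult norm_power)
    qed
    then show ?thesis using suminf_geometric[of "norm \<alpha>"] norm_\<alpha>_le by simp
  qed
  define D where "D = 1 / (1 - norm \<alpha>) + 4"
  have approx: "\<exists>v \<in> tail_set (d (1 + int m)) (d (int m)) (d (int m - 1)). norm (T m - v) \<le> norm \<alpha> ^ n * D" for n m
  proof (induction n arbitrary: m)
    case 0
    obtain v where v: "v \<in> tail_set (d (1 + int m)) (d (int m)) (d (int m - 1))" using tail_set_nonempty by blast
    then show ?case using norm_triangle_ineq4[of "T m" v] Tb[of m] tail_set_norm[OF v] unfolding D_def by (intro bexI[of _ v]) auto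
  next
    case (Suc n)
    obtain v where v: "v \<in> tail_set (d (1 + int (Suc m))) (d (int (Suc m))) (d (int (Suc m) - 1))"
      "norm (T (Suc m) - v) \<le> norm \<alpha> ^ n * D" using Suc by blast
    have v': "v \<in> tail_set (d (2 + int m)) (d (1 + int m)) (d (int m))" using v(1) by (simp add: add.commute)
    have al: "allowed (d (2 + int m)) (d (1 + int m)) (d (int m)) (d (int m - 1))"
      using adm[of "2 + int m"] by (simp add: add.commute)
    have "of_nat (d (2 + int m)) + \<alpha> * v \<in> tail_set (d (1 + int m)) (d (int m)) (d (int m - 1))"
      by (rule tail_set_intro[OF al v']) (use dig in auto)
    moreover have "norm (T m - (of_nat (d (2 + int m)) + \<alpha> * v)) \<le> norm \<alpha> ^ Suc n * D"
    proof -
      have "T m - (of_nat (d (2 + int m)) + \<alpha> * v) = \<alpha> * (T (Suc m) - v)" unfolding TS[of m] by (simp add: algebra_simps)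
      then show ?thesis using mult_left_mono[OF v(2), of "norm \<alpha>"] by (simp add: norm_mult mult.assoc)
    qed
    ultimately show ?case by blast
  qed
  have "\<exists>v \<in> tail_set 0 0 0. norm (w - v) \<le> norm \<alpha> ^ n * D" for n
    using approx[of 0 n] init T0 by simp
  then obtain v where v: "\<And>n. v n \<in> tail_set 0 0 0" "\<And>n. norm (w - v n) \<le> norm \<alpha> ^ n * D" by metis
  have lim: "(\<lambda>n. norm \<alpha> ^ n * D) \<longlonglongrightarrow> 0"
    using tendsto_mult[OF LIMSEQ_realpow_zero[of "norm \<alpha>"] tendsto_const[of D]] norm_\<alpha>_le by simp
  have "v \<longlonglongrightarrow> w"
    by (rule LIM_zero_cancel, rule Lim_null_comparison[OF _ lim]) (use v(2) in \<open>simp add: norm_minus_commute\<close>)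
  then show ?thesis by (rule closed_sequentially[OF compact_imp_closed[OF tail_set_compact] v(1)])
qed

text \<open>The digits are chosen one after the other by \<open>tail_set_step\<close>. The remainders stay bounded, so the
partial sums converge to \<open>w\<close>.\<close>
lemma tail_set_digits:
  assumes "w \<in> tail_set 0 0 0"
  obtains d :: "int \<Rightarrow> nat" where "\<And>i. 2 \<le> i \<Longrightarrow> allowed (d i) (d (i - 1)) (d (i - 2)) (d (i - 3))"
    "\<And>i. i < 2 \<Longrightarrow> d i = 0" "(\<lambda>n. of_nat (d (int n + 2)) * \<alpha> ^ n) sums w"
proof -
  \<comment> \<open>States consist of the last three digits and the remainder still to be expanded.\<close>
  define I where "I = (\<lambda>(a, b, c, z). a \<in> {0, 1} \<and> b \<in> {0, 1} \<and> z \<in> tail_set a b c)"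
  define J where "J = (\<lambda>(a, b, c, z) (e, a', b', z'). allowed e a b c \<and> a' = a \<and> b' = b \<and> z = of_nat e + \<alpha> * z')"
  have "\<exists>S. \<forall>n. (I (S n) \<and> (n = 0 \<longrightarrow> S n = (0, 0, 0, w))) \<and> J (S n) (S (Suc n))"
  proof (rule dependent_nat_choice)
    show "\<exists>x. I x \<and> (0 = 0 \<longrightarrow> x = (0, 0, 0, w))" using assms by (auto simp: I_def)
  next
    fix x :: "nat \<times> nat \<times> nat \<times> complex" and n :: nat
    assume "I x \<and> (n = 0 \<longrightarrow> x = (0, 0, 0, w))"
    then obtain a b c z where x: "x = (a, b, c, z)" "a \<in> {0, 1}" "b \<in> {0, 1}" "z \<in> tail_set a b c" by (auto simp: I_def)
    obtain e z' where e: "allowed e a b c" "z' \<in> tail_set e a b" "z = of_nat e + \<alpha> * z'"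
      using tail_set_step[OF x(4,2,3)] by blast
    have "e \<in> {0, 1}" using e(1) by (auto simp: allowed_def)
    then show "\<exists>y. (I y \<and> (Suc n = 0 \<longrightarrow> y = (0, 0, 0, w))) \<and> J x y"
      using x e by (intro exI[of _ "(e, a, b, z')"]) (simp add: I_def J_def)
  qed
  then obtain S where S: "\<And>n. I (S n)" "S 0 = (0, 0, 0, w)" "\<And>n. J (S n) (S (Suc n))" by blast
  define a b c z where "a n = fst (S n)" and "b n = fst (snd (S n))" and "c n = fst (snd (snd (S n)))" and "z n = snd (snd (snd (S n)))" for n
  have Sn: "S n = (a n, b n, c n, z n)" for n by (simp add: a_def b_def c_def z_def)
  have 0: "a 0 = 0" "b 0 = 0" "c 0 = 0" "z 0 = w" using S(2) unfolding Sn by auto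
  have step: "allowed (a (Suc n)) (a n) (b n) (c n)" "b (Suc n) = a n" "c (Suc n) = b n" "z n = of_nat (a (Suc n)) + \<alpha> * z (Suc n)" for n
    using S(3)[of n] unfolding Sn J_def by auto
  have zb: "norm (z n) \<le> 4" for n using S(1)[of n] tail_set_norm unfolding Sn I_def by auto
  define d where "d i = (if i < 2 then 0 else a (Suc (nat (i - 2))))" for i :: int
  have d: "d (int n + 1) = a n" for n using 0 by (cases n) (auto simp: d_def nat_add_distrib)
  have db: "d (int n) = b n" for n using 0 step(2) d by (cases n) (auto simp: d_def add.commute)
  have dc: "d (int n - 1) = c n" for n using 0 step(3) db by (cases n) (auto simp: d_def)
  show thesis
  proof
    show "d i = 0" if "i < 2" for i using that by (simp add: d_def)
    show "allowed (d i) (d (i - 1)) (d (i - 2)) (d (i - 3))" if i: "2 \<le> i" for i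
    proof -
      define n where "n = nat (i - 2)"
      have n: "i = int n + 2" using i by (simp add: n_def)
      have "d i = a (Suc n)" "d (i - 1) = a n" "d (i - 2) = b n" "d (i - 3) = c n"
        using d[of "Suc n"] d[of n] db[of n] dc[of n] unfolding n by (simp_all add: algebra_simps)
      then show ?thesis using step(1) by simp
    qed
    have part: "w = (\<Sum>k<n. of_nat (d (int k + 2)) * \<alpha> ^ k) + \<alpha> ^ n * z n" for n
    proof (induction n)
      case (Suc n)
      have "d (int n + 2) = a (Suc n)" using d[of "Suc n"] by (simp add: algebra_simps)
      then show ?case using Suc step(4)[of n] by (simp add: algebra_simps)
    qed (simp add: 0)
    have "(\<lambda>n. \<alpha> ^ n * z n) \<longlonglongrightarrow> 0"
    proof (rule Lim_null_comparison)
      show "\<forall>\<^sub>F n in sequentially. norm (\<alpha> ^ n * z n) \<le> norm \<alpha> ^ n * 4"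
        using zb by (intro always_eventually) (simp add: norm_mult norm_power mult_left_mono)
      show "(\<lambda>n. norm \<alpha> ^ n * 4) \<longlonglongrightarrow> 0"
        using tendsto_mult[OF LIMSEQ_realpow_zero[of "norm \<alpha>"] tendsto_const[of 4]] norm_\<alpha>_le by simp
    qed
    then have "(\<lambda>n. w - \<alpha> ^ n * z n) \<longlonglongrightarrow> w - 0" by (intro tendsto_diff tendsto_const)
    moreover have "w - \<alpha> ^ n * z n = (\<Sum>k<n. of_nat (d (int k + 2)) * \<alpha> ^ k)" for n using part[of n] by (simp add: algebra_simps)
    ultimately show "(\<lambda>n. of_nat (d (int n + 2)) * \<alpha> ^ n) sums w" unfolding sums_def by simp
  qed
qed

lemma admissible_iff:
  "admissible d \<longleftrightarrow> d 1 = 0 \<and> d 0 = 0 \<and> d (-1) = 0 \<and> (\<forall>i\<ge>2. allowed (d i) (d (i - 1)) (d (i - 2)) (d (i - 3)))"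
proof -
  have lex: "([e, a, b, c], [1, 1, 0, 1]) \<in> lexord less_than \<longleftrightarrow> (e = 1 \<longrightarrow> a = 1 \<longrightarrow> b = 0 \<and> c = 0)"
    if "e \<in> {0, 1}" "a \<in> {0, 1}" "b \<in> {0, 1}" "c \<in> {0, 1}" for e a b c :: nat
    using that by auto
  have dig: "d i \<in> {0, 1}" if "d 1 = 0" "d 0 = 0" "d (-1) = 0" "\<forall>i\<ge>2. d i \<in> {0, 1}" "-1 \<le> i" for i
  proof (cases "2 \<le> i")
    case False
    then have "i = -1 \<or> i = 0 \<or> i = 1" using that(5) by auto
    then show ?thesis using that by auto
  qed (use that(4) in blast)
  show ?thesis
  proof
    assume ad: "admissible d"
    then have z: "d 1 = 0" "d 0 = 0" "d (-1) = 0" and b: "\<forall>i\<ge>2. d i \<in> {0, 1}" by (auto simp: admissible_def)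
    have "allowed (d i) (d (i - 1)) (d (i - 2)) (d (i - 3))" if "2 \<le> i" for i
      using ad that lex[of "d i" "d (i - 1)" "d (i - 2)" "d (i - 3)"] dig[OF z b] unfolding admissible_def allowed_def by auto
    then show "d 1 = 0 \<and> d 0 = 0 \<and> d (-1) = 0 \<and> (\<forall>i\<ge>2. allowed (d i) (d (i - 1)) (d (i - 2)) (d (i - 3)))"
      using z by blast
  next
    assume al: "d 1 = 0 \<and> d 0 = 0 \<and> d (-1) = 0 \<and> (\<forall>i\<ge>2. allowed (d i) (d (i - 1)) (d (i - 2)) (d (i - 3)))"
    then have z: "d 1 = 0" "d 0 = 0" "d (-1) = 0" and b: "\<forall>i\<ge>2. d i \<in> {0, 1}" by (auto simp: allowed_def)
    have "([d i, d (i - 1), d (i - 2), d (i - 3)], [1, 1, 0, 1]) \<in> lexord less_than" if "2 \<le> i" for i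
      using al that lex[of "d i" "d (i - 1)" "d (i - 2)" "d (i - 3)"] dig[OF z b] unfolding allowed_def by auto
    then show "admissible d" unfolding admissible_def using z b by blast
  qed
qed

text \<open>Before the first digit the three previous digits count as \<open>0\<close>. As \<open>tail_set 0 0 0 = C \<union> (1 + \<alpha> + \<alpha>\<^sup>3 C)\<close>,
one factor \<open>\<alpha>\<close> of \<open>\<alpha>\<^sup>2\<close> turns these two sets into \<open>f\<^sub>1 C\<close> and \<open>f\<^sub>3 C\<close>.\<close>
lemma rauzy_eq: "rauzy_fractal_R2 \<alpha> = (\<lambda>w. \<alpha> * w) ` (f P1 ` C \<union> f P3 ` C)"
proof -
  have tail: "(\<lambda>w. \<alpha>\<^sup>2 * w) ` tail_set 0 0 0 = (\<lambda>w. \<alpha> * w) ` (f P1 ` C \<union> f P3 ` C)"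
  proof -
    have "f P1 ` C \<union> f P3 ` C = (\<lambda>w. \<alpha> * w) ` tail_set 0 0 0"
      by (simp add: tail_set_def image_Un image_image f_simps power_numeral_reduce algebra_simps)
    then show ?thesis by (simp add: image_image power2_eq_square mult.assoc)
  qed
  have shift: "(\<lambda>n. of_nat (d (int n + 2)) * \<alpha> ^ (n + 2)) sums (\<alpha>\<^sup>2 * w) \<longleftrightarrow> (\<lambda>n. of_nat (d (int n + 2)) * \<alpha> ^ n) sums w"
    for d :: "int \<Rightarrow> nat" and w
  proof -
    have "(\<lambda>n. of_nat (d (int n + 2)) * \<alpha> ^ (n + 2)) = (\<lambda>n. \<alpha>\<^sup>2 * (of_nat (d (int n + 2)) * \<alpha> ^ n))"
      by (simp add: power_add power2_eq_square algebra_simps)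
    then show ?thesis using \<alpha>_nz by (simp add: sums_mult_iff)
  qed
  have "rauzy_fractal_R2 \<alpha> = (\<lambda>w. \<alpha>\<^sup>2 * w) ` tail_set 0 0 0"
  proof (intro equalityI subsetI)
    fix z assume "z \<in> rauzy_fractal_R2 \<alpha>"
    then obtain d where d: "admissible d" "(\<lambda>n. of_nat (d (int n + 2)) * \<alpha> ^ (n + 2)) sums z"
      unfolding rauzy_fractal_R2_def by blast
    have z: "z = \<alpha>\<^sup>2 * (z / \<alpha>\<^sup>2)" using \<alpha>_nz by simp
    have "(\<lambda>n. of_nat (d (int n + 2)) * \<alpha> ^ n) sums (z / \<alpha>\<^sup>2)"
      using d(2) shift[of d "z / \<alpha>\<^sup>2"] z by simp
    then have "z / \<alpha>\<^sup>2 \<in> tail_set 0 0 0"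
      using d(1)[unfolded admissible_iff] by (intro digit_sums_subset[of d]) auto
    then show "z \<in> (\<lambda>w. \<alpha>\<^sup>2 * w) ` tail_set 0 0 0" using z by blast
  next
    fix z assume "z \<in> (\<lambda>w. \<alpha>\<^sup>2 * w) ` tail_set 0 0 0"
    then obtain w where w: "w \<in> tail_set 0 0 0" "z = \<alpha>\<^sup>2 * w" by blast
    obtain d where d: "\<And>i. 2 \<le> i \<Longrightarrow> allowed (d i) (d (i - 1)) (d (i - 2)) (d (i - 3))" "\<And>i. i < 2 \<Longrightarrow> d i = 0"
      "(\<lambda>n. of_nat (d (int n + 2)) * \<alpha> ^ n) sums w" using tail_set_digits[OF w(1)] by blast
    have "admissible d" unfolding admissible_iff using d(1,2) by simp
    then show "z \<in> rauzy_fractal_R2 \<alpha>"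
      unfolding rauzy_fractal_R2_def using d(3) w(2) shift[of d w] by blast
  qed
  then show ?thesis using tail by simp
qed

end

theorem mainTheorem2:
  fixes \<alpha> :: complex
  assumes "\<alpha> ^ 3 - 2 * \<alpha> ^ 2 + \<alpha> - 1 = 0"
    and "\<alpha> \<notin> \<real>"
  shows "rauzy_fractal_R2 \<alpha> homeomorphic {z::complex. norm z \<le> 1}"
proof -
  interpret cubic_root \<alpha> by unfold_locales (use assms in auto)
  let ?K = "f P1 ` C \<union> f P3 ` C"
  have "compact ?K" using two_pieces_disc homeomorphic_compactness compact_cball by blast
  then have "?K homeomorphic rauzy_fractal_R2 \<alpha>"
  proof (rule homeomorphic_compact)
    show "(\<lambda>w. \<alpha> * w) ` ?K = rauzy_fractal_R2 \<alpha>" by (rule rauzy_eq[symmetric])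
    show "inj_on (\<lambda>w. \<alpha> * w) ?K" using \<alpha>_nz by (intro inj_onI) simp
  qed (intro continuous_intros)
  then have "rauzy_fractal_R2 \<alpha> homeomorphic ?K" using homeomorphic_sym by blast
  then have "rauzy_fractal_R2 \<alpha> homeomorphic cball (0::complex) 1" by (rule homeomorphic_trans[OF _ two_pieces_disc])
  moreover have "cball (0::complex) 1 = {z. norm z \<le> 1}" by (auto simp: dist_norm)
  ultimately show ?thesis by simp
qed

end
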